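(* Let $d\in\{2,3\}$, let $\Omega\subset\mathbb{R}^d$ be a polyhedral (polygonal) domain, and let $\mathcal{T}_0,\mathcal{T}_1,\dots$ be a sequence of triangulations of $\Omega$ produced by local red-green refinement as described in the context, with linear finite element spaces $\mathcal{S}_0\subset\mathcal{S}_1\subset\cdots\subset H_0^1(\Omega)$ and $L_2$-orthogonal projections $Q_j:L_2(\Omega)\to\mathcal{S}_j$. Then the $L_2$-projection restricted to the finite element spaces is $H^1$-stable: there exists a constant $c$, independent of $k$, $J$ and $u$, such that $$\|Q_ku\|_{H^1(\Omega)}\le c\,\|u\|_{H^1(\Omega)}\qquad\forall\, J\ge0,\ \forall u\in\mathcal{S}_J,\ \forall\,0\le k\le J .$$
   Context: Triangulations. Each $\mathcal{T}_j$ is a finite collection of simplices (triangles if $d=2$, tetrahedra if $d=3$) with mutually disjoint interiors whose union covers (the closure of) $\Omega$. $\mathcal{T}_0$ is conforming, shape regular and quasiuniform. $\mathcal{T}_{j+1}$ is obtained from $\mathcal{T}_j$ by refining some of its simplices; the resulting simplices are the sons, the refined simplex is their father (an unrefined simplex is carried over unchanged). Regular (red) refinement: for $d=2$, division of a triangle into 4 congruent triangles by joining edge midpoints; for $d=3$, bisection of all six edges and division into 8 subtetrahedra of equal volume, four corner subtetrahedra similar to the father being cut off and the remaining octahedron being cut into four tetrahedra using one diagonal chosen so that successive refinements remain nondegenerate. Irregular (green) refinement, used to restore conformity: for $d=2$, bisection of a triangle by joining the midpoint of one edge to the opposite vertex; for $d=3$, a subdivision into tetrahedra with corners among the vertices and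 edge midpoints of the father in which at least one, but not all six, edges are refined. Sons of an irregular refinement are called irregular. The level of a simplex is $L(\tau)=\min\{j:\tau\in\mathcal{T}_j\}$. The refinement obeys: (1) Nestedness: each $\tau\in\mathcal{T}_j$ is covered by exactly one $\tau'\in\mathcal{T}_{j-1}$, and any corner of $\tau$ is a corner or an edge midpoint of $\tau'$. (2) Conformity: the intersection of any two simplices in $\mathcal{T}_j$ is empty or a common lower-dimensional face (vertex, edge, or, for $d=3$, face). (3) Nondegeneracy: the interior angles of all simplices in all $\mathcal{T}_j$ are bounded away from zero (uniform shape regularity). (4) Irregular simplices are not refined further. (5) Only $\tau\in\mathcal{T}_j$ with $L(\tau)=j$ are refined in the construction of $\mathcal{T}_{j+1}$. (6) (For $d=3$) if three or more edges of a tetrahedron are refined and do not belong to a common face, then the tetrahedron is refined regularly. $\mathcal{S}_j$ is the space of continuous functions that are affine on each simplex of $\mathcal{T}_j$ and vanish on $\partial\Omega$. *)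

theory Defs
  imports "HOL-Analysis.Analysis"
begin

section \<open>Polyhedral domains and partitions into simplices\<close>

text \<open>Requiring \<open>\<Omega>\<close> to be the interior of its closure excludes cracks, and more importantly
  removed lower-dimensional sets such as points, on which Sobolev functions of order 1 have no trace.
  No Lipschitz condition is imposed.\<close>

definition polyhedral_domain :: "'a::euclidean_space set \<Rightarrow> bool" where
  "polyhedral_domain \<Omega> \<longleftrightarrow>
     open \<Omega> \<and> connected \<Omega> \<and> \<Omega> \<noteq> {} \<and> \<Omega> = interior (closure \<Omega>) \<and>
     (\<exists>P. finite P \<and> (\<forall>p\<in>P. polytope p) \<and> closure \<Omega> = \<Union>P)"

text \<open>Simplices are closed sets (convex hulls of their corners).\<close>

definition simplicial_partition :: "'a::euclidean_space set \<Rightarrow> 'a set set \<Rightarrow> bool" where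
  "simplicial_partition K R \<longleftrightarrow>
     finite R \<and> (\<forall>\<tau>\<in>R. int DIM('a) simplex \<tau>) \<and>
     pairwise (\<lambda>\<sigma> \<tau>. interior \<sigma> \<inter> interior \<tau> = {}) R \<and> \<Union>R = K"

text \<open>The empty set is a face, so that disjoint simplices are covered.\<close>

definition conforming :: "'a::euclidean_space set set \<Rightarrow> bool" where
  "conforming R \<longleftrightarrow>
     (\<forall>\<sigma>\<in>R. \<forall>\<tau>\<in>R. \<sigma> \<noteq> \<tau> \<longrightarrow>
        (\<sigma> \<inter> \<tau>) face_of \<sigma> \<and> (\<sigma> \<inter> \<tau>) face_of \<tau> \<and> aff_dim (\<sigma> \<inter> \<tau>) < int DIM('a))"

definition corners :: "'a::euclidean_space set \<Rightarrow> 'a set" where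
  "corners \<tau> = {v. v extreme_point_of \<tau>}"

definition edge_midpoints :: "'a::euclidean_space set \<Rightarrow> 'a set" where
  "edge_midpoints \<tau> = {midpoint a b | a b. closed_segment a b edge_of \<tau>}"

section \<open>Shape regularity\<close>

definition vec_angle :: "'a::real_inner \<Rightarrow> 'a \<Rightarrow> real" where
  "vec_angle v w = arccos (v \<bullet> w / (norm v * norm w))"

definition orth_part :: "'a::real_inner \<Rightarrow> 'a \<Rightarrow> 'a" where
  "orth_part t w = w - ((w \<bullet> t) / (t \<bullet> t)) *\<^sub>R t"

text \<open>Interior dihedral angle, at the edge from \<open>a\<close> to \<open>b\<close>, between the faces through
  \<open>c\<close> and through \<open>e\<close>.\<close>

definition dihedral_angle :: "'a::real_inner \<Rightarrow> 'a \<Rightarrow> 'a \<Rightarrow> 'a \<Rightarrow> real" where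
  "dihedral_angle a b c e =
     vec_angle (orth_part (b - a) (c - a)) (orth_part (b - a) (e - a))"

text \<open>The interior angles of a triangle are those at its corners. Those of a tetrahedron are
  the angles of its faces and its dihedral angles; bounding only one of the two kinds would
  admit degenerating tetrahedra (slivers, respectively needles). For a triangle the
  condition on dihedral angles is void.\<close>

definition interior_angles_ge :: "real \<Rightarrow> 'a::euclidean_space set \<Rightarrow> bool" where
  "interior_angles_ge \<alpha> \<tau> \<longleftrightarrow>
     (\<forall>a b c. {a, b, c} \<subseteq> corners \<tau> \<and> distinct [a, b, c] \<longrightarrow>
        \<alpha> \<le> vec_angle (b - a) (c - a)) \<and>
     (\<forall>a b c e. {a, b, c, e} \<subseteq> corners \<tau> \<and> distinct [a, b, c, e] \<longrightarrow>
        \<alpha> \<le> dihedral_angle a b c e)"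

definition shape_regular :: "'a::euclidean_space set set \<Rightarrow> bool" where
  "shape_regular R \<longleftrightarrow> (\<exists>\<alpha>>0. \<forall>\<tau>\<in>R. interior_angles_ge \<alpha> \<tau>)"

definition quasiuniform :: "'a::euclidean_space set set \<Rightarrow> bool" where
  "quasiuniform R \<longleftrightarrow> (\<exists>C. \<forall>\<sigma>\<in>R. \<forall>\<tau>\<in>R. diameter \<sigma> \<le> C * diameter \<tau>)"

section \<open>Regular (red) and irregular (green) refinement\<close>

definition red_triangle :: "'a::euclidean_space \<Rightarrow> 'a \<Rightarrow> 'a \<Rightarrow> 'a set set" where
  "red_triangle a b c =
     {convex hull {a, midpoint a b, midpoint a c},
      convex hull {b, midpoint a b, midpoint b c},
      convex hull {c, midpoint a c, midpoint b c},
      convex hull {midpoint a b, midpoint a c, midpoint b c}}"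

text \<open>The inner octahedron is cut along the diagonal from the midpoint of \<open>ab\<close> to that of
  \<open>ce\<close>; its other four vertices, in cyclic order, are the midpoints of
  \<open>ac\<close>, \<open>bc\<close>, \<open>be\<close>, \<open>ae\<close>. Relabelling the corners gives the other two diagonals.\<close>

definition red_tetrahedron :: "'a::euclidean_space \<Rightarrow> 'a \<Rightarrow> 'a \<Rightarrow> 'a \<Rightarrow> 'a set set" where
  "red_tetrahedron a b c e =
     {convex hull {a, midpoint a b, midpoint a c, midpoint a e},
      convex hull {b, midpoint a b, midpoint b c, midpoint b e},
      convex hull {c, midpoint a c, midpoint b c, midpoint c e},
      convex hull {e, midpoint a e, midpoint b e, midpoint c e},
      convex hull {midpoint a b, midpoint c e, midpoint a c, midpoint b c},
      convex hull {midpoint a b, midpoint c e, midpoint b c, midpoint b e},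
      convex hull {midpoint a b, midpoint c e, midpoint b e, midpoint a e},
      convex hull {midpoint a b, midpoint c e, midpoint a e, midpoint a c}}"

definition regular_refinement :: "'a::euclidean_space set \<Rightarrow> 'a set set \<Rightarrow> bool" where
  "regular_refinement \<tau> R \<longleftrightarrow>
     (DIM('a) = 2 \<and>
        (\<exists>a b c. distinct [a, b, c] \<and> corners \<tau> = {a, b, c} \<and> R = red_triangle a b c)) \<or>
     (DIM('a) = 3 \<and>
        (\<exists>a b c e. distinct [a, b, c, e] \<and> corners \<tau> = {a, b, c, e} \<and>
           R = red_tetrahedron a b c e))"

text \<open>Edges of \<open>\<tau>\<close> that are bisected when \<open>\<tau>\<close> is replaced by the simplices in \<open>R\<close>.\<close>

definition refined_edges :: "'a::euclidean_space set \<Rightarrow> 'a set set \<Rightarrow> 'a set set" where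
  "refined_edges \<tau> R =
     {closed_segment a b | a b.
        closed_segment a b edge_of \<tau> \<and> midpoint a b \<in> (\<Union>\<sigma>\<in>R. corners \<sigma>)}"

definition irregular_refinement :: "'a::euclidean_space set \<Rightarrow> 'a set set \<Rightarrow> bool" where
  "irregular_refinement \<tau> R \<longleftrightarrow>
     (DIM('a) = 2 \<and>
        (\<exists>a b c. distinct [a, b, c] \<and> corners \<tau> = {a, b, c} \<and>
           R = {convex hull {a, midpoint a b, c}, convex hull {b, midpoint a b, c}})) \<or>
     (DIM('a) = 3 \<and>
        simplicial_partition \<tau> R \<and>
        (\<forall>\<sigma>\<in>R. corners \<sigma> \<subseteq> corners \<tau> \<union> edge_midpoints \<tau>) \<and>
        refined_edges \<tau> R \<noteq> {} \<and> refined_edges \<tau> R \<noteq> {e. e edge_of \<tau>})"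

section \<open>Sequences of triangulations\<close>

definition sons :: "(nat \<Rightarrow> 'a set set) \<Rightarrow> nat \<Rightarrow> 'a set \<Rightarrow> 'a set set" where
  "sons T j \<tau> = {\<sigma> \<in> T (Suc j). \<sigma> \<subseteq> \<tau>}"

text \<open>A simplex of \<open>T j\<close> that is carried over to \<open>T (Suc j)\<close> has itself as its only son.\<close>

definition is_refined :: "(nat \<Rightarrow> 'a set set) \<Rightarrow> nat \<Rightarrow> 'a set \<Rightarrow> bool" where
  "is_refined T j \<tau> \<longleftrightarrow> \<tau> \<in> T j \<and> sons T j \<tau> \<noteq> {\<tau>}"

definition level :: "(nat \<Rightarrow> 'a set set) \<Rightarrow> 'a set \<Rightarrow> nat" where
  "level T \<tau> = (LEAST j. \<tau> \<in> T j)"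

definition irregular_simplex :: "(nat \<Rightarrow> 'a::euclidean_space set set) \<Rightarrow> 'a set \<Rightarrow> bool" where
  "irregular_simplex T \<sigma> \<longleftrightarrow>
     (\<exists>i. \<exists>\<tau>\<in>T i. irregular_refinement \<tau> (sons T i \<tau>) \<and> \<sigma> \<in> sons T i \<tau>)"

locale red_green_refinement =
  fixes \<Omega> :: "'a::euclidean_space set" and T :: "nat \<Rightarrow> 'a set set"
  assumes partition: "\<And>j. simplicial_partition (closure \<Omega>) (T j)"
    and initial: "conforming (T 0)" "shape_regular (T 0)" "quasiuniform (T 0)"
    and refinement: "\<And>j \<tau>. is_refined T j \<tau> \<Longrightarrow>
          regular_refinement \<tau> (sons T j \<tau>) \<or> irregular_refinement \<tau> (sons T j \<tau>)"
    and nested: "\<And>j \<sigma>. \<sigma> \<in> T (Suc j) \<Longrightarrow> \<exists>!\<tau>. \<tau> \<in> T j \<and> \<sigma> \<subseteq> \<tau>"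
    and nested_corners: "\<And>j \<sigma> \<tau>. \<sigma> \<in> T (Suc j) \<Longrightarrow> \<tau> \<in> T j \<Longrightarrow> \<sigma> \<subseteq> \<tau> \<Longrightarrow>
          corners \<sigma> \<subseteq> corners \<tau> \<union> edge_midpoints \<tau>"
    and conformity: "\<And>j. conforming (T j)"
    and nondegenerate: "shape_regular (\<Union>j. T j)"
    and irregular_not_refined: "\<And>j \<tau>. irregular_simplex T \<tau> \<Longrightarrow> \<not> is_refined T j \<tau>"
    and refined_level: "\<And>j \<tau>. is_refined T j \<tau> \<Longrightarrow> level T \<tau> = j"
    and three_edges: "\<And>j \<tau>. DIM('a) = 3 \<Longrightarrow> \<tau> \<in> T j \<Longrightarrow>
          3 \<le> card (refined_edges \<tau> (sons T j \<tau>)) \<Longrightarrow>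
          \<not> (\<exists>F. F facet_of \<tau> \<and> (\<forall>e \<in> refined_edges \<tau> (sons T j \<tau>). e \<subseteq> F)) \<Longrightarrow>
          regular_refinement \<tau> (sons T j \<tau>)"

section \<open>Function spaces\<close>

definition l2_fun :: "'a::euclidean_space set \<Rightarrow> ('a \<Rightarrow> 'b::euclidean_space) \<Rightarrow> bool" where
  "l2_fun \<Omega> f \<longleftrightarrow>
     f \<in> borel_measurable (lebesgue_on \<Omega>) \<and> integrable (lebesgue_on \<Omega>) (\<lambda>x. (norm (f x))\<^sup>2)"

definition l2_inner ::
    "'a::euclidean_space set \<Rightarrow> ('a \<Rightarrow> 'b::euclidean_space) \<Rightarrow> ('a \<Rightarrow> 'b) \<Rightarrow> real" where
  "l2_inner \<Omega> f g = integral\<^sup>L (lebesgue_on \<Omega>) (\<lambda>x. f x \<bullet> g x)"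

text \<open>\<open>\<phi>\<close> is continuously differentiable with gradient \<open>\<psi>\<close>, and its support is a compact
  subset of \<open>\<Omega>\<close>.\<close>

definition test_function ::
    "'a::euclidean_space set \<Rightarrow> ('a \<Rightarrow> real) \<Rightarrow> ('a \<Rightarrow> 'a) \<Rightarrow> bool" where
  "test_function \<Omega> \<phi> \<psi> \<longleftrightarrow>
     (\<forall>x. GDERIV \<phi> x :> \<psi> x) \<and> continuous_on UNIV \<psi> \<and>
     (\<exists>K. compact K \<and> K \<subseteq> \<Omega> \<and> (\<forall>x. x \<notin> K \<longrightarrow> \<phi> x = 0))"

text \<open>Square integrable weak gradients. As in Gilbarg and Trudinger, first-order weak derivatives
  are tested with continuously differentiable functions; by mollification this agrees with
  testing with smooth functions.\<close>

definition has_weak_gradient ::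
    "'a::euclidean_space set \<Rightarrow> ('a \<Rightarrow> real) \<Rightarrow> ('a \<Rightarrow> 'a) \<Rightarrow> bool" where
  "has_weak_gradient \<Omega> u g \<longleftrightarrow>
     l2_fun \<Omega> u \<and> l2_fun \<Omega> g \<and>
     (\<forall>\<phi> \<psi>. test_function \<Omega> \<phi> \<psi> \<longrightarrow>
        integral\<^sup>L (lebesgue_on \<Omega>) (\<lambda>x. u x *\<^sub>R \<psi> x) =
        - integral\<^sup>L (lebesgue_on \<Omega>) (\<lambda>x. \<phi> x *\<^sub>R g x))"

text \<open>Weak gradients are unique up to null sets, so the choice does not affect the norm, which
  is meaningful for those \<open>u\<close> that have a weak gradient.\<close>

definition weak_gradient :: "'a::euclidean_space set \<Rightarrow> ('a \<Rightarrow> real) \<Rightarrow> 'a \<Rightarrow> 'a" where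
  "weak_gradient \<Omega> u = (SOME g. has_weak_gradient \<Omega> u g)"

definition h1_norm :: "'a::euclidean_space set \<Rightarrow> ('a \<Rightarrow> real) \<Rightarrow> real" where
  "h1_norm \<Omega> u =
     sqrt (l2_inner \<Omega> u u + l2_inner \<Omega> (weak_gradient \<Omega> u) (weak_gradient \<Omega> u))"

text \<open>Finite element functions are extended by zero to the whole space, so that a function on
  the closure of \<open>\<Omega>\<close> has a unique representative.\<close>

definition fe_space :: "'a::euclidean_space set \<Rightarrow> 'a set set \<Rightarrow> ('a \<Rightarrow> real) set" where
  "fe_space \<Omega> R =
     {u. continuous_on (closure \<Omega>) u \<and>
         (\<forall>\<tau>\<in>R. \<exists>a b. \<forall>x\<in>\<tau>. u x = a \<bullet> x + b) \<and>
         (\<forall>x\<in>frontier \<Omega>. u x = 0) \<and> (\<forall>x. x \<notin> closure \<Omega> \<longrightarrow> u x = 0)}"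

text \<open>The orthogonal projection of \<open>u\<close> onto the subspace \<open>S\<close>.\<close>

definition l2_projection ::
    "'a::euclidean_space set \<Rightarrow> ('a \<Rightarrow> real) set \<Rightarrow> ('a \<Rightarrow> real) \<Rightarrow> 'a \<Rightarrow> real" where
  "l2_projection \<Omega> S u =
     (THE w. w \<in> S \<and> (\<forall>v\<in>S. l2_inner \<Omega> (\<lambda>x. u x - w x) v = 0))"

end

theory Submission
  imports Defs
begin

text \<open>Write \<open>h = 2 ^ - k\<close>. For \<open>u\<close> in the fine space \<open>S J\<close> there is \<open>w\<close> in the coarse space \<open>S k\<close> with
  \<open>norm (u - w) / h + norm (grad w) \<le> C * norm (grad u)\<close> in \<open>L2\<close>. Combined with the inverse estimate on
  \<open>S k\<close> and with \<open>norm (Q k u - w) \<le> norm (u - w)\<close>, this bounds the gradient of \<open>Q k u\<close>.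

  Although the meshes are not quasiuniform, the uniform scale \<open>h\<close> suffices. Every simplex of \<open>T k\<close> has
  diameter at least a multiple of \<open>h\<close>, which gives the inverse estimate. A simplex of \<open>T k\<close> that is
  still refined later has level \<open>k\<close>, hence diameter at most a multiple of \<open>h\<close>; on the remaining ones \<open>u\<close> is
  affine and \<open>w\<close> is chosen equal to \<open>u\<close>. The error of the local averages that define \<open>w\<close>
  is controlled pointwise by the mean oscillation of \<open>u\<close>, extended by zero, over balls of radius
  comparable to \<open>h\<close>, and the integral of the latter by the estimate
  \<open>norm (u (\<cdot> + z) - u) \<le> norm z * norm (grad u)\<close> in the whole space. At a boundary vertex, where
  \<open>w\<close> is zero, the role of the averaging domain is played by a ball outside \<open>\<Omega>\<close> at the scale \<open>h\<close>.\<close>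

section \<open>Weak gradients of Lipschitz functions\<close>

lemma integrable_bounded_support:
  fixes f :: "'a::euclidean_space \<Rightarrow> 'b::{banach, second_countable_topology}"
  assumes [measurable]: "f \<in> borel_measurable borel"
    and "\<And>x. norm (f x) \<le> C" and "\<And>x. B < norm x \<Longrightarrow> f x = 0"
  shows "integrable lborel f"
proof (rule Bochner_Integration.integrable_bound)
  show "integrable lborel (\<lambda>x. C * indicat_real (cball (0::'a) B) x)"
    by (intro integrable_mult_right integrable_real_indicator) (auto simp: emeasure_bounded_finite[unfolded infinity_ennreal_def])
  show "AE x in lborel. norm (f x) \<le> norm (C * indicat_real (cball (0::'a) B) x)"
    using assms(2,3) by (auto simp: indicator_def not_le intro!: AE_I2) (metis abs_ge_self order_trans)
qed simp

definition has_ae_gradient :: "('a::euclidean_space \<Rightarrow> real) \<Rightarrow> ('a \<Rightarrow> 'a) \<Rightarrow> bool" where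
  "has_ae_gradient u g \<longleftrightarrow>
     (\<exists>L. L-lipschitz_on UNIV u) \<and> g \<in> borel_measurable borel \<and> (\<exists>C. \<forall>x. norm (g x) \<le> C) \<and>
     (\<exists>B. \<forall>x. B < norm x \<longrightarrow> u x = 0 \<and> g x = 0) \<and> (AE x in lborel. GDERIV u x :> g x)"

lemma has_ae_gradient_continuous:
  "has_ae_gradient u g \<Longrightarrow> continuous_on A u"
  unfolding has_ae_gradient_def
  using lipschitz_on_continuous_on continuous_on_subset by blast

lemma has_ae_gradient_bounded:
  assumes "has_ae_gradient u g"
  obtains C B where "\<And>x. \<bar>u x\<bar> \<le> C" "\<And>x. norm (g x) \<le> C" "\<And>x. B < norm x \<Longrightarrow> u x = 0"
     "\<And>x. B < norm x \<Longrightarrow> g x = 0"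
proof -
  obtain B where B: "\<And>x. B < norm x \<Longrightarrow> u x = 0 \<and> g x = 0"
    using assms unfolding has_ae_gradient_def by blast
  obtain C where C: "\<And>x. norm (g x) \<le> C"
    using assms unfolding has_ae_gradient_def by blast
  have "compact (u ` cball 0 B)"
    by (intro compact_continuous_image has_ae_gradient_continuous[OF assms]) auto
  then obtain D where D: "\<And>x. norm x \<le> B \<Longrightarrow> \<bar>u x\<bar> \<le> D"
    using that by (fastforce simp: bounded_iff dest!: compact_imp_bounded)
  have "0 \<le> C" using C[of 0] norm_ge_zero order_trans by blast
  show thesis
  proof
    show "\<bar>u x\<bar> \<le> max C D" for x
      using D[of x] B[of x] \<open>0 \<le> C\<close> by (cases "norm x \<le> B") auto
    show "norm (g x) \<le> max C D" for x using C[of x] by auto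
  qed (use B in auto)
qed

lemma tendsto_difference_quotient:
  fixes u :: "'a::euclidean_space \<Rightarrow> real"
  assumes "GDERIV u x :> d"
  shows "(\<lambda>n. real (Suc n) * (u (x + (1 / real (Suc n)) *\<^sub>R e) - u x)) \<longlonglongrightarrow> d \<bullet> e"
proof -
  have "((\<lambda>t. u (x + t *\<^sub>R e)) has_derivative (\<lambda>t. (t *\<^sub>R e) \<bullet> d)) (at 0)"
    using assms unfolding gderiv_def
    by (intro has_derivative_compose[of "\<lambda>t. x + t *\<^sub>R e" _ 0 UNIV u "\<lambda>h. h \<bullet> d", simplified])
       (auto intro!: derivative_eq_intros)
  then have "((\<lambda>t. u (x + t *\<^sub>R e)) has_field_derivative (e \<bullet> d)) (at 0)"
    by (simp add: has_field_derivative_def inner_commute mult.commute[of "d \<bullet> e"] mult_commute_abs)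
  then have lim: "((\<lambda>t. (u (x + t *\<^sub>R e) - u x) / t) \<longlongrightarrow> e \<bullet> d) (at 0)"
    by (simp add: has_field_derivative_iff)
  have "filterlim (\<lambda>n. 1 / real (Suc n)) (at 0) sequentially"
    unfolding filterlim_at using LIMSEQ_inverse_real_of_nat
    by (auto simp: divide_inverse)
  from filterlim_compose[OF lim this] show ?thesis
    by (simp add: inner_commute mult.commute)
qed

lemma has_ae_gradient_parts:
  fixes u v :: "'a::euclidean_space \<Rightarrow> real"
  assumes u: "has_ae_gradient u g" and v: "has_ae_gradient v g'"
  shows "(\<integral>x. u x * (g' x \<bullet> e) \<partial>lborel) = - (\<integral>x. v x * (g x \<bullet> e) \<partial>lborel)"
proof -
  have [measurable]: "u \<in> borel_measurable borel" "v \<in> borel_measurable borel"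
    using u v by (auto intro!: borel_measurable_continuous_onI has_ae_gradient_continuous)
  have [measurable]: "g \<in> borel_measurable borel" "g' \<in> borel_measurable borel"
    using u v by (auto simp: has_ae_gradient_def)
  obtain Cu Bu where Cu: "\<And>x. \<bar>u x\<bar> \<le> Cu" "\<And>x. Bu < norm x \<Longrightarrow> u x = 0"
    using has_ae_gradient_bounded[OF u] by metis
  obtain Cv Bv where Cv: "\<And>x. \<bar>v x\<bar> \<le> Cv" "\<And>x. Bv < norm x \<Longrightarrow> v x = 0"
    using has_ae_gradient_bounded[OF v] by metis
  obtain Lu where Lu: "Lu-lipschitz_on UNIV u" using u by (auto simp: has_ae_gradient_def)
  obtain Lv where Lv: "Lv-lipschitz_on UNIV v" using v by (auto simp: has_ae_gradient_def)
  define s where "s n = (1 / real (Suc n)) *\<^sub>R e" for n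
  have quot: "\<bar>real (Suc n) * (w (x + c *\<^sub>R s n) - w x)\<bar> \<le> L * norm e"
    if "L-lipschitz_on UNIV w" "\<bar>c\<bar> = 1" for w :: "'a \<Rightarrow> real" and L n x c
  proof -
    have "\<bar>w (x + c *\<^sub>R s n) - w x\<bar> \<le> L * norm (s n)"
      using lipschitz_onD[OF that(1), of "x + c *\<^sub>R s n" x] that(2) by (simp add: dist_norm)
    then have "real (Suc n) * \<bar>w (x + c *\<^sub>R s n) - w x\<bar> \<le> real (Suc n) * (L * norm (s n))"
      by (intro mult_left_mono) auto
    also have "\<dots> = L * norm e"
      by (simp add: s_def field_simps)
    finally show ?thesis by (simp add: abs_mult)
  qed
  have int_bd: "\<bar>a * b\<bar> \<le> C * D" if "\<bar>a\<bar> \<le> C" "\<bar>b\<bar> \<le> D" for a b C D :: real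
    using that by (auto simp: abs_mult intro!: mult_mono)
  have int_uv: "integrable lborel (\<lambda>x. u (x + c) * v x)" for c
    by (rule integrable_bounded_support[where C="Cu * Cv" and B=Bv]) (auto simp: Cv int_bd Cu)
  have shift: "(\<integral>x. u (x + s n) * v x \<partial>lborel) = (\<integral>x. u x * v (x - s n) \<partial>lborel)" for n
  proof -
    have "(\<integral>x. u x * v (x - s n) \<partial>lborel) = (\<integral>x. u x * v (x - s n) \<partial>(distr lborel borel ((+) (s n))))"
      by (simp add: lborel_distr_plus)
    also have "\<dots> = (\<integral>x. u (x + s n) * v x \<partial>lborel)"
      by (subst integral_distr) (auto simp: add.commute)
    finally show ?thesis by simp
  qed
  have int_uv': "integrable lborel (\<lambda>x. u x * v (x - c))" for c
    by (rule integrable_bounded_support[where C="Cu * Cv" and B=Bu]) (auto simp: Cu int_bd Cv)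
  have eq: "(\<integral>x. v x * (real (Suc n) * (u (x + s n) - u x)) \<partial>lborel) =
      - (\<integral>x. u x * (- (real (Suc n) * (v (x - s n) - v x))) \<partial>lborel)" for n
  proof -
    have "(\<integral>x. v x * (real (Suc n) * (u (x + s n) - u x)) \<partial>lborel) =
       (\<integral>x. real (Suc n) * (u (x + s n) * v x - u (x + 0) * v x) \<partial>lborel)"
      by (intro Bochner_Integration.integral_cong) (auto simp: algebra_simps)
    also have "\<dots> = real (Suc n) * ((\<integral>x. u (x + s n) * v x \<partial>lborel) - (\<integral>x. u (x + 0) * v x \<partial>lborel))"
      using int_uv[of "s n"] int_uv[of 0]
      by (simp only: integral_mult_right_zero Bochner_Integration.integral_diff)
    also have "\<dots> = real (Suc n) * ((\<integral>x. u x * v (x - s n) \<partial>lborel) - (\<integral>x. u x * v (x - 0) \<partial>lborel))"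
      by (simp add: shift)
    also have "\<dots> = (\<integral>x. real (Suc n) * (u x * v (x - s n) - u x * v (x - 0)) \<partial>lborel)"
      using int_uv'[of "s n"] int_uv'[of 0]
      by (simp only: integral_mult_right_zero Bochner_Integration.integral_diff)
    also have "\<dots> = - (\<integral>x. u x * (- (real (Suc n) * (v (x - s n) - v x))) \<partial>lborel)"
      by (subst integral_minus[symmetric], intro Bochner_Integration.integral_cong) (auto simp: algebra_simps)
    finally show ?thesis .
  qed
  have lim1: "(\<lambda>n. \<integral>x. v x * (real (Suc n) * (u (x + s n) - u x)) \<partial>lborel) \<longlonglongrightarrow> (\<integral>x. v x * (g x \<bullet> e) \<partial>lborel)"
  proof (rule integral_dominated_convergence[where w="\<lambda>x. \<bar>v x\<bar> * (Lu * norm e)"])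
    show "integrable lborel (\<lambda>x. \<bar>v x\<bar> * (Lu * norm e))"
      by (intro integrable_mult_left integrable_bounded_support[where C=Cv and B=Bv]) (auto simp: Cv)
    show "AE x in lborel. (\<lambda>i. v x * (real (Suc i) * (u (x + s i) - u x))) \<longlonglongrightarrow> v x * (g x \<bullet> e)"
      using u unfolding has_ae_gradient_def s_def
      by (auto simp del: of_nat_Suc elim!: eventually_mono intro!: tendsto_mult_left tendsto_difference_quotient)
    show "AE x in lborel. norm (v x * (real (Suc i) * (u (x + s i) - u x))) \<le> \<bar>v x\<bar> * (Lu * norm e)" for i
      using quot[OF Lu, of 1 i] by (auto simp: abs_mult intro!: AE_I2 mult_left_mono)
  qed (simp_all add: s_def)
  have lim2: "(\<lambda>n. \<integral>x. u x * (- (real (Suc n) * (v (x - s n) - v x))) \<partial>lborel) \<longlonglongrightarrow> (\<integral>x. u x * (g' x \<bullet> e) \<partial>lborel)"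
  proof (rule integral_dominated_convergence[where w="\<lambda>x. \<bar>u x\<bar> * (Lv * norm e)"])
    show "integrable lborel (\<lambda>x. \<bar>u x\<bar> * (Lv * norm e))"
      by (intro integrable_mult_left integrable_bounded_support[where C=Cu and B=Bu]) (auto simp: Cu)
    have lim: "(\<lambda>n. - (real (Suc n) * (v (x - s n) - v x))) \<longlonglongrightarrow> g' x \<bullet> e" if "GDERIV v x :> g' x" for x
      using tendsto_minus[OF tendsto_difference_quotient[OF that, of "- e"]]
      by (simp add: s_def)
    have "AE x in lborel. GDERIV v x :> g' x"
      using v unfolding has_ae_gradient_def by blast
    then show "AE x in lborel. (\<lambda>i. u x * (- (real (Suc i) * (v (x - s i) - v x)))) \<longlonglongrightarrow> u x * (g' x \<bullet> e)"
      by eventually_elim (intro tendsto_mult_left lim)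
    show "AE x in lborel. norm (u x * (- (real (Suc i) * (v (x - s i) - v x)))) \<le> \<bar>u x\<bar> * (Lv * norm e)" for i
      using quot[OF Lv, of "-1" i] by (auto simp: abs_mult intro!: AE_I2 mult_left_mono)
  qed (simp_all add: s_def)
  show ?thesis
    using LIMSEQ_unique[OF lim1[unfolded eq] tendsto_minus[OF lim2]] by simp
qed

text \<open>Splitting the translation into \<open>n\<close> equal steps reduces the estimate to difference quotients.\<close>

lemma has_ae_gradient_translation:
  fixes u :: "'a::euclidean_space \<Rightarrow> real"
  assumes u: "has_ae_gradient u g"
  shows "(\<integral>\<^sup>+x. ennreal ((u (x + z) - u x)\<^sup>2) \<partial>lborel) \<le>
     ennreal ((norm z)\<^sup>2) * (\<integral>\<^sup>+x. ennreal ((norm (g x))\<^sup>2) \<partial>lborel)"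
proof -
  have [measurable]: "u \<in> borel_measurable borel"
    using u by (auto intro!: borel_measurable_continuous_onI has_ae_gradient_continuous)
  have [measurable]: "g \<in> borel_measurable borel"
    using u by (auto simp: has_ae_gradient_def)
  obtain Cu Bu where Cu: "\<And>x. \<bar>u x\<bar> \<le> Cu" "\<And>x. Bu < norm x \<Longrightarrow> u x = 0"
    using has_ae_gradient_bounded[OF u] by metis
  obtain L where L: "L-lipschitz_on UNIV u" using u by (auto simp: has_ae_gradient_def)
  define s where "s n = (1 / real (Suc n)) *\<^sub>R z" for n
  have norm_s: "norm (s n) \<le> norm z" for n
    by (auto simp: s_def divide_simps mult_left_le_one_le) (simp add: algebra_simps)
  have step: "(\<integral>\<^sup>+x. ennreal ((u (x + z) - u x)\<^sup>2) \<partial>lborel) \<le>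
      (\<integral>\<^sup>+x. ennreal ((real (Suc n) * (u (x + s n) - u x))\<^sup>2) \<partial>lborel)" for n
  proof -
    define a where "a i x = u (x + real (Suc i) *\<^sub>R s n) - u (x + real i *\<^sub>R s n)" for i x
    have [measurable]: "a i \<in> borel_measurable borel" for i unfolding a_def by measurable
    have sum: "u (x + z) - u x = (\<Sum>i<Suc n. a i x)" for x
      unfolding a_def by (subst sum_lessThan_telescope) (simp add: s_def)
    have "(u (x + z) - u x)\<^sup>2 \<le> real (Suc n) * (\<Sum>i<Suc n. (a i x)\<^sup>2)" for x
    proof -
      have "(u (x + z) - u x)\<^sup>2 = (\<Sum>i<Suc n. 1 * a i x)\<^sup>2" by (simp add: sum)
      also have "\<dots> \<le> (\<Sum>i<Suc n. 1\<^sup>2) * (\<Sum>i<Suc n. (a i x)\<^sup>2)" by (rule Cauchy_Schwarz_ineq_sum)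
      finally show ?thesis by simp
    qed
    note bound = this
    have eq_a: "(\<integral>\<^sup>+x. ennreal ((a i x)\<^sup>2) \<partial>lborel) = (\<integral>\<^sup>+x. ennreal ((u (x + s n) - u x)\<^sup>2) \<partial>lborel)" for i
    proof -
      have "(\<integral>\<^sup>+x. ennreal ((u (x + s n) - u x)\<^sup>2) \<partial>lborel) =
        (\<integral>\<^sup>+x. ennreal ((u (x + s n) - u x)\<^sup>2) \<partial>(distr lborel borel ((+) (real i *\<^sub>R s n))))"
        by (simp add: lborel_distr_plus)
      also have "\<dots> = (\<integral>\<^sup>+x. ennreal ((a i x)\<^sup>2) \<partial>lborel)"
        by (subst nn_integral_distr) (auto simp: a_def algebra_simps intro!: nn_integral_cong)
      finally show ?thesis by simp
    qed
    from bound have "(\<integral>\<^sup>+x. ennreal ((u (x + z) - u x)\<^sup>2) \<partial>lborel) \<le>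
        (\<integral>\<^sup>+x. ennreal (real (Suc n)) * (\<Sum>i<Suc n. ennreal ((a i x)\<^sup>2)) \<partial>lborel)"
      by (intro nn_integral_mono)
        (simp only: sum_ennreal zero_le_power2 sum_nonneg ennreal_mult[symmetric] of_nat_0_le_iff, rule ennreal_leI)
    also have "\<dots> = ennreal (real (Suc n)) * (\<Sum>i<Suc n. \<integral>\<^sup>+x. ennreal ((a i x)\<^sup>2) \<partial>lborel)"
      by (subst nn_integral_cmult, measurable, subst nn_integral_sum) simp_all
    also have "\<dots> =
       ennreal ((real (Suc n))\<^sup>2) * (\<integral>\<^sup>+x. ennreal ((u (x + s n) - u x)\<^sup>2) \<partial>lborel)"
      unfolding eq_a
      by (simp only: sum_constant card_lessThan ennreal_of_nat_eq_real_of_nat power2_eq_square ennreal_mult'' mult.assoc of_nat_0_le_iff)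
    also have "\<dots> = (\<integral>\<^sup>+x. ennreal ((real (Suc n) * (u (x + s n) - u x))\<^sup>2) \<partial>lborel)"
      by (subst nn_integral_cmult[symmetric]) (auto simp: ennreal_mult'' power_mult_distrib simp del: of_nat_Suc)
    finally show ?thesis .
  qed
  have "(\<lambda>n. \<integral>\<^sup>+x. ennreal ((real (Suc n) * (u (x + s n) - u x))\<^sup>2) \<partial>lborel) \<longlonglongrightarrow>
     (\<integral>\<^sup>+x. ennreal ((g x \<bullet> z)\<^sup>2) \<partial>lborel)"
  proof (rule nn_integral_dominated_convergence[where w="\<lambda>x. ennreal ((L * norm z)\<^sup>2 * indicat_real (cball 0 (\<bar>Bu\<bar> + norm z)) x)"])
    show "(\<integral>\<^sup>+x. ennreal ((L * norm z)\<^sup>2 * indicat_real (cball (0::'a) (\<bar>Bu\<bar> + norm z)) x) \<partial>lborel) < \<infinity>"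
      by (simp add: ennreal_mult'' ennreal_indicator nn_integral_cmult_indicator ennreal_mult_less_top
          emeasure_bounded_finite[unfolded infinity_ennreal_def])
    show "AE x in lborel. (\<lambda>i. ennreal ((real (Suc i) * (u (x + s i) - u x))\<^sup>2)) \<longlonglongrightarrow> ennreal ((g x \<bullet> z)\<^sup>2)"
      using u unfolding has_ae_gradient_def s_def
      by (auto elim!: eventually_mono intro!: tendsto_ennrealI tendsto_power tendsto_difference_quotient simp del: of_nat_Suc)
    fix i
    show "AE x in lborel. ennreal ((real (Suc i) * (u (x + s i) - u x))\<^sup>2) \<le>
       ennreal ((L * norm z)\<^sup>2 * indicat_real (cball 0 (\<bar>Bu\<bar> + norm z)) x)"
    proof (intro AE_I2 ennreal_leI)
      fix x
      have "\<bar>u (x + s i) - u x\<bar> \<le> L * norm (s i)"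
        using lipschitz_onD[OF L, of "x + s i" x] by (simp add: dist_norm)
      then have "real (Suc i) * \<bar>u (x + s i) - u x\<bar> \<le> real (Suc i) * (L * norm (s i))"
        by (intro mult_left_mono) auto
      also have "\<dots> = L * norm z"
        by (simp add: s_def field_simps)
      finally have "\<bar>real (Suc i) * (u (x + s i) - u x)\<bar> \<le> \<bar>L * norm z\<bar>"
        using lipschitz_on_nonneg[OF L] by (simp add: abs_mult)
      then have 1: "(real (Suc i) * (u (x + s i) - u x))\<^sup>2 \<le> (L * norm z)\<^sup>2"
        by (rule power2_le_iff_abs_le[THEN iffD2, OF abs_ge_zero, unfolded power2_abs])
      show "(real (Suc i) * (u (x + s i) - u x))\<^sup>2 \<le> (L * norm z)\<^sup>2 * indicat_real (cball 0 (\<bar>Bu\<bar> + norm z)) x"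
      proof (cases "norm x \<le> \<bar>Bu\<bar> + norm z")
        case True then show ?thesis using 1 by simp
      next
        case False
        have "norm x \<le> norm (x + s i) + norm (s i)" using norm_triangle_ineq4[of "x + s i" "s i"] by simp
        with False norm_s[of i] norm_ge_zero[of z] have "Bu < norm x" "Bu < norm (x + s i)" by linarith+
        then show ?thesis by (simp add: Cu)
      qed
    qed
  qed (simp_all add: s_def borel_measurable_times borel_measurable_indicator)
  then have "(\<integral>\<^sup>+x. ennreal ((u (x + z) - u x)\<^sup>2) \<partial>lborel) \<le> (\<integral>\<^sup>+x. ennreal ((g x \<bullet> z)\<^sup>2) \<partial>lborel)"
    by (rule LIMSEQ_le_const) (use step in auto)
  also have "\<dots> \<le> (\<integral>\<^sup>+x. ennreal ((norm z)\<^sup>2) * ennreal ((norm (g x))\<^sup>2) \<partial>lborel)"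
  proof (rule nn_integral_mono)
    fix x
    have "(g x \<bullet> z)\<^sup>2 \<le> (norm (g x) * norm z)\<^sup>2"
      by (rule power2_le_iff_abs_le[THEN iffD2]) (auto simp: Cauchy_Schwarz_ineq2)
    then show "ennreal ((g x \<bullet> z)\<^sup>2) \<le> ennreal ((norm z)\<^sup>2) * ennreal ((norm (g x))\<^sup>2)"
      by (simp add: ennreal_mult[symmetric] power_mult_distrib mult.commute ennreal_leI)
  qed
  also have "\<dots> = ennreal ((norm z)\<^sup>2) * (\<integral>\<^sup>+x. ennreal ((norm (g x))\<^sup>2) \<partial>lborel)"
    by (rule nn_integral_cmult) simp
  finally show ?thesis .
qed

lemma GDERIV_unique:
  assumes "GDERIV f x :> d" "GDERIV f x :> d'"
  shows "d = d'"
proof -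
  have "(\<lambda>h. h \<bullet> d) = (\<lambda>h. h \<bullet> d')"
    using assms unfolding gderiv_def by (rule has_derivative_unique)
  then show ?thesis by (metis inner_commute vector_eq_ldot)
qed

lemma GDERIV_cong_open:
  assumes "GDERIV f x :> d" "open S" "x \<in> S" "\<And>y. y \<in> S \<Longrightarrow> g y = f y"
  shows "GDERIV g x :> d"
  using assms unfolding gderiv_def
  by (metis has_derivative_transform_within_open)

lemma test_function_has_ae_gradient:
  fixes \<phi> :: "'a::euclidean_space \<Rightarrow> real"
  assumes "test_function \<Omega> \<phi> \<psi>"
  shows "has_ae_gradient \<phi> \<psi>" "\<And>x. x \<notin> \<Omega> \<Longrightarrow> \<phi> x = 0" "\<And>x. x \<notin> \<Omega> \<Longrightarrow> \<psi> x = 0"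
proof -
  note t = assms[unfolded test_function_def]
  have d: "GDERIV \<phi> x :> \<psi> x" for x
    using t[THEN conjunct1] by (rule spec)
  note c = t[THEN conjunct2, THEN conjunct1]
  from t[THEN conjunct2, THEN conjunct2]
  obtain K where K0: "compact K \<and> K \<subseteq> \<Omega> \<and> (\<forall>x. x \<notin> K \<longrightarrow> \<phi> x = 0)"
    by (rule exE)
  have K: "compact K" "K \<subseteq> \<Omega>" "\<And>x. x \<notin> K \<Longrightarrow> \<phi> x = 0"
    using K0 by blast+
  have \<psi>0: "\<psi> x = 0" if "x \<notin> K" for x
  proof -
    have "GDERIV \<phi> x :> 0"
      using K that compact_imp_closed[of K]
      by (intro GDERIV_cong_open[where f="\<lambda>_. 0" and S="- K", OF GDERIV_const]) auto
    then show ?thesis using GDERIV_unique d by blast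
  qed
  obtain C where C: "\<And>x. x \<in> K \<Longrightarrow> norm (\<psi> x) \<le> C"
    using compact_imp_bounded[OF compact_continuous_image[OF continuous_on_subset[OF c] K(1)]]
    by (auto simp: bounded_iff)
  have C': "norm (\<psi> x) \<le> \<bar>C\<bar>" for x
    using C[of x] \<psi>0[of x] by (cases "x \<in> K") auto
  have "\<bar>C\<bar>-lipschitz_on UNIV \<phi>"
  proof (rule bounded_derivative_imp_lipschitz[where f'="\<lambda>x h. h \<bullet> \<psi> x"])
    show "onorm (\<lambda>h. h \<bullet> \<psi> x) \<le> \<bar>C\<bar>" for x
    proof (rule onorm_bound)
      fix h
      have "norm (h \<bullet> \<psi> x) \<le> norm h * norm (\<psi> x)" by (simp add: Cauchy_Schwarz_ineq2)
      also have "\<dots> \<le> norm h * \<bar>C\<bar>" by (intro mult_left_mono C') auto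
      finally show "norm (h \<bullet> \<psi> x) \<le> \<bar>C\<bar> * norm h" by (simp add: mult.commute)
    qed simp
  qed (use d in \<open>auto simp: gderiv_def intro: has_derivative_at_withinI\<close>)
  moreover obtain B where B: "\<And>x. x \<in> K \<Longrightarrow> norm x \<le> B"
    using compact_imp_bounded[OF K(1)] by (auto simp: bounded_iff)
  moreover have "\<forall>x. B < norm x \<longrightarrow> \<phi> x = 0 \<and> \<psi> x = 0"
    using K(3) \<psi>0 B by (meson not_le)
  moreover have "\<psi> \<in> borel_measurable borel"
    using c by (rule borel_measurable_continuous_onI)
  ultimately show "has_ae_gradient \<phi> \<psi>"
    unfolding has_ae_gradient_def using C' d by auto
  show "x \<notin> \<Omega> \<Longrightarrow> \<phi> x = 0" "x \<notin> \<Omega> \<Longrightarrow> \<psi> x = 0" for x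
    using K \<psi>0 by auto
qed

lemma integral_lebesgue_on_eq_lborel:
  fixes f :: "'a::euclidean_space \<Rightarrow> 'b::{banach, second_countable_topology}"
  assumes "\<Omega> \<in> sets lebesgue" and f: "f \<in> borel_measurable borel" and "\<And>x. x \<notin> \<Omega> \<Longrightarrow> f x = 0"
  shows "integral\<^sup>L (lebesgue_on \<Omega>) f = integral\<^sup>L lborel f"
proof -
  have "integral\<^sup>L (lebesgue_on \<Omega>) f = integral\<^sup>L lebesgue (\<lambda>x. indicator \<Omega> x *\<^sub>R f x)"
    using assms(1) by (intro integral_restrict_space) auto
  also have "(\<lambda>x. indicator \<Omega> x *\<^sub>R f x) = f"
    using assms(3) by (auto simp: indicator_def)
  also have "integral\<^sup>L lebesgue f = integral\<^sup>L lborel f"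
    using f by (intro integral_completion) auto
  finally show ?thesis .
qed

lemma l2_fun_bounded_support:
  fixes f :: "'a::euclidean_space \<Rightarrow> 'b::euclidean_space"
  assumes "\<Omega> \<in> sets lebesgue" and f: "f \<in> borel_measurable borel"
    and "\<And>x. norm (f x) \<le> C" "\<And>x. B < norm x \<Longrightarrow> f x = 0"
  shows "l2_fun \<Omega> f"
  unfolding l2_fun_def
proof
  show "f \<in> borel_measurable (lebesgue_on \<Omega>)"
    using f by (intro measurable_restrict_space1) (auto intro: measurable_completion)
  have "integrable lborel (\<lambda>x. (norm (f x))\<^sup>2)"
    by (rule integrable_bounded_support[where C="C\<^sup>2" and B=B]) (use f assms(3,4) in \<open>auto intro: power_mono\<close>)
  then have "integrable lebesgue (\<lambda>x. (norm (f x))\<^sup>2)"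
    using f by (subst integrable_completion) auto
  then show "integrable (lebesgue_on \<Omega>) (\<lambda>x. (norm (f x))\<^sup>2)"
    using assms(1) by (intro integrable_restrict_space[THEN iffD2] integrable_mult_indicator) (auto simp: )
qed

lemma has_ae_gradient_imp_weak_gradient:
  fixes u :: "'a::euclidean_space \<Rightarrow> real"
  assumes u: "has_ae_gradient u g" and "open \<Omega>"
    and 0: "\<And>x. x \<notin> \<Omega> \<Longrightarrow> u x = 0" "\<And>x. x \<notin> \<Omega> \<Longrightarrow> g x = 0"
  shows "has_weak_gradient \<Omega> u g"
  unfolding has_weak_gradient_def
proof (intro conjI allI impI)
  have sets: "\<Omega> \<in> sets lebesgue" using \<open>open \<Omega>\<close> by simp
  have [measurable]: "u \<in> borel_measurable borel" "g \<in> borel_measurable borel"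
    using u by (auto simp: has_ae_gradient_def intro!: borel_measurable_continuous_onI has_ae_gradient_continuous[OF u])
  obtain C B where CB: "\<And>x. \<bar>u x\<bar> \<le> C" "\<And>x. norm (g x) \<le> C" "\<And>x. B < norm x \<Longrightarrow> u x = 0"
     "\<And>x. B < norm x \<Longrightarrow> g x = 0"
    using has_ae_gradient_bounded[OF u] by metis
  show "l2_fun \<Omega> u" by (rule l2_fun_bounded_support[where C=C and B=B]) (use sets CB in auto)
  show "l2_fun \<Omega> g" by (rule l2_fun_bounded_support[where C=C and B=B]) (use sets CB in auto)
  fix \<phi> \<psi> assume t: "test_function \<Omega> \<phi> \<psi>"
  note \<phi> = test_function_has_ae_gradient[OF t]
  have [measurable]: "\<phi> \<in> borel_measurable borel" "\<psi> \<in> borel_measurable borel"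
    using \<phi>(1) by (auto simp: has_ae_gradient_def intro!: borel_measurable_continuous_onI has_ae_gradient_continuous[OF \<phi>(1)])
  obtain C' B' where CB': "\<And>x. \<bar>\<phi> x\<bar> \<le> C'" "\<And>x. norm (\<psi> x) \<le> C'"
    using has_ae_gradient_bounded[OF \<phi>(1)] by metis
  have nonneg: "0 \<le> C" "0 \<le> C'" using order_trans[OF abs_ge_zero CB(1)] order_trans[OF abs_ge_zero CB'(1)] by auto
  have int1: "integrable lborel (\<lambda>x. u x *\<^sub>R \<psi> x)"
    by (rule integrable_bounded_support[where C="C * C'" and B=B])
      (use CB CB' nonneg in \<open>auto intro!: mult_mono\<close>)
  have int2: "integrable lborel (\<lambda>x. \<phi> x *\<^sub>R g x)"
    by (rule integrable_bounded_support[where C="C' * C" and B=B])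
      (use CB CB' nonneg in \<open>auto intro!: mult_mono\<close>)
  have "(\<integral>x. u x *\<^sub>R \<psi> x \<partial>lborel) = - (\<integral>x. \<phi> x *\<^sub>R g x \<partial>lborel)"
  proof (rule euclidean_eqI)
    fix b :: 'a assume "b \<in> Basis"
    have "(\<integral>x. u x *\<^sub>R \<psi> x \<partial>lborel) \<bullet> b = (\<integral>x. u x * (\<psi> x \<bullet> b) \<partial>lborel)"
      using integral_inner_left[OF int1, of b] by simp
    also have "\<dots> = - (\<integral>x. \<phi> x * (g x \<bullet> b) \<partial>lborel)"
      by (rule has_ae_gradient_parts[OF u \<phi>(1)])
    also have "\<dots> = - (\<integral>x. \<phi> x *\<^sub>R g x \<partial>lborel) \<bullet> b"
      using integral_inner_left[OF int2, of b] by simp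
    finally show "(\<integral>x. u x *\<^sub>R \<psi> x \<partial>lborel) \<bullet> b = - (\<integral>x. \<phi> x *\<^sub>R g x \<partial>lborel) \<bullet> b" .
  qed
  then show "integral\<^sup>L (lebesgue_on \<Omega>) (\<lambda>x. u x *\<^sub>R \<psi> x) = - integral\<^sup>L (lebesgue_on \<Omega>) (\<lambda>x. \<phi> x *\<^sub>R g x)"
    using sets 0 by (simp add: integral_lebesgue_on_eq_lborel)
qed

lemma has_real_derivative_pos_part_square:
  "((\<lambda>t::real. (max 0 t)\<^sup>2) has_real_derivative 2 * max 0 t) (at t)"
proof (cases t "0::real" rule: linorder_cases)
  case less
  have "((\<lambda>t::real. 0) has_real_derivative 2 * max 0 t) (at t)"
    using less by simp
  then show ?thesis
    by (rule has_field_derivative_transform_within_open[where S="{..<0}"]) (use less in auto)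
next
  case greater
  have "((\<lambda>t::real. t\<^sup>2) has_real_derivative 2 * max 0 t) (at t)"
    using greater by (auto intro!: derivative_eq_intros)
  then show ?thesis
    by (rule has_field_derivative_transform_within_open[where S="{0<..}"]) (use greater in auto)
next
  case equal
  have "((\<lambda>h::real. ((max 0 h)\<^sup>2 - (max 0 0)\<^sup>2) / (h - 0)) \<longlongrightarrow> 0) (at 0)"
  proof (rule Lim_null_comparison)
    show "\<forall>\<^sub>F h in at 0. norm (((max 0 h)\<^sup>2 - (max 0 0)\<^sup>2) / (h - 0)) \<le> \<bar>h::real\<bar>"
      by (auto simp: max_def power2_eq_square)
    show "((\<lambda>h::real. \<bar>h\<bar>) \<longlongrightarrow> 0) (at 0)" by (auto intro!: tendsto_eq_intros)
  qed
  then show ?thesis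
    using equal by (simp add: has_field_derivative_iff)
qed

lemma ball_bump:
  fixes c :: "'a::euclidean_space"
  defines "b \<equiv> \<lambda>r x. (max 0 (r\<^sup>2 - (x - c) \<bullet> (x - c)))\<^sup>2"
  assumes "r > 0"
  shows "GDERIV (b r) x :> (- 4 * max 0 (r\<^sup>2 - (x - c) \<bullet> (x - c))) *\<^sub>R (x - c)"
    "x \<in> ball c r \<Longrightarrow> b r x > 0" "x \<notin> ball c r \<Longrightarrow> b r x = 0"
proof -
  have "GDERIV (\<lambda>x. r\<^sup>2 - (x - c) \<bullet> (x - c)) x :> (- 2) *\<^sub>R (x - c)"
    unfolding gderiv_def by (auto intro!: derivative_eq_intros simp: inner_commute)
  from GDERIV_DERIV_compose[OF this has_real_derivative_pos_part_square]
  show "GDERIV (b r) x :> (- 4 * max 0 (r\<^sup>2 - (x - c) \<bullet> (x - c))) *\<^sub>R (x - c)"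
    unfolding b_def by simp
  have *: "x \<in> ball c r \<longleftrightarrow> (x - c) \<bullet> (x - c) < r\<^sup>2"
  proof -
    have "x \<in> ball c r \<longleftrightarrow> norm (x - c) < r" by (simp add: dist_norm norm_minus_commute)
    also have "\<dots> \<longleftrightarrow> (norm (x - c))\<^sup>2 < r\<^sup>2"
      using \<open>r > 0\<close> by (auto intro: power_strict_mono power2_less_imp_less)
    finally show ?thesis by (simp add: power2_norm_eq_inner)
  qed
  show "x \<in> ball c r \<Longrightarrow> b r x > 0" "x \<notin> ball c r \<Longrightarrow> b r x = 0"
    unfolding * b_def by auto
qed

lemma open_indicator_test_functions:
  fixes V :: "'a::euclidean_space set"
  assumes "open V"
  obtains \<phi> \<psi> where "\<And>n. test_function V (\<phi> n) (\<psi> n)" "\<And>n x. 0 \<le> \<phi> n x" "\<And>n x. \<phi> n x \<le> 1"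
    "\<And>x. (\<lambda>n. \<phi> n x) \<longlonglongrightarrow> indicat_real V x"
proof (cases "V = {}")
  case True
  show ?thesis
    by (rule that[of "\<lambda>_ _. 0" "\<lambda>_ _. 0"]) (auto simp: True test_function_def intro: GDERIV_const)
next
  case False
  define F where "F = {ball c r | c r. r > 0 \<and> cball c r \<subseteq> V}"
  obtain F' where F': "F' \<subseteq> F" "countable F'" "\<Union>F' = \<Union>F"
    using Lindelof[of F] unfolding F_def by (smt (verit) mem_Collect_eq open_ball)
  have "\<Union>F = V"
  proof
    show "\<Union>F \<subseteq> V" unfolding F_def using ball_subset_cball by fastforce
    show "V \<subseteq> \<Union>F"
    proof
      fix x assume "x \<in> V"
      then obtain e where "e > 0" "cball x e \<subseteq> V" using assms open_contains_cball by blast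
      then show "x \<in> \<Union>F" unfolding F_def using centre_in_ball by blast
    qed
  qed
  with F' False have "F' \<noteq> {}" "\<Union>F' = V" by auto
  then have rng: "range (from_nat_into F') = F'" using F'(2) by (simp add: range_from_nat_into)
  have "\<exists>c r. from_nat_into F' i = ball c r \<and> r > 0 \<and> cball c r \<subseteq> V" for i
    using F'(1) rng unfolding F_def by (smt (verit) mem_Collect_eq rangeI subsetD)
  then obtain c r where cr: "\<And>i. from_nat_into F' i = ball (c i) (r i)" "\<And>i. r i > 0" "\<And>i. cball (c i) (r i) \<subseteq> V"
    by metis
  have cover: "V = (\<Union>i. ball (c i) (r i))"
    using \<open>\<Union>F' = V\<close> rng cr(1) by (metis (no_types, lifting) image_cong)
  define b where "b i x = (max 0 ((r i)\<^sup>2 - (x - c i) \<bullet> (x - c i)))\<^sup>2" for i x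
  define db where "db i x = (- 4 * max 0 ((r i)\<^sup>2 - (x - c i) \<bullet> (x - c i))) *\<^sub>R (x - c i)" for i x
  have b: "GDERIV (b i) x :> db i x" "x \<in> ball (c i) (r i) \<Longrightarrow> b i x > 0" "x \<notin> ball (c i) (r i) \<Longrightarrow> b i x = 0" for i x
    unfolding b_def[abs_def] db_def by (fact ball_bump[OF cr(2)[of i]])+
  have b0: "b i x \<ge> 0" for i x unfolding b_def by simp
  have contb: "continuous_on UNIV (b i)" for i
    unfolding b_def by (intro continuous_intros)
  have contdb: "continuous_on UNIV (db i)" for i
    unfolding db_def by (intro continuous_intros)
  define S where "S n x = (\<Sum>i<n. b i x)" for n x
  define dS where "dS n x = (\<Sum>i<n. db i x)" for n x
  have S: "GDERIV (S n) x :> dS n x" for n x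
    unfolding gderiv_def S_def dS_def inner_sum_right
    by (intro has_derivative_sum) (use b(1) gderiv_def in blast)
  have S0: "S n x \<ge> 0" for n x unfolding S_def by (intro sum_nonneg b0)
  have pos: "1 + real n * S n x > 0" for n x using S0[of n x] by (simp add: add_pos_nonneg)
  define \<phi> where "\<phi> n x = 1 - inverse (1 + real n * S n x)" for n x
  define \<psi> where "\<psi> n x = (real n * (inverse (1 + real n * S n x))\<^sup>2) *\<^sub>R dS n x" for n x
  show ?thesis
  proof (rule that[of \<phi> \<psi>])
    fix n
    show "test_function V (\<phi> n) (\<psi> n)"
      unfolding test_function_def
    proof (intro conjI allI)
      fix x
      have "((\<lambda>t. 1 - inverse (1 + real n * t)) has_real_derivative real n * (inverse (1 + real n * S n x))\<^sup>2) (at (S n x))"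
        using pos[of n x] by (auto intro!: derivative_eq_intros simp: power2_eq_square)
      from GDERIV_DERIV_compose[OF S this]
      show "GDERIV (\<phi> n) x :> \<psi> n x" unfolding \<phi>_def[abs_def] \<psi>_def .
    next
      have "continuous_on UNIV (S n)" "continuous_on UNIV (dS n)" unfolding S_def dS_def
        by (intro continuous_on_sum contb contdb)+
      then show "continuous_on UNIV (\<psi> n)" unfolding \<psi>_def using pos[of n]
        by (intro continuous_intros) (auto simp: less_le)
      show "\<exists>K. compact K \<and> K \<subseteq> V \<and> (\<forall>x. x \<notin> K \<longrightarrow> \<phi> n x = 0)"
      proof (intro exI[of _ "\<Union>i<n. cball (c i) (r i)"] conjI allI impI)
        fix x assume "x \<notin> (\<Union>i<n. cball (c i) (r i))"
        then have "x \<notin> ball (c i) (r i)" if "i < n" for i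
          using that ball_subset_cball[of "c i" "r i"] by blast
        then have "S n x = 0" unfolding S_def
          by (intro sum.neutral ballI b(3)) (simp only: lessThan_iff not_False_eq_True)
        then show "\<phi> n x = 0" by (simp add: \<phi>_def)
      qed (use cr(3) in auto)
    qed
    fix x
    have "1 \<le> 1 + real n * S n x" using S0[of n x] by simp
    then show "0 \<le> \<phi> n x" "\<phi> n x \<le> 1" unfolding \<phi>_def using pos[of n x]
      by (auto simp: inverse_le_1_iff less_imp_le)
  next
    fix x
    show "(\<lambda>n. \<phi> n x) \<longlonglongrightarrow> indicat_real V x"
    proof (cases "x \<in> V")
      case True
      then obtain i where i: "x \<in> ball (c i) (r i)" using cover by auto
      have "\<forall>\<^sub>F n in sequentially. real n * b i x \<le> 1 + real n * S n x"
        using eventually_gt_at_top[of i]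
      proof eventually_elim
        case (elim n)
        then have "b i x \<le> S n x" unfolding S_def by (intro member_le_sum b0) auto
        then have "real n * b i x \<le> real n * S n x" by (intro mult_left_mono) auto
        then show ?case by simp
      qed
      moreover have "filterlim (\<lambda>n. real n * b i x) at_top sequentially"
        using b(2)[OF i] by (intro filterlim_at_top_mult_tendsto_pos[OF tendsto_const]) (auto simp: filterlim_real_sequentially mult.commute)
      ultimately have "filterlim (\<lambda>n. 1 + real n * S n x) at_top sequentially"
        by (rule filterlim_at_top_mono[rotated])
      then have "(\<lambda>n. inverse (1 + real n * S n x)) \<longlonglongrightarrow> 0"
        by (rule tendsto_inverse_0_at_top)
      from tendsto_diff[OF tendsto_const this, of 1] show ?thesis
        using True by (simp add: \<phi>_def)
    next
      case False
      then have "b i x = 0" for i using cover b(3) by blast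
      then show ?thesis using False by (simp add: \<phi>_def S_def)
    qed
  qed
qed

lemma AE_zero_if_test_integrals_zero:
  fixes f :: "'a::euclidean_space \<Rightarrow> real"
  assumes "open \<Omega>" and f: "integrable (lebesgue_on \<Omega>) f"
    and zero: "\<And>\<phi> \<psi>. test_function \<Omega> \<phi> \<psi> \<Longrightarrow> (\<integral>x. \<phi> x * f x \<partial>(lebesgue_on \<Omega>)) = 0"
  shows "AE x in lebesgue_on \<Omega>. f x \<le> 0"
proof -
  define M where "M = lebesgue_on \<Omega>"
  have sets: "\<Omega> \<in> sets lebesgue" using assms(1) by simp
  have fm[measurable]: "f \<in> borel_measurable M" using f by (simp add: M_def)
  have borel_M: "g \<in> borel_measurable M" if "g \<in> borel_measurable borel" for g :: "'a \<Rightarrow> real"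
    unfolding M_def using that by (intro measurable_restrict_space1) (auto intro: measurable_completion)
  have open_zero: "(\<integral>x. indicator V x * f x \<partial>M) = 0" if "open V" "V \<subseteq> \<Omega>" for V
  proof -
    obtain \<phi> \<psi> where \<phi>: "\<And>n. test_function V (\<phi> n) (\<psi> n)" "\<And>n x. 0 \<le> \<phi> n x" "\<And>n x. \<phi> n x \<le> (1::real)"
      "\<And>x. (\<lambda>n. \<phi> n x) \<longlonglongrightarrow> indicat_real V x"
      using open_indicator_test_functions[OF \<open>open V\<close>] by metis
    have t: "test_function \<Omega> (\<phi> n) (\<psi> n)" for n
      using \<phi>(1)[of n] that(2) unfolding test_function_def by fast
    have "(\<lambda>n. \<integral>x. \<phi> n x * f x \<partial>M) \<longlonglongrightarrow> (\<integral>x. indicator V x * f x \<partial>M)"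
    proof (rule integral_dominated_convergence[where w="\<lambda>x. norm (f x)"])
      show "(\<lambda>x. \<phi> n x * f x) \<in> borel_measurable M" for n
        using has_ae_gradient_continuous[OF test_function_has_ae_gradient(1)[OF t[of n]], of UNIV]
        by (intro borel_measurable_times fm borel_M borel_measurable_continuous_onI)
      show "(\<lambda>x. indicator V x * f x) \<in> borel_measurable M"
        using that(1) by (intro borel_measurable_times fm borel_M) auto
      show "AE x in M. (\<lambda>n. \<phi> n x * f x) \<longlonglongrightarrow> indicator V x * f x"
        by (intro AE_I2 tendsto_mult_right \<phi>(4))
      show "AE x in M. norm (\<phi> n x * f x) \<le> norm (f x)" for n
        using \<phi>(2,3)[of n] by (auto simp: abs_mult mult_left_le_one_le)
    qed (use f M_def in auto)
    then show ?thesis using zero[OF t] by (simp add: M_def LIMSEQ_const_iff)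
  qed
  define A where "A = {x \<in> \<Omega>. f x > 0}"
  have A: "A \<in> sets lebesgue"
  proof -
    have "{x \<in> space M. f x > 0} \<in> sets M" by measurable
    then show ?thesis using sets unfolding A_def M_def by (auto simp: sets_restrict_space_iff)
  qed
  have "emeasure lebesgue A \<le> 0"
  proof (rule ennreal_le_epsilon)
    fix e :: real assume "0 < e"
    obtain K where K: "closed K" "K \<subseteq> A" "A - K \<in> lmeasurable" "emeasure lebesgue (A - K) < ennreal e"
      using sets_lebesgue_inner_closed[OF A \<open>0 < e\<close>] by metis
    have "K \<subseteq> \<Omega>" using K(2) by (auto simp: A_def)
    have m: "indicat_real K \<in> borel_measurable M" using K(1) by (intro borel_M) auto
    have int: "integrable M (\<lambda>x. indicator K x * f x)"
    proof (rule Bochner_Integration.integrable_bound[of M f])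
      show "(\<lambda>x. indicator K x * f x) \<in> borel_measurable M" using m by simp
    qed (use f in \<open>auto simp: M_def indicator_def\<close>)
    have "(\<integral>x. indicator K x * f x \<partial>M) = (\<integral>x. indicator \<Omega> x * f x - indicator (\<Omega> - K) x * f x \<partial>M)"
      using \<open>K \<subseteq> \<Omega>\<close> by (intro Bochner_Integration.integral_cong) (auto simp: indicator_def)
    also have "\<dots> = (\<integral>x. indicator \<Omega> x * f x \<partial>M) - (\<integral>x. indicator (\<Omega> - K) x * f x \<partial>M)"
    proof -
      have "integrable M (\<lambda>x. indicator V x * f x)" if "open V" for V
      proof (rule Bochner_Integration.integrable_bound[of M f])
        have "indicat_real V \<in> borel_measurable M" using that by (intro borel_M) auto
        then show "(\<lambda>x. indicator V x * f x) \<in> borel_measurable M" by simp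
      qed (use f in \<open>auto simp: M_def indicator_def\<close>)
      then show ?thesis
        using assms(1) K(1) by (intro Bochner_Integration.integral_diff) (simp_all add: open_Diff)
    qed
    also have "\<dots> = 0" using open_zero assms(1) K(1) by (simp add: open_Diff)
    finally have "AE x in M. indicator K x * f x = 0"
      using int K(2)
      by (subst (asm) integral_nonneg_eq_0_iff_AE) (auto simp: A_def indicator_def intro!: AE_I2 simp del: of_bool_eq_1_iff)
    then have "AE x in M. x \<notin> K"
      by eventually_elim (use K(2) in \<open>auto simp: A_def indicator_def split: if_splits\<close>)
    then have "AE x in lebesgue. x \<notin> K"
      using sets \<open>K \<subseteq> \<Omega>\<close> unfolding M_def by (subst (asm) AE_restrict_space_iff) auto
    then have "emeasure lebesgue K = 0"
      using K(1) by (subst (asm) AE_iff_measurable[where N=K]) auto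
    moreover have "emeasure lebesgue A \<le> emeasure lebesgue K + emeasure lebesgue (A - K)"
      using emeasure_subadditive[of K lebesgue "A - K"] K A by (simp add: Un_absorb1 )
    ultimately show "emeasure lebesgue A \<le> 0 + ennreal e" using K(4) by auto
  qed
  then have "AE x in lebesgue. x \<notin> A"
    using A by (subst AE_iff_measurable[where N=A]) auto
  then show ?thesis
    using sets by (subst AE_restrict_space_iff) (auto simp: A_def elim!: eventually_mono)
qed

lemma l2_fun_imp_integrable:
  assumes "l2_fun \<Omega> f" "bounded \<Omega>" "\<Omega> \<in> sets lebesgue"
  shows "integrable (lebesgue_on \<Omega>) f"
proof (rule Bochner_Integration.integrable_bound)
  have "\<Omega> \<in> lmeasurable" using assms(2,3) by (simp add: bounded_set_imp_lmeasurable)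
  then have "integrable (lebesgue_on \<Omega>) (\<lambda>x. 1::real)"
    by (simp add: finite_measure.integrable_const finite_measure_lebesgue_on)
  then show "integrable (lebesgue_on \<Omega>) (\<lambda>x. 1 + (norm (f x))\<^sup>2)"
    using assms(1) by (auto simp: l2_fun_def)
  have "t \<le> 1 + t\<^sup>2" for t :: real
    using zero_le_power2[of "t - 1/2"] by (simp add: power2_eq_square algebra_simps)
  then show "AE x in lebesgue_on \<Omega>. norm (f x) \<le> norm (1 + (norm (f x))\<^sup>2)"
    by (auto intro!: AE_I2) 
qed (use assms(1) in \<open>simp add: l2_fun_def\<close>)

lemma weak_gradient_unique:
  fixes g g' :: "'a::euclidean_space \<Rightarrow> 'a"
  assumes "open \<Omega>" "bounded \<Omega>" and g: "has_weak_gradient \<Omega> u g" and g': "has_weak_gradient \<Omega> u g'"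
  shows "AE x in lebesgue_on \<Omega>. g x = g' x"
proof -
  have sets: "\<Omega> \<in> sets lebesgue" using assms(1) by simp
  have int: "integrable (lebesgue_on \<Omega>) g" "integrable (lebesgue_on \<Omega>) g'"
    using g g' assms(2) sets by (auto intro!: l2_fun_imp_integrable simp: has_weak_gradient_def)
  have half: "AE x in lebesgue_on \<Omega>. (g x - g' x) \<bullet> b \<le> 0" for b
  proof (rule AE_zero_if_test_integrals_zero[OF assms(1)])
    show "integrable (lebesgue_on \<Omega>) (\<lambda>x. (g x - g' x) \<bullet> b)" using int by auto
    fix \<phi> \<psi> assume t: "test_function \<Omega> \<phi> \<psi>"
    have \<phi>: "has_ae_gradient \<phi> \<psi>" using test_function_has_ae_gradient(1)[OF t] .
    obtain C B where C: "\<And>x. \<bar>\<phi> x\<bar> \<le> C" using has_ae_gradient_bounded[OF \<phi>] by metis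
    have m: "\<phi> \<in> borel_measurable (lebesgue_on \<Omega>)"
      using borel_measurable_continuous_onI[OF has_ae_gradient_continuous[OF \<phi>]]
      by (intro measurable_restrict_space1) (auto intro: measurable_completion)
    have i: "integrable (lebesgue_on \<Omega>) (\<lambda>x. \<phi> x *\<^sub>R h x)"
      if h: "integrable (lebesgue_on \<Omega>) h" for h :: "'a \<Rightarrow> 'a"
    proof (rule Bochner_Integration.integrable_bound)
      show "integrable (lebesgue_on \<Omega>) (\<lambda>x. C *\<^sub>R h x)" using h by auto
      show "AE x in lebesgue_on \<Omega>. norm (\<phi> x *\<^sub>R h x) \<le> norm (C *\<^sub>R h x)"
        using order_trans[OF C abs_ge_self] by (auto intro!: AE_I2 mult_right_mono)
    qed (use m h in auto)
    have "(\<integral>x. \<phi> x * ((g x - g' x) \<bullet> b) \<partial>lebesgue_on \<Omega>) = (\<integral>x. (\<phi> x *\<^sub>R g x - \<phi> x *\<^sub>R g' x) \<bullet> b \<partial>lebesgue_on \<Omega>)"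
      by (intro Bochner_Integration.integral_cong) (auto simp: algebra_simps inner_diff_left)
    also have "\<dots> = ((\<integral>x. \<phi> x *\<^sub>R g x \<partial>lebesgue_on \<Omega>) - (\<integral>x. \<phi> x *\<^sub>R g' x \<partial>lebesgue_on \<Omega>)) \<bullet> b"
      using i[OF int(1)] i[OF int(2)] by (subst integral_inner_left) auto
    also have "(\<integral>x. \<phi> x *\<^sub>R g x \<partial>lebesgue_on \<Omega>) = (\<integral>x. \<phi> x *\<^sub>R g' x \<partial>lebesgue_on \<Omega>)"
    proof -
      have "has_weak_gradient \<Omega> u h \<Longrightarrow>
          (\<integral>x. u x *\<^sub>R \<psi> x \<partial>lebesgue_on \<Omega>) = - (\<integral>x. \<phi> x *\<^sub>R h x \<partial>lebesgue_on \<Omega>)" for h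
        using t unfolding has_weak_gradient_def by blast
      from this[OF g] this[OF g'] show ?thesis by simp
    qed
    finally show "(\<integral>x. \<phi> x * ((g x - g' x) \<bullet> b) \<partial>lebesgue_on \<Omega>) = 0" by simp
  qed
  have "AE x in lebesgue_on \<Omega>. \<forall>b\<in>Basis. (g x - g' x) \<bullet> b = 0"
  proof (rule AE_finite_allI[OF finite_Basis])
    fix b :: 'a
    show "AE x in lebesgue_on \<Omega>. (g x - g' x) \<bullet> b = 0"
      using half[of b] half[of "- b"] by eventually_elim auto
  qed
  then show ?thesis
  proof eventually_elim
    case (elim x)
    then have "g x - g' x = 0" by (subst euclidean_all_zero_iff[symmetric]) blast
    then show ?case by simp
  qed
qed

lemma h1_norm_square:
  fixes u :: "'a::euclidean_space \<Rightarrow> real"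
  assumes u: "has_ae_gradient u g" and "open \<Omega>" "bounded \<Omega>"
    and 0: "\<And>x. x \<notin> \<Omega> \<Longrightarrow> u x = 0" "\<And>x. x \<notin> \<Omega> \<Longrightarrow> g x = 0"
  shows "(h1_norm \<Omega> u)\<^sup>2 = (\<integral>x. (u x)\<^sup>2 \<partial>lborel) + (\<integral>x. (norm (g x))\<^sup>2 \<partial>lborel)"
proof -
  have [measurable]: "u \<in> borel_measurable borel" "g \<in> borel_measurable borel"
    using u by (auto simp: has_ae_gradient_def intro!: borel_measurable_continuous_onI has_ae_gradient_continuous[OF u])
  have wg: "has_weak_gradient \<Omega> u g"
    by (rule has_ae_gradient_imp_weak_gradient[OF u \<open>open \<Omega>\<close> 0])
  have w: "has_weak_gradient \<Omega> u (weak_gradient \<Omega> u)"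
    unfolding weak_gradient_def by (rule someI[of "has_weak_gradient \<Omega> u", OF wg])
  have m: "weak_gradient \<Omega> u \<in> borel_measurable (lebesgue_on \<Omega>)" "g \<in> borel_measurable (lebesgue_on \<Omega>)"
    using w wg by (auto simp: has_weak_gradient_def l2_fun_def)
  have "l2_inner \<Omega> (weak_gradient \<Omega> u) (weak_gradient \<Omega> u) = l2_inner \<Omega> g g"
    unfolding l2_inner_def
  proof (rule integral_cong_AE)
    show "AE x in lebesgue_on \<Omega>. weak_gradient \<Omega> u x \<bullet> weak_gradient \<Omega> u x = g x \<bullet> g x"
      using weak_gradient_unique[OF assms(2,3) wg w] by eventually_elim auto
  qed (use m in auto)
  also have "\<dots> = (\<integral>x. (norm (g x))\<^sup>2 \<partial>lborel)"
    unfolding l2_inner_def using 0 \<open>open \<Omega>\<close>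
    by (subst integral_lebesgue_on_eq_lborel) (auto simp: power2_norm_eq_inner)
  finally have 1: "l2_inner \<Omega> (weak_gradient \<Omega> u) (weak_gradient \<Omega> u) = (\<integral>x. (norm (g x))\<^sup>2 \<partial>lborel)" .
  have 2: "l2_inner \<Omega> u u = (\<integral>x. (u x)\<^sup>2 \<partial>lborel)"
    unfolding l2_inner_def using 0 \<open>open \<Omega>\<close>
    by (subst integral_lebesgue_on_eq_lborel) (auto simp: power2_eq_square)
  show ?thesis
    unfolding h1_norm_def 1 2 by (intro real_sqrt_pow2 add_nonneg_nonneg integral_nonneg) auto
qed

section \<open>Barycentric coordinates\<close>

definition bary :: "'a::euclidean_space set \<Rightarrow> 'a \<Rightarrow> 'a \<Rightarrow> real" where
  "bary \<tau> p = (SOME f. (\<exists>a b. \<forall>x. f x = a \<bullet> x + b) \<and> (\<forall>q\<in>corners \<tau>. f q = (if q = p then 1 else 0)))"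

lemma affine_function_delta:
  fixes C :: "'a::euclidean_space set"
  assumes "\<not> affine_dependent C" "p \<in> C"
  shows "\<exists>a b. \<forall>q\<in>C. a \<bullet> q + b = (if q = p then 1 else 0::real)"
proof -
  have "insert p (C - {p}) = C" using assms(2) by auto
  then have "independent ((\<lambda>q. q - p) ` (C - {p}))"
    using affine_dependent_iff_dependent[of p "C - {p}"] assms(1)
    by (simp add: image_def)
  then obtain f :: "'a \<Rightarrow> real" where f: "linear f" "\<forall>x\<in>(\<lambda>q. q - p) ` (C - {p}). f x = -1"
    using linear_independent_extend[of _ "\<lambda>_. -1"] by blast
  define a where "a = (\<Sum>b\<in>Basis. f b *\<^sub>R b)"
  have fa: "f x = a \<bullet> x" for x
  proof -
    have "f x = f (\<Sum>b\<in>Basis. (x \<bullet> b) *\<^sub>R b)" by (simp add: euclidean_representation)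
    also have "\<dots> = (\<Sum>b\<in>Basis. (x \<bullet> b) * f b)"
      using f(1) by (simp add: linear_sum linear_scale)
    also have "\<dots> = a \<bullet> x"
      by (simp add: a_def inner_sum_left inner_commute[of x] mult.commute)
    finally show ?thesis .
  qed
  have "a \<bullet> q + (1 - a \<bullet> p) = (if q = p then 1 else 0)" if "q \<in> C" for q
  proof (cases "q = p")
    case False
    then have "f (q - p) = -1" using f(2) that by simp
    then show ?thesis using False by (simp add: fa inner_diff_right)
  qed simp
  then show ?thesis by blast
qed

context
  fixes \<tau> :: "'a::euclidean_space set"
  assumes simplex: "int DIM('a) simplex \<tau>"
begin

lemma corners_simplex:
  "finite (corners \<tau>)" "\<not> affine_dependent (corners \<tau>)" "card (corners \<tau>) = DIM('a) + 1"
  "\<tau> = convex hull (corners \<tau>)" "affine hull (corners \<tau>) = UNIV"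
proof -
  obtain C where C: "\<not> affine_dependent C" "int (card C) = int DIM('a) + 1" "\<tau> = convex hull C"
    using simplex unfolding simplex_def by blast
  have eq: "corners \<tau> = C"
    unfolding corners_def C(3) using extreme_point_of_convex_hull_affine_independent[OF C(1)] by blast
  moreover have "finite C" using C(1) aff_independent_finite by blast
  moreover have "card C = DIM('a) + 1" using C(2) by linarith
  moreover have "affine hull C = UNIV"
    using affine_independent_span_eq[OF C(1)] \<open>card C = DIM('a) + 1\<close> by simp
  ultimately show "finite (corners \<tau>)" "\<not> affine_dependent (corners \<tau>)" "card (corners \<tau>) = DIM('a) + 1"
    "\<tau> = convex hull (corners \<tau>)" "affine hull (corners \<tau>) = UNIV"
    unfolding eq using C(1,3) by blast+
qed

lemma corner_in: "p \<in> corners \<tau> \<Longrightarrow> p \<in> \<tau>"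
  using corners_simplex(4) hull_subset[of "corners \<tau>" convex] by blast

lemma simplex_closed: "closed \<tau>" and simplex_compact: "compact \<tau>" and simplex_convex: "convex \<tau>"
  using simplex closed_simplex compact_simplex convex_simplex by auto

lemma simplex_interior_nonempty: "interior \<tau> \<noteq> {}"
  using corners_simplex interior_convex_hull_eq_empty[of "corners \<tau>"] by simp

lemma bary_affine_delta:
  assumes "p \<in> corners \<tau>"
  shows "(\<exists>a b. \<forall>x. bary \<tau> p x = a \<bullet> x + b) \<and> (\<forall>q\<in>corners \<tau>. bary \<tau> p q = (if q = p then 1 else 0))"
proof -
  obtain a b where "\<forall>q\<in>corners \<tau>. a \<bullet> q + b = (if q = p then 1 else 0::real)"
    using affine_function_delta[OF corners_simplex(2) assms] by blast
  then have "\<exists>f. (\<exists>a b. \<forall>x. f x = a \<bullet> x + b) \<and> (\<forall>q\<in>corners \<tau>. f q = (if q = p then 1 else 0))"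
    by (intro exI[of _ "\<lambda>x. a \<bullet> x + b"]) auto
  then show ?thesis unfolding bary_def by (rule someI_ex)
qed

lemma bary_affineE:
  assumes "p \<in> corners \<tau>"
  obtains a b where "\<And>x. bary \<tau> p x = a \<bullet> x + b"
  using bary_affine_delta[OF assms] by blast

lemma bary_corner: "p \<in> corners \<tau> \<Longrightarrow> q \<in> corners \<tau> \<Longrightarrow> bary \<tau> p q = (if q = p then 1 else 0)"
  using bary_affine_delta by blast

lemma affine_function_sum:
  fixes a :: "'b::real_inner"
  assumes "sum u C = 1"
  shows "a \<bullet> (\<Sum>q\<in>C. u q *\<^sub>R q) + b = (\<Sum>q\<in>C. u q * (a \<bullet> q + b))"
  using assms by (simp add: inner_sum_right distrib_left sum.distrib flip: sum_distrib_right)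

lemma bary_unique:
  assumes "sum u (corners \<tau>) = 1" "p \<in> corners \<tau>"
  shows "bary \<tau> p (\<Sum>q\<in>corners \<tau>. u q *\<^sub>R q) = u p"
proof -
  obtain a b where ab: "\<And>x. bary \<tau> p x = a \<bullet> x + b" by (rule bary_affineE[OF assms(2)]) blast
  have "bary \<tau> p (\<Sum>q\<in>corners \<tau>. u q *\<^sub>R q) = (\<Sum>q\<in>corners \<tau>. u q * bary \<tau> p q)"
    unfolding ab by (rule affine_function_sum[OF assms(1)])
  also have "\<dots> = (\<Sum>q\<in>corners \<tau>. if q = p then u q else 0)"
    using assms(2) by (intro sum.cong) (auto simp: bary_corner)
  also have "\<dots> = u p" using assms(2) corners_simplex(1) by simp
  finally show ?thesis .
qed

lemma bary_representation:
  "(\<Sum>p\<in>corners \<tau>. bary \<tau> p x) = 1" "(\<Sum>p\<in>corners \<tau>. bary \<tau> p x *\<^sub>R p) = x"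
proof -
  have "x \<in> affine hull (corners \<tau>)" using corners_simplex(5) by simp
  then obtain u where u: "sum u (corners \<tau>) = 1" "(\<Sum>q\<in>corners \<tau>. u q *\<^sub>R q) = x"
    using affine_hull_finite[OF corners_simplex(1)] by auto
  then have "bary \<tau> p x = u p" if "p \<in> corners \<tau>" for p
    using bary_unique[OF u(1) that] by simp
  then show "(\<Sum>p\<in>corners \<tau>. bary \<tau> p x) = 1" "(\<Sum>p\<in>corners \<tau>. bary \<tau> p x *\<^sub>R p) = x"
    using u by simp_all
qed

lemma bary_affine_function: "a \<bullet> x + b = (\<Sum>p\<in>corners \<tau>. bary \<tau> p x * (a \<bullet> p + b))"
  using affine_function_sum[OF bary_representation(1), of a x b] bary_representation(2)[of x] by simp

lemma mem_simplex_hull: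
  "x \<in> \<tau> \<longleftrightarrow> (\<exists>u. (\<forall>q\<in>corners \<tau>. 0 \<le> u q) \<and> sum u (corners \<tau>) = 1 \<and> (\<Sum>q\<in>corners \<tau>. u q *\<^sub>R q) = x)"
proof -
  have "x \<in> \<tau> \<longleftrightarrow> x \<in> convex hull (corners \<tau>)" using corners_simplex(4) by simp
  then show ?thesis unfolding convex_hull_finite[OF corners_simplex(1)] by simp
qed

lemma mem_simplex_iff: "x \<in> \<tau> \<longleftrightarrow> (\<forall>p\<in>corners \<tau>. 0 \<le> bary \<tau> p x)"
proof
  assume "x \<in> \<tau>"
  then obtain u where u: "\<And>q. q \<in> corners \<tau> \<Longrightarrow> 0 \<le> u q" "sum u (corners \<tau>) = 1" "(\<Sum>q\<in>corners \<tau>. u q *\<^sub>R q) = x"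
    unfolding mem_simplex_hull by blast
  then show "\<forall>p\<in>corners \<tau>. 0 \<le> bary \<tau> p x"
    using bary_unique[OF u(2)] by auto
next
  assume "\<forall>p\<in>corners \<tau>. 0 \<le> bary \<tau> p x"
  then show "x \<in> \<tau>" unfolding mem_simplex_hull
    by (intro exI[of _ "\<lambda>p. bary \<tau> p x"]) (simp add: bary_representation)
qed

lemma bary_segment:
  "p \<in> corners \<tau> \<Longrightarrow> bary \<tau> p ((1 - t) *\<^sub>R x + t *\<^sub>R y) = (1 - t) * bary \<tau> p x + t * bary \<tau> p y"
  by (rule bary_affineE) (auto simp: inner_add_right algebra_simps)

lemma bary_continuous: "p \<in> corners \<tau> \<Longrightarrow> continuous_on A (bary \<tau> p)"
  by (rule bary_affineE[of p]) (auto intro!: continuous_intros simp: continuous_on_cong[of A A "bary \<tau> p"])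

end

text \<open>A common face is the hull of the common corners, so that both simplices see the same
  coordinates there.\<close>

lemma bary_common:
  fixes \<sigma> \<tau> :: "'a::euclidean_space set"
  assumes "conforming R" "\<sigma> \<in> R" "\<tau> \<in> R" "int DIM('a) simplex \<sigma>" "int DIM('a) simplex \<tau>"
    "x \<in> \<sigma>" "x \<in> \<tau>" "p \<in> corners \<tau>"
  shows "bary \<tau> p x = (if p \<in> corners \<sigma> then bary \<sigma> p x else 0)"
proof (cases "\<sigma> = \<tau>")
  case True then show ?thesis using assms(8) by simp
next
  case False
  define F where "F = \<sigma> \<inter> \<tau>"
  have face: "F face_of \<sigma>" "F face_of \<tau>"
    using assms(1-3) False unfolding conforming_def F_def by blast+
  define E where "E = {v. v extreme_point_of F}"
  have E: "E \<subseteq> corners \<sigma>" "E \<subseteq> corners \<tau>"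
    unfolding E_def corners_def using extreme_point_of_face[OF face(1)] extreme_point_of_face[OF face(2)] by auto
  have "finite E" using E(1) corners_simplex(1)[OF assms(4)] finite_subset by blast
  have "compact F" unfolding F_def using simplex_compact assms(4,5) by blast
  moreover have "convex F" unfolding F_def using simplex_convex assms(4,5) convex_Int by blast
  ultimately have "F = convex hull E" unfolding E_def by (rule Krein_Milman_Minkowski)
  moreover have "x \<in> F" using assms F_def by simp
  ultimately obtain u where u: "sum u E = 1" "(\<Sum>q\<in>E. u q *\<^sub>R q) = x"
    using convex_hull_finite[OF \<open>finite E\<close>] by auto
  define w where "w q = (if q \<in> E then u q else 0)" for q
  have ext: "sum w (corners \<rho>) = 1" "(\<Sum>q\<in>corners \<rho>. w q *\<^sub>R q) = x"
    if "int DIM('a) simplex \<rho>" "E \<subseteq> corners \<rho>" for \<rho> :: "'a set"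
  proof -
    have "sum w (corners \<rho>) = sum w E"
      using that corners_simplex(1)[OF that(1)] by (intro sum.mono_neutral_right) (auto simp: w_def)
    then show "sum w (corners \<rho>) = 1" using u(1) by (simp add: w_def)
    have "(\<Sum>q\<in>corners \<rho>. w q *\<^sub>R q) = (\<Sum>q\<in>E. w q *\<^sub>R q)"
      using that corners_simplex(1)[OF that(1)] by (intro sum.mono_neutral_right) (auto simp: w_def)
    then show "(\<Sum>q\<in>corners \<rho>. w q *\<^sub>R q) = x" using u(2) by (simp add: w_def)
  qed
  have "bary \<tau> p x = w p"
    using bary_unique[OF assms(5) ext(1)[OF assms(5) E(2)] assms(8)] ext(2)[OF assms(5) E(2)] by simp
  moreover have "bary \<sigma> p x = w p" if "p \<in> corners \<sigma>"
    using bary_unique[OF assms(4) ext(1)[OF assms(4) E(1)] that] ext(2)[OF assms(4) E(1)] by simp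
  moreover have "w p = 0" if "p \<notin> corners \<sigma>" using that E(1) by (auto simp: w_def)
  ultimately show ?thesis by auto
qed

section \<open>Finite element functions\<close>

definition slope :: "('a::euclidean_space \<Rightarrow> real) \<Rightarrow> 'a set \<Rightarrow> 'a" where
  "slope u \<tau> = (SOME a. \<exists>b. \<forall>x\<in>\<tau>. u x = a \<bullet> x + b)"

lemma slope_eqI:
  assumes "int DIM('a::euclidean_space) simplex (\<tau>::'a set)" "\<And>x. x \<in> \<tau> \<Longrightarrow> u x = a \<bullet> x + b"
  shows "slope u \<tau> = a"
proof -
  have "\<exists>a b. \<forall>x\<in>\<tau>. u x = a \<bullet> x + b" using assms by blast
  then have "\<exists>b. \<forall>x\<in>\<tau>. u x = slope u \<tau> \<bullet> x + b"
    unfolding slope_def by (rule someI_ex)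
  then obtain b' where b': "\<And>x. x \<in> \<tau> \<Longrightarrow> u x = slope u \<tau> \<bullet> x + b'" by blast
  obtain x where x: "x \<in> interior \<tau>" using simplex_interior_nonempty[OF assms(1)] by blast
  have "GDERIV u x :> c" if "\<And>x. x \<in> \<tau> \<Longrightarrow> u x = c \<bullet> x + d" for c d
  proof (rule GDERIV_cong_open)
    show "GDERIV (\<lambda>x. c \<bullet> x + d) x :> c"
      unfolding gderiv_def by (auto intro!: derivative_eq_intros simp: inner_commute)
  qed (use x that interior_subset in auto)
  then show ?thesis using GDERIV_unique assms(2) b' by metis
qed

locale fe_mesh =
  fixes \<Omega> :: "'a::euclidean_space set" and R :: "'a set set"
  assumes dom: "open \<Omega>" "\<Omega> = interior (closure \<Omega>)"
    and part: "simplicial_partition (closure \<Omega>) R" and conf: "conforming R"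
begin

lemma simplices: "\<tau> \<in> R \<Longrightarrow> int DIM('a) simplex \<tau>"
  and finite_R: "finite R" and cover: "\<Union>R = closure \<Omega>"
  and disjoint_interiors: "\<sigma> \<in> R \<Longrightarrow> \<tau> \<in> R \<Longrightarrow> \<sigma> \<noteq> \<tau> \<Longrightarrow> interior \<sigma> \<inter> interior \<tau> = {}"
  using part unfolding simplicial_partition_def pairwise_def by auto

lemma compact_domain: "compact (closure \<Omega>)"
  using simplex_compact[OF simplices] unfolding cover[symmetric] by (intro compact_Union finite_R) blast

lemma bounded_domain: "bounded \<Omega>"
  by (rule bounded_subset[OF compact_imp_bounded[OF compact_domain] closure_subset])

lemma interior_subset_domain: "\<tau> \<in> R \<Longrightarrow> interior \<tau> \<subseteq> \<Omega>"
  using cover dom(2) interior_mono[of \<tau> "closure \<Omega>"] by auto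

lemma frontier_domain: "frontier \<Omega> = closure \<Omega> - \<Omega>"
  using dom(1) by (simp add: frontier_def interior_open)

definition pgrad :: "('a \<Rightarrow> real) \<Rightarrow> 'a \<Rightarrow> 'a" where
  "pgrad u x = (\<Sum>\<tau>\<in>R. indicat_real (interior \<tau>) x *\<^sub>R slope u \<tau>)"

definition energy :: "('a \<Rightarrow> real) \<Rightarrow> real" where
  "energy u = (\<Sum>\<tau>\<in>R. measure lborel \<tau> * (norm (slope u \<tau>))\<^sup>2)"

lemma pgrad_interior:
  assumes "\<tau> \<in> R" "x \<in> interior \<tau>"
  shows "pgrad u x = slope u \<tau>"
proof -
  have "pgrad u x = (\<Sum>\<sigma>\<in>R. if \<sigma> = \<tau> then slope u \<tau> else 0)"
    unfolding pgrad_def using assms disjoint_interiors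
    by (intro sum.cong) (auto simp: indicator_def)
  then show ?thesis using assms finite_R by simp
qed

lemma pgrad_outside: "x \<notin> (\<Union>\<tau>\<in>R. interior \<tau>) \<Longrightarrow> pgrad u x = 0"
  unfolding pgrad_def by (intro sum.neutral) (auto simp: indicator_def)

lemma pgrad_measurable[measurable]: "pgrad u \<in> borel_measurable borel"
  unfolding pgrad_def by (intro borel_measurable_sum borel_measurable_scaleR borel_measurable_indicator) auto

lemma simplex_null_frontier: "\<tau> \<in> R \<Longrightarrow> frontier \<tau> \<in> null_sets lborel"
  using negligible_convex_frontier[OF simplex_convex[OF simplices]]
  by (simp add: negligible_iff_null_sets null_sets_completion_iff)

lemma measure_interior: "\<tau> \<in> R \<Longrightarrow> measure lborel (interior \<tau>) = measure lborel \<tau>"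
proof -
  assume "\<tau> \<in> R"
  have "measure lborel (interior \<tau>) = measure lborel (\<tau> - frontier \<tau>)"
    using simplex_closed[OF simplices[OF \<open>\<tau> \<in> R\<close>]] by (simp add: frontier_def Diff_Diff_Int interior_subset Int_absorb1)
  also have "\<dots> = measure lborel \<tau>"
    using simplex_closed[OF simplices[OF \<open>\<tau> \<in> R\<close>]]
    by (intro measure_Diff_null_set simplex_null_frontier \<open>\<tau> \<in> R\<close>) auto
  finally show ?thesis .
qed

lemma pgrad_norm_square: "(norm (pgrad u x))\<^sup>2 = (\<Sum>\<tau>\<in>R. indicat_real (interior \<tau>) x * (norm (slope u \<tau>))\<^sup>2)"
proof (cases "x \<in> (\<Union>\<tau>\<in>R. interior \<tau>)")
  case True
  then obtain \<tau> where \<tau>: "\<tau> \<in> R" "x \<in> interior \<tau>" by blast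
  have "(\<Sum>\<sigma>\<in>R. indicat_real (interior \<sigma>) x * (norm (slope u \<sigma>))\<^sup>2) = (\<Sum>\<sigma>\<in>R. if \<sigma> = \<tau> then (norm (slope u \<tau>))\<^sup>2 else 0)"
    using \<tau> disjoint_interiors by (intro sum.cong) (auto simp: indicator_def)
  then show ?thesis using \<tau> finite_R by (simp add: pgrad_interior)
next
  case False
  then show ?thesis
    by (subst sum.neutral) (auto simp: pgrad_outside indicator_def)
qed

lemma integral_pgrad:
  shows "integrable lborel (\<lambda>x. (norm (pgrad u x))\<^sup>2)" "(\<integral>x. (norm (pgrad u x))\<^sup>2 \<partial>lborel) = energy u"
proof -
  have i: "integrable lborel (\<lambda>x. indicat_real (interior \<tau>) x * (norm (slope u \<tau>))\<^sup>2)" if "\<tau> \<in> R" for \<tau>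
  proof -
    have "emeasure lborel (interior \<tau>) < \<infinity>"
      using simplex_compact[OF simplices[OF that]] compact_imp_bounded bounded_interior emeasure_bounded_finite by blast
    then show ?thesis
      by (intro integrable_mult_left integrable_real_indicator) (auto)
  qed
  then show "integrable lborel (\<lambda>x. (norm (pgrad u x))\<^sup>2)"
    unfolding pgrad_norm_square by (intro Bochner_Integration.integrable_sum)
  show "(\<integral>x. (norm (pgrad u x))\<^sup>2 \<partial>lborel) = energy u"
    unfolding pgrad_norm_square energy_def using i
    by (subst Bochner_Integration.integral_sum) (auto simp: measure_interior intro!: sum.cong)
qed

lemma energy_nonneg: "0 \<le> energy u"
  unfolding energy_def by (intro sum_nonneg) auto

lemma fe_affine:
  assumes "u \<in> fe_space \<Omega> R" "\<tau> \<in> R"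
  obtains b where "\<And>x. x \<in> \<tau> \<Longrightarrow> u x = slope u \<tau> \<bullet> x + b"
proof -
  have "\<exists>a b. \<forall>x\<in>\<tau>. u x = a \<bullet> x + b" using assms by (simp add: fe_space_def)
  then obtain a b where ab: "\<And>x. x \<in> \<tau> \<Longrightarrow> u x = a \<bullet> x + b" by blast
  have "slope u \<tau> = a" by (rule slope_eqI[OF simplices[OF assms(2)] ab])
  with ab show ?thesis by (intro that[of b]) simp
qed

lemma fe_zero: "u \<in> fe_space \<Omega> R \<Longrightarrow> x \<notin> \<Omega> \<Longrightarrow> u x = 0"
  unfolding fe_space_def using frontier_domain by blast

lemma fe_continuous:
  assumes "u \<in> fe_space \<Omega> R"
  shows "continuous_on UNIV u"
proof -
  have "continuous_on (closure \<Omega> \<union> - \<Omega>) u"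
  proof (rule continuous_on_closed_Un)
    show "continuous_on (- \<Omega>) u"
      using fe_zero[OF assms] by (intro continuous_on_eq[OF continuous_on_const[of _ 0]]) auto
  qed (use assms dom in \<open>auto simp: fe_space_def closed_Compl\<close>)
  moreover have "closure \<Omega> \<union> - \<Omega> = UNIV" using closure_subset by blast
  ultimately show ?thesis by simp
qed

lemma fe_lipschitz:
  assumes u: "u \<in> fe_space \<Omega> R"
  shows "\<exists>L. L-lipschitz_on UNIV u"
proof -
  define L where "L = (\<Sum>\<tau>\<in>R. norm (slope u \<tau>))"
  have L: "norm (slope u \<tau>) \<le> L" if "\<tau> \<in> R" for \<tau>
    unfolding L_def using that finite_R by (intro member_le_sum) auto
  have "0 \<le> L" unfolding L_def by (intro sum_nonneg) auto
  have "\<bar>u x - u y\<bar> \<le> L * dist x y" for x y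
  proof -
    define \<gamma> where "\<gamma> t = x + t *\<^sub>R (y - x)" for t :: real
    have cont: "continuous_on UNIV \<gamma>" unfolding \<gamma>_def by (intro continuous_intros)
    define U where "U A = \<gamma> -` A" for A
    have "(L * dist x y)-lipschitz_on {0..1} (u \<circ> \<gamma>)"
    proof (rule lipschitz_on_closed_Union[where I="insert (- \<Omega>) R" and U=U])
      fix A assume A: "A \<in> insert (- \<Omega>) R"
      show "closed (U A)"
        unfolding U_def using A dom(1) simplex_closed[OF simplices] cont
        by (intro closed_vimage) (auto simp: continuous_on_eq_continuous_at)
      show "(L * dist x y)-lipschitz_on (U A) (u \<circ> \<gamma>)"
      proof (rule lipschitz_onI)
        fix s t assume st: "s \<in> U A" "t \<in> U A"
        show "dist ((u \<circ> \<gamma>) s) ((u \<circ> \<gamma>) t) \<le> L * dist x y * dist s t"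
        proof (cases "A \<in> R")
          case True
          obtain b where b: "\<And>x. x \<in> A \<Longrightarrow> u x = slope u A \<bullet> x + b" using fe_affine[OF u True] by blast
          have "\<gamma> s - \<gamma> t = (s - t) *\<^sub>R (y - x)" by (simp add: \<gamma>_def algebra_simps)
          then have "u (\<gamma> s) - u (\<gamma> t) = (s - t) * (slope u A \<bullet> (y - x))"
            using st b unfolding U_def by (simp flip: inner_diff_right)
          moreover have "\<bar>slope u A \<bullet> (y - x)\<bar> \<le> L * dist x y"
            using L[OF True] by (intro order_trans[OF Cauchy_Schwarz_ineq2] mult_mono) (auto simp: dist_norm norm_minus_commute \<open>0 \<le> L\<close>)
          ultimately show ?thesis
            by (simp add: dist_real_def abs_mult mult.commute[of "L * _"] mult_left_mono)
        next
          case False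
          then have "u (\<gamma> s) = 0" "u (\<gamma> t) = 0" using A st fe_zero[OF u] unfolding U_def by auto
          then show ?thesis using \<open>0 \<le> L\<close> by simp
        qed
      qed (use \<open>0 \<le> L\<close> in auto)
    next
      have "x \<in> - \<Omega> \<or> x \<in> \<Union>R" for x using cover closure_subset by blast
      then show "{0..1} \<subseteq> (\<Union>A\<in>insert (- \<Omega>) R. U A)" unfolding U_def by blast
    qed (use finite_R \<open>0 \<le> L\<close> in auto)
    from lipschitz_onD[OF this, of 0 1] show ?thesis by (simp add: \<gamma>_def dist_real_def)
  qed
  then show ?thesis using \<open>0 \<le> L\<close> by (intro exI[of _ L] lipschitz_onI) (auto simp: dist_real_def)
qed

lemma fe_has_ae_gradient:
  assumes u: "u \<in> fe_space \<Omega> R"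
  shows "has_ae_gradient u (pgrad u)"
  unfolding has_ae_gradient_def
proof (intro conjI)
  show "\<exists>C. \<forall>x. norm (pgrad u x) \<le> C"
  proof (intro exI allI)
    show "norm (pgrad u x) \<le> (\<Sum>\<tau>\<in>R. norm (slope u \<tau>))" for x
      unfolding pgrad_def by (intro sum_norm_le) (auto simp: indicator_def)
  qed
  obtain B where "\<And>x. x \<in> \<Omega> \<Longrightarrow> norm x \<le> B" using bounded_domain bounded_iff by blast
  then have "B < norm x \<Longrightarrow> x \<notin> \<Omega>" for x by (meson not_le)
  then show "\<exists>B. \<forall>x. B < norm x \<longrightarrow> u x = 0 \<and> pgrad u x = 0"
    using fe_zero[OF u] pgrad_outside interior_subset_domain by (metis UN_E subsetD)
  have "(\<Union>\<tau>\<in>R. frontier \<tau>) \<in> null_sets lborel"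
    using finite_R simplex_null_frontier by (intro null_sets.finite_UN) auto
  then have "AE x in lborel. x \<notin> (\<Union>\<tau>\<in>R. frontier \<tau>)" by (rule AE_not_in)
  then show "AE x in lborel. GDERIV u x :> pgrad u x"
  proof eventually_elim
    case (elim x)
    show ?case
    proof (cases "x \<in> closure \<Omega>")
      case True
      then obtain \<tau> where \<tau>: "\<tau> \<in> R" "x \<in> \<tau>" using cover by blast
      then have x: "x \<in> interior \<tau>" using elim simplex_closed[OF simplices] by (auto simp: frontier_def)
      obtain b where b: "\<And>x. x \<in> \<tau> \<Longrightarrow> u x = slope u \<tau> \<bullet> x + b" using fe_affine[OF u \<tau>(1)] by blast
      have "GDERIV u x :> slope u \<tau>"
      proof (rule GDERIV_cong_open)
        show "GDERIV (\<lambda>x. slope u \<tau> \<bullet> x + b) x :> slope u \<tau>"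
          unfolding gderiv_def by (auto intro!: derivative_eq_intros simp: inner_commute)
      qed (use x b interior_subset in auto)
      then show ?thesis using pgrad_interior[OF \<tau>(1) x] by simp
    next
      case False
      have "GDERIV u x :> 0"
        by (rule GDERIV_cong_open[OF GDERIV_const[of 0], where S="- closure \<Omega>"])
          (use False fe_zero[OF u] closure_subset in auto)
      moreover have "pgrad u x = 0"
        using False interior_subset_domain closure_subset by (intro pgrad_outside) blast
      ultimately show ?thesis by simp
    qed
  qed
qed (use fe_lipschitz[OF u] in auto)

lemma fe_h1_norm_square:
  assumes u: "u \<in> fe_space \<Omega> R"
  shows "(h1_norm \<Omega> u)\<^sup>2 = (\<integral>x. (u x)\<^sup>2 \<partial>lborel) + energy u"
proof -
  have "pgrad u x = 0" if "x \<notin> \<Omega>" for x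
    using that interior_subset_domain by (intro pgrad_outside) blast
  then show ?thesis
    using h1_norm_square[OF fe_has_ae_gradient[OF u] dom(1) bounded_domain fe_zero[OF u]]
    by (simp add: integral_pgrad)
qed

lemma fe_translation:
  assumes u: "u \<in> fe_space \<Omega> R"
  shows "(\<integral>\<^sup>+x. ennreal ((u (x + z) - u x)\<^sup>2) \<partial>lborel) \<le> ennreal ((norm z)\<^sup>2 * energy u)"
proof -
  have "(\<integral>\<^sup>+x. ennreal ((norm (pgrad u x))\<^sup>2) \<partial>lborel) = ennreal (energy u)"
    using integral_pgrad[of u] by (simp add: nn_integral_eq_integral)
  then show ?thesis
    using has_ae_gradient_translation[OF fe_has_ae_gradient[OF u], of z] by (simp add: ennreal_mult energy_nonneg)
qed

end

section \<open>The orthogonal projection\<close>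

definition cont_supp :: "('a::euclidean_space \<Rightarrow> real) \<Rightarrow> bool" where
  "cont_supp f \<longleftrightarrow> continuous_on UNIV f \<and> (\<exists>B. \<forall>x. B < norm x \<longrightarrow> f x = 0)"

definition ip :: "('a::euclidean_space \<Rightarrow> real) \<Rightarrow> ('a \<Rightarrow> real) \<Rightarrow> real" where
  "ip f g = (\<integral>x. f x * g x \<partial>lborel)"

lemma cont_supp_bounded:
  assumes "cont_supp f"
  obtains C B where "\<And>x. \<bar>f x\<bar> \<le> C" "\<And>x. B < norm x \<Longrightarrow> f x = 0"
proof -
  obtain B where B: "\<And>x. B < norm x \<Longrightarrow> f x = 0" using assms unfolding cont_supp_def by blast
  have "compact (f ` cball 0 B)"
    using assms unfolding cont_supp_def
    by (intro compact_continuous_image) (auto intro: continuous_on_subset)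
  then obtain D where D: "\<forall>y\<in>f ` cball 0 B. norm y \<le> D" using compact_imp_bounded bounded_iff by blast
  show thesis
  proof (rule that[of "max 0 D" B])
    show "\<bar>f x\<bar> \<le> max 0 D" for x
      using D B[of x] by (cases "norm x \<le> B") (force simp: max.coboundedI2)+
  qed (rule B)
qed

lemma cont_supp_measurable: "cont_supp f \<Longrightarrow> f \<in> borel_measurable borel"
  by (auto simp: cont_supp_def intro: borel_measurable_continuous_onI)

lemma cont_supp_mult_measurable:
  "cont_supp f \<Longrightarrow> cont_supp g \<Longrightarrow> (\<lambda>x. f x * g x) \<in> borel_measurable borel"
  by (intro borel_measurable_times cont_supp_measurable)

lemma cont_supp_integrable_mult:
  assumes "cont_supp f" "cont_supp g"
  shows "integrable lborel (\<lambda>x. f x * g x)"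
proof -
  obtain C B where f: "\<And>x. \<bar>f x\<bar> \<le> C" "\<And>x. B < norm x \<Longrightarrow> f x = 0" using cont_supp_bounded[OF assms(1)] by metis
  obtain D where g: "\<And>x. \<bar>g x\<bar> \<le> D" using cont_supp_bounded[OF assms(2)] by metis
  have "0 \<le> C" using f(1) abs_ge_zero order_trans by blast
  show ?thesis
    by (rule integrable_bounded_support[where C="C * D" and B=B])
      (use f g \<open>0 \<le> C\<close> assms in \<open>auto simp: abs_mult intro!: mult_mono cont_supp_mult_measurable\<close>)
qed

lemma cont_supp_diff: "cont_supp f \<Longrightarrow> cont_supp g \<Longrightarrow> cont_supp (\<lambda>x. f x - g x)"
  unfolding cont_supp_def
proof (elim conjE exE, intro conjI continuous_on_diff)
  fix B B' assume "\<forall>x. B < norm x \<longrightarrow> f x = 0" "\<forall>x. B' < norm x \<longrightarrow> g x = 0"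
  then show "\<exists>B. \<forall>x. B < norm x \<longrightarrow> f x - g x = 0" by (intro exI[of _ "max B B'"]) auto
qed

lemma cont_supp_scale: "cont_supp f \<Longrightarrow> cont_supp (\<lambda>x. c * f x)"
  unfolding cont_supp_def by (auto intro!: continuous_intros)

lemma cont_supp_zero: "cont_supp (\<lambda>x. 0)"
  unfolding cont_supp_def by auto

lemma cont_supp_sum: "(\<And>i. i \<in> I \<Longrightarrow> cont_supp (\<phi> i)) \<Longrightarrow> cont_supp (\<lambda>x. \<Sum>i\<in>I. c i * \<phi> i x)"
proof (induction I rule: infinite_finite_induct)
  case (insert i I)
  then have "cont_supp (\<lambda>x. c i * \<phi> i x - (-1) * (\<Sum>i\<in>I. c i * \<phi> i x))"
    by (intro cont_supp_diff cont_supp_scale) auto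
  then show ?case using insert by simp
qed (auto simp: cont_supp_zero)

lemma ip_commute: "ip f g = ip g f"
  unfolding ip_def by (simp add: mult.commute)

lemma ip_diff_left: "cont_supp f \<Longrightarrow> cont_supp g \<Longrightarrow> cont_supp h \<Longrightarrow> ip (\<lambda>x. f x - g x) h = ip f h - ip g h"
  unfolding ip_def left_diff_distrib
  by (intro Bochner_Integration.integral_diff cont_supp_integrable_mult)

lemma ip_diff_right: "cont_supp f \<Longrightarrow> cont_supp g \<Longrightarrow> cont_supp h \<Longrightarrow> ip h (\<lambda>x. f x - g x) = ip h f - ip h g"
  by (metis ip_commute ip_diff_left)

lemma ip_scale_left: "ip (\<lambda>x. c * f x) h = c * ip f h"
  unfolding ip_def by (simp add: mult.assoc)

lemma ip_sum_right:
  "(\<And>i. i \<in> I \<Longrightarrow> cont_supp (\<phi> i)) \<Longrightarrow> cont_supp h \<Longrightarrow>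
    ip h (\<lambda>x. \<Sum>i\<in>I. c i * \<phi> i x) = (\<Sum>i\<in>I. c i * ip h (\<phi> i))"
  unfolding ip_def sum_distrib_left
  by (subst Bochner_Integration.integral_sum)
    (auto simp: mult.left_commute intro!: integrable_mult_right cont_supp_integrable_mult)

lemma ip_nonneg: "0 \<le> ip f f"
  unfolding ip_def by (intro Bochner_Integration.integral_nonneg) auto

lemma ip_self_eq_0:
  assumes "cont_supp f" "ip f f = 0"
  shows "f x = 0"
proof -
  have "AE x in lborel. f x * f x = 0"
    using assms(2) cont_supp_integrable_mult[OF assms(1,1)] unfolding ip_def
    by (subst (asm) integral_nonneg_eq_0_iff_AE) auto
  moreover have op: "open {x. f x \<noteq> 0}"
    using assms(1) unfolding cont_supp_def
    by (auto simp: open_Collect_neq continuous_on_const)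
  ultimately have "{x. f x \<noteq> 0} \<in> null_sets lborel"
    using AE_iff_null[of lborel "\<lambda>x. f x * f x = 0"] by simp
  then have "negligible {x. f x \<noteq> 0}"
    by (simp add: negligible_iff_null_sets null_sets_completionI)
  then have "{x. f x \<noteq> 0} = {}" using open_not_negligible op by blast
  then show ?thesis by blast
qed

lemma orthogonal_projection_exists:
  assumes "finite I" "\<And>i. i \<in> I \<Longrightarrow> cont_supp (\<phi> i)" "cont_supp u"
  shows "\<exists>c. \<forall>i\<in>I. ip (\<lambda>x. u x - (\<Sum>j\<in>I. c j * \<phi> j x)) (\<phi> i) = 0"
  using assms
proof (induction I arbitrary: u rule: finite_induct)
  case (insert j I)
  note cs = insert.prems
  obtain c0 where c0: "\<forall>i\<in>I. ip (\<lambda>x. u x - (\<Sum>j\<in>I. c0 j * \<phi> j x)) (\<phi> i) = 0"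
    using insert.IH[OF cs(1)[OF insertI2] cs(2)] by blast
  obtain c1 where c1: "\<forall>i\<in>I. ip (\<lambda>x. \<phi> j x - (\<Sum>j\<in>I. c1 j * \<phi> j x)) (\<phi> i) = 0"
    using insert.IH[OF cs(1)[OF insertI2] cs(1)[OF insertI1]] by blast
  define r where "r = (\<lambda>x. u x - (\<Sum>j\<in>I. c0 j * \<phi> j x))"
  define w1 where "w1 = (\<lambda>x. (\<Sum>j\<in>I. c1 j * \<phi> j x))"
  define \<psi> where "\<psi> = (\<lambda>x. \<phi> j x - w1 x)"
  have w1: "cont_supp w1" unfolding w1_def by (intro cont_supp_sum cs) auto
  have r: "cont_supp r" unfolding r_def by (intro cont_supp_diff cont_supp_sum cs) auto
  have \<psi>: "cont_supp \<psi>" unfolding \<psi>_def by (intro cont_supp_diff w1 cs) auto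
  have orth_w1: "ip h w1 = 0" if "cont_supp h" "\<forall>i\<in>I. ip h (\<phi> i) = 0" for h
    unfolding w1_def using that cs by (subst ip_sum_right) auto
  have r\<phi>: "\<forall>i\<in>I. ip r (\<phi> i) = 0" using c0 unfolding r_def .
  have \<psi>\<phi>: "\<forall>i\<in>I. ip \<psi> (\<phi> i) = 0"
    using c1 unfolding \<psi>_def w1_def .
  define \<alpha> where "\<alpha> = ip r \<psi> / ip \<psi> \<psi>"
  have \<alpha>: "ip r \<psi> = \<alpha> * ip \<psi> \<psi>"
  proof (cases "ip \<psi> \<psi> = 0")
    case True
    then have "\<psi> x = 0" for x by (rule ip_self_eq_0[OF \<psi>])
    then have "ip r \<psi> = 0" by (simp add: ip_def)
    then show ?thesis using True by simp
  qed (simp add: \<alpha>_def)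
  define w where "w = (\<lambda>x. r x - \<alpha> * \<psi> x)"
  have w: "cont_supp w" unfolding w_def by (intro cont_supp_diff cont_supp_scale r \<psi>)
  have ipw: "ip w h = ip r h - \<alpha> * ip \<psi> h" if "cont_supp h" for h
    unfolding w_def using r \<psi> that by (simp add: ip_diff_left cont_supp_scale ip_scale_left)
  define c where "c i = (if i = j then \<alpha> else c0 i - \<alpha> * c1 i)" for i
  have eq: "(\<lambda>x. u x - (\<Sum>i\<in>insert j I. c i * \<phi> i x)) = w"
  proof
    fix x
    have "(\<Sum>i\<in>I. c i * \<phi> i x) = (\<Sum>i\<in>I. c0 i * \<phi> i x - \<alpha> * (c1 i * \<phi> i x))"
      using insert.hyps(2) by (intro sum.cong) (auto simp: c_def algebra_simps)
    also have "\<dots> = (\<Sum>i\<in>I. c0 i * \<phi> i x) - \<alpha> * w1 x"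
      unfolding w1_def by (simp add: sum_subtractf sum_distrib_left)
    finally show "u x - (\<Sum>i\<in>insert j I. c i * \<phi> i x) = w x"
      using insert.hyps by (simp add: c_def w_def r_def \<psi>_def algebra_simps)
  qed
  have orth: "\<forall>i\<in>I. ip w (\<phi> i) = 0"
    using r\<phi> \<psi>\<phi> ipw cs by auto
  have "ip w \<psi> = 0" using ipw[OF \<psi>] \<alpha> by simp
  moreover have "ip w \<psi> = ip w (\<phi> j) - ip w w1"
    unfolding \<psi>_def using w w1 cs by (intro ip_diff_right) auto
  ultimately have "ip w (\<phi> j) = 0" using orth_w1[OF w orth] by simp
  with orth show ?case by (intro exI[of _ c]) (simp add: eq)
qed simp

lemma l2_inner_eq_ip:
  assumes "open \<Omega>" "cont_supp f" "cont_supp g" "\<And>x. x \<notin> \<Omega> \<Longrightarrow> g x = 0"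
  shows "l2_inner \<Omega> f g = ip f g"
  unfolding l2_inner_def ip_def using assms
  by (subst integral_lebesgue_on_eq_lborel) (auto intro!: cont_supp_mult_measurable)

section \<open>Nodal interpolation\<close>

context fe_mesh
begin

definition vertices :: "'a set" where
  "vertices = (\<Union>\<tau>\<in>R. corners \<tau>)"

definition nodal_interp :: "('a \<Rightarrow> real) \<Rightarrow> 'a \<Rightarrow> real" where
  "nodal_interp y x =
     (if x \<in> closure \<Omega> then \<Sum>p\<in>corners (SOME \<tau>. \<tau> \<in> R \<and> x \<in> \<tau>). y p * bary (SOME \<tau>. \<tau> \<in> R \<and> x \<in> \<tau>) p x else 0)"

lemma finite_vertices: "finite vertices"
  unfolding vertices_def using finite_R corners_simplex(1)[OF simplices] by auto

lemma nodal_interp_eq: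
  assumes "\<tau> \<in> R" "x \<in> \<tau>"
  shows "nodal_interp y x = (\<Sum>p\<in>corners \<tau>. y p * bary \<tau> p x)"
proof -
  define \<sigma> where "\<sigma> = (SOME \<tau>. \<tau> \<in> R \<and> x \<in> \<tau>)"
  have \<sigma>: "\<sigma> \<in> R" "x \<in> \<sigma>"
    using someI[of "\<lambda>\<tau>. \<tau> \<in> R \<and> x \<in> \<tau>" \<tau>] assms unfolding \<sigma>_def by auto
  note s\<sigma> = simplices[OF \<sigma>(1)] and s\<tau> = simplices[OF assms(1)]
  have "(\<Sum>p\<in>corners \<sigma>. y p * bary \<sigma> p x) = (\<Sum>p\<in>corners \<sigma> \<inter> corners \<tau>. y p * bary \<sigma> p x)"
    using bary_common[OF conf assms(1) \<sigma>(1) s\<tau> s\<sigma> assms(2) \<sigma>(2)] corners_simplex(1)[OF s\<sigma>]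
    by (intro sum.mono_neutral_right) auto
  also have "\<dots> = (\<Sum>p\<in>corners \<sigma> \<inter> corners \<tau>. y p * bary \<tau> p x)"
    using bary_common[OF conf assms(1) \<sigma>(1) s\<tau> s\<sigma> assms(2) \<sigma>(2)] by (intro sum.cong) auto
  also have "\<dots> = (\<Sum>p\<in>corners \<tau>. y p * bary \<tau> p x)"
    using bary_common[OF conf \<sigma>(1) assms(1) s\<sigma> s\<tau> \<sigma>(2) assms(2)] corners_simplex(1)[OF s\<tau>]
    by (intro sum.mono_neutral_left) auto
  finally have "(\<Sum>p\<in>corners \<sigma>. y p * bary \<sigma> p x) = (\<Sum>p\<in>corners \<tau>. y p * bary \<tau> p x)" .
  moreover have "x \<in> closure \<Omega>" using assms cover by blast
  ultimately show ?thesis unfolding nodal_interp_def \<sigma>_def[symmetric] by simp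
qed

lemma nodal_interp_affine:
  assumes "\<tau> \<in> R"
  shows "\<exists>a b. \<forall>x\<in>\<tau>. nodal_interp y x = a \<bullet> x + b"
proof -
  have "\<exists>a b. \<forall>x. bary \<tau> p x = a \<bullet> x + b" if "p \<in> corners \<tau>" for p
    using bary_affine_delta[OF simplices[OF assms] that] by (rule conjunct1)
  then obtain a b where ab: "\<And>p x. p \<in> corners \<tau> \<Longrightarrow> bary \<tau> p x = a p \<bullet> x + b p" by metis
  have "nodal_interp y x = (\<Sum>p\<in>corners \<tau>. y p *\<^sub>R a p) \<bullet> x + (\<Sum>p\<in>corners \<tau>. y p * b p)" if "x \<in> \<tau>" for x
    using that by (simp add: nodal_interp_eq[OF assms] ab inner_sum_left distrib_left sum.distrib)
  then show ?thesis by blast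
qed

text \<open>Contracting towards \<open>p\<close> brings a neighbourhood of \<open>x\<close> into a neighbourhood of \<open>p\<close>, which is
  covered by the partition; by the compatibility of the coordinates on common faces, no point
  crosses the face opposite to \<open>p\<close>.\<close>

lemma open_star_subset:
  assumes "\<tau> \<in> R" "p \<in> corners \<tau>" "p \<in> \<Omega>" "x \<in> \<tau>" "0 < bary \<tau> p x"
  shows "x \<in> \<Omega>"
proof -
  obtain e where e: "e > 0" "ball p e \<subseteq> \<Omega>" using dom(1) assms(3) open_contains_ball by blast
  define t where "t = min 1 (e / (2 * (norm (x - p) + 1)))"
  have t: "0 < t" "t \<le> 1" using e(1) unfolding t_def by (auto simp: add_nonneg_pos)
  have "t * norm (x - p) \<le> (e / (2 * (norm (x - p) + 1))) * norm (x - p)"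
    unfolding t_def by (intro mult_right_mono) auto
  also have "\<dots> = e * (norm (x - p) / (2 * (norm (x - p) + 1)))" by simp
  also have "\<dots> < e * 1"
  proof (rule mult_strict_left_mono[OF _ e(1)])
    have frac: "n / (2 * (n + 1)) < 1" if "0 \<le> n" for n :: real
      using that by (simp add: divide_simps)
    show "norm (x - p) / (2 * (norm (x - p) + 1)) < 1" by (rule frac[OF norm_ge_zero])
  qed
  finally have te: "t * norm (x - p) < e" by simp
  define H where "H y = (1 - t) *\<^sub>R p + t *\<^sub>R y" for y
  have H: "H y - p = t *\<^sub>R (y - p)" for y by (simp add: H_def algebra_simps)
  have contH: "continuous_on UNIV H" unfolding H_def by (intro continuous_intros)
  have bH: "bary \<sigma> q (H y) = (1 - t) * bary \<sigma> q p + t * bary \<sigma> q y" if "\<sigma> \<in> R" "q \<in> corners \<sigma>" for \<sigma> q y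
    unfolding H_def using bary_segment[OF simplices[OF that(1)] that(2)] .
  have Hx\<tau>: "H x \<in> \<tau>"
    unfolding H_def using simplex_convex[OF simplices[OF assms(1)]] corner_in[OF simplices[OF assms(1)] assms(2)] assms(4) t
    by (intro convexD) auto
  have pos: "p \<in> corners \<sigma> \<and> 0 < bary \<sigma> p x" if "\<sigma> \<in> R" "H x \<in> \<sigma>" for \<sigma>
  proof -
    note c = bary_common[OF conf that(1) assms(1) simplices[OF that(1)] simplices[OF assms(1)] that(2) Hx\<tau> assms(2)]
    have h: "bary \<tau> p (H x) = (1 - t) + t * bary \<tau> p x"
      using bH[OF assms(1,2)] bary_corner[OF simplices[OF assms(1)] assms(2,2)] by simp
    moreover have "0 < t * bary \<tau> p x" using t assms(5) by simp
    ultimately have "0 < bary \<tau> p (H x)" using t by simp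
    with c have p: "p \<in> corners \<sigma>" by (auto split: if_splits)
    with c h have "bary \<sigma> p (H x) = (1 - t) + t * bary \<tau> p x" by simp
    moreover have "bary \<sigma> p (H x) = (1 - t) + t * bary \<sigma> p x"
      using bH[OF that(1) p] bary_corner[OF simplices[OF that(1)] p p] by simp
    ultimately show ?thesis using t p assms(5) by simp
  qed
  define U where "U = H -` ball p e \<inter> (\<Inter>\<sigma>\<in>R. if H x \<in> \<sigma> then {y. 0 < bary \<sigma> p y} else H -` (- \<sigma>))"
  have "open U" unfolding U_def
  proof (intro open_Int open_INT ballI finite_R)
    show "open (H -` ball p e)" using contH by (intro open_vimage) auto
    fix \<sigma> assume \<sigma>: "\<sigma> \<in> R"
    show "open (if H x \<in> \<sigma> then {y. 0 < bary \<sigma> p y} else H -` (- \<sigma>))"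
    proof (cases "H x \<in> \<sigma>")
      case True
      then have "continuous_on UNIV (bary \<sigma> p)" using pos[OF \<sigma>] bary_continuous[OF simplices[OF \<sigma>]] by blast
      then have "open {y. 0 < bary \<sigma> p y}" by (intro open_Collect_less continuous_on_const)
      then show ?thesis using True by simp
    next
      case False
      then show ?thesis using simplex_closed[OF simplices[OF \<sigma>]] contH by (auto intro!: open_vimage open_Compl)
    qed
  qed
  moreover have "dist p (H x) < e" using te H[of x] t by (simp add: dist_norm norm_minus_commute[of p "H x"])
  then have "x \<in> U" unfolding U_def using pos by auto
  moreover have "U \<subseteq> closure \<Omega>"
  proof
    fix y assume y: "y \<in> U"
    then have "H y \<in> closure \<Omega>" using e(2) closure_subset unfolding U_def by blast
    then obtain \<sigma> where \<sigma>: "\<sigma> \<in> R" "H y \<in> \<sigma>" using cover by blast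
    have "y \<in> (if H x \<in> \<sigma> then {y. 0 < bary \<sigma> p y} else H -` (- \<sigma>))"
      using y \<sigma>(1) unfolding U_def by blast
    then have Hx: "H x \<in> \<sigma>" and bpos: "0 < bary \<sigma> p y" using \<sigma>(2) by (simp_all split: if_splits)
    have "0 \<le> bary \<sigma> q y" if "q \<in> corners \<sigma>" for q
    proof (cases "q = p")
      case False
      have "0 \<le> bary \<sigma> q (H y)" using \<sigma> that mem_simplex_iff[OF simplices[OF \<sigma>(1)]] by blast
      moreover have "bary \<sigma> q p = 0"
        using bary_corner[OF simplices[OF \<sigma>(1)] that, of p] pos[OF \<sigma>(1) Hx] False by auto
      ultimately show ?thesis using bH[OF \<sigma>(1) that, of y] t by (simp add: zero_le_mult_iff)
    qed (use bpos in simp)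
    then show "y \<in> closure \<Omega>" using mem_simplex_iff[OF simplices[OF \<sigma>(1)]] \<sigma>(1) cover by blast
  qed
  ultimately show ?thesis by (subst dom(2)) (rule interiorI)
qed

lemma nodal_interp_in_fe:
  assumes "\<And>p. p \<in> vertices \<Longrightarrow> p \<notin> \<Omega> \<Longrightarrow> y p = 0"
  shows "nodal_interp y \<in> fe_space \<Omega> R"
proof -
  have "continuous_on (\<Union>\<tau>\<in>R. \<tau>) (nodal_interp y)"
  proof (rule continuous_on_closed_Union[OF finite_R])
    fix \<tau> assume \<tau>: "\<tau> \<in> R"
    show "closed \<tau>" using simplex_closed[OF simplices[OF \<tau>]] .
    obtain a b where ab: "\<forall>x\<in>\<tau>. nodal_interp y x = a \<bullet> x + b" using nodal_interp_affine[OF \<tau>] by blast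
    have "continuous_on \<tau> (\<lambda>x. a \<bullet> x + b)" by (intro continuous_intros)
    then show "continuous_on \<tau> (nodal_interp y)"
      by (rule continuous_on_eq) (use ab in simp)
  qed
  moreover have "nodal_interp y x = 0" if "x \<in> frontier \<Omega>" for x
  proof -
    have x: "x \<in> closure \<Omega>" "x \<notin> \<Omega>" using that frontier_domain by auto
    then obtain \<tau> where \<tau>: "\<tau> \<in> R" "x \<in> \<tau>" using cover by blast
    have "y p * bary \<tau> p x = 0" if p: "p \<in> corners \<tau>" for p
    proof (cases "p \<in> \<Omega>")
      case True
      have "\<not> 0 < bary \<tau> p x" using open_star_subset[OF \<tau>(1) p True \<tau>(2)] x(2) by blast
      moreover have "0 \<le> bary \<tau> p x" using mem_simplex_iff[OF simplices[OF \<tau>(1)]] \<tau>(2) p by blast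
      ultimately show ?thesis by simp
    next
      case False
      then show ?thesis using assms p \<tau>(1) unfolding vertices_def by auto
    qed
    then show ?thesis unfolding nodal_interp_eq[OF \<tau>] by (rule sum.neutral[OF ballI])
  qed
  moreover have "nodal_interp y x = 0" if "x \<notin> closure \<Omega>" for x
    using that by (simp add: nodal_interp_def)
  ultimately show ?thesis
    unfolding fe_space_def using nodal_interp_affine cover by simp
qed

lemma fe_corner_sum:
  assumes "u \<in> fe_space \<Omega> R" "\<tau> \<in> R" "x \<in> \<tau>"
  shows "u x = (\<Sum>p\<in>corners \<tau>. u p * bary \<tau> p x)"
proof -
  obtain b where b: "\<And>x. x \<in> \<tau> \<Longrightarrow> u x = slope u \<tau> \<bullet> x + b" using fe_affine[OF assms(1,2)] by blast
  have "u x = (\<Sum>p\<in>corners \<tau>. bary \<tau> p x * (slope u \<tau> \<bullet> p + b))"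
    using b[OF assms(3)] bary_affine_function[OF simplices[OF assms(2)], of "slope u \<tau>" x b] by simp
  also have "\<dots> = (\<Sum>p\<in>corners \<tau>. u p * bary \<tau> p x)"
    using b corner_in[OF simplices[OF assms(2)]] by (intro sum.cong) auto
  finally show ?thesis .
qed

lemma fe_cont_supp: "u \<in> fe_space \<Omega> R \<Longrightarrow> cont_supp u"
proof -
  assume u: "u \<in> fe_space \<Omega> R"
  obtain B where "\<And>x. x \<in> \<Omega> \<Longrightarrow> norm x \<le> B" using bounded_domain bounded_iff by blast
  then have "B < norm x \<Longrightarrow> u x = 0" for x using fe_zero[OF u] by (meson not_le)
  then show ?thesis unfolding cont_supp_def using fe_continuous[OF u] by blast
qed

lemma fe_diff:
  assumes u: "u \<in> fe_space \<Omega> R" and v: "v \<in> fe_space \<Omega> R"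
  shows "(\<lambda>x. u x - v x) \<in> fe_space \<Omega> R"
    and "\<tau> \<in> R \<Longrightarrow> slope (\<lambda>x. u x - v x) \<tau> = slope u \<tau> - slope v \<tau>"
proof -
  have aff: "\<exists>b. \<forall>x\<in>\<tau>. u x - v x = (slope u \<tau> - slope v \<tau>) \<bullet> x + b" if \<tau>: "\<tau> \<in> R" for \<tau>
  proof -
    obtain b where b: "\<And>x. x \<in> \<tau> \<Longrightarrow> u x = slope u \<tau> \<bullet> x + b" using fe_affine[OF u \<tau>] by blast
    obtain c where c: "\<And>x. x \<in> \<tau> \<Longrightarrow> v x = slope v \<tau> \<bullet> x + c" using fe_affine[OF v \<tau>] by blast
    show ?thesis by (intro exI[of _ "b - c"]) (auto simp: b c inner_diff_left)
  qed
  then have "\<exists>a b. \<forall>x\<in>\<tau>. u x - v x = a \<bullet> x + b" if "\<tau> \<in> R" for \<tau> using that by blast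
  then show "(\<lambda>x. u x - v x) \<in> fe_space \<Omega> R"
    using u v unfolding fe_space_def by (auto intro: continuous_on_diff)
  assume \<tau>: "\<tau> \<in> R"
  then obtain b where "\<And>x. x \<in> \<tau> \<Longrightarrow> u x - v x = (slope u \<tau> - slope v \<tau>) \<bullet> x + b" using aff by blast
  then show "slope (\<lambda>x. u x - v x) \<tau> = slope u \<tau> - slope v \<tau>"
    by (rule slope_eqI[OF simplices[OF \<tau>]])
qed

lemma energy_diff:
  assumes u: "u \<in> fe_space \<Omega> R" and v: "v \<in> fe_space \<Omega> R"
  shows "energy u \<le> 2 * energy v + 2 * energy (\<lambda>x. u x - v x)"
proof -
  have sq: "(norm a)\<^sup>2 \<le> 2 * (norm b)\<^sup>2 + 2 * (norm (a - b))\<^sup>2" for a b :: 'a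
  proof -
    have "(norm a)\<^sup>2 \<le> (norm b + norm (a - b))\<^sup>2"
      using norm_triangle_ineq[of b "a - b"] by (intro power_mono) auto
    also have "\<dots> \<le> 2 * (norm b)\<^sup>2 + 2 * (norm (a - b))\<^sup>2"
      using zero_le_power2[of "norm b - norm (a - b)"] by (simp add: power2_eq_square algebra_simps)
    finally show ?thesis .
  qed
  have "energy u \<le> (\<Sum>\<tau>\<in>R. measure lborel \<tau> * (2 * (norm (slope v \<tau>))\<^sup>2 + 2 * (norm (slope u \<tau> - slope v \<tau>))\<^sup>2))"
    unfolding energy_def by (intro sum_mono mult_left_mono sq) auto
  also have "\<dots> = 2 * energy v + 2 * energy (\<lambda>x. u x - v x)"
    unfolding energy_def sum_distrib_left sum.distrib[symmetric]
    by (intro sum.cong) (auto simp: fe_diff(2)[OF u v] algebra_simps)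
  finally show ?thesis .
qed

lemma fe_expansion:
  assumes u: "u \<in> fe_space \<Omega> R"
  shows "u x = (\<Sum>p\<in>vertices \<inter> \<Omega>. u p * nodal_interp (\<lambda>q. if q = p then 1 else 0) x)"
proof (cases "x \<in> closure \<Omega>")
  case True
  then obtain \<tau> where \<tau>: "\<tau> \<in> R" "x \<in> \<tau>" using cover by blast
  have fin: "finite (corners \<tau>)" using corners_simplex(1)[OF simplices[OF \<tau>(1)]] .
  have hat: "nodal_interp (\<lambda>q. if q = p then 1 else 0) x = (if p \<in> corners \<tau> then bary \<tau> p x else 0)" for p
    unfolding nodal_interp_eq[OF \<tau>] using fin by (simp add: if_distrib[of "\<lambda>t. t * _"] cong: if_cong)
  have "(\<Sum>p\<in>vertices \<inter> \<Omega>. u p * nodal_interp (\<lambda>q. if q = p then 1 else 0) x) =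
      (\<Sum>p\<in>corners \<tau> \<inter> \<Omega>. u p * bary \<tau> p x)"
    unfolding hat using \<tau>(1) finite_vertices
    by (intro sum.mono_neutral_cong_right) (auto simp: vertices_def)
  also have "\<dots> = (\<Sum>p\<in>corners \<tau>. u p * bary \<tau> p x)"
    using fin fe_zero[OF u] by (intro sum.mono_neutral_left) auto
  finally show ?thesis using fe_corner_sum[OF u \<tau>] by simp
next
  case False
  then have "u x = 0" using fe_zero[OF u] closure_subset by blast
  then show ?thesis using False by (simp add: nodal_interp_def)
qed

lemma hat_in_fe: "p \<in> vertices \<inter> \<Omega> \<Longrightarrow> nodal_interp (\<lambda>q. if q = p then 1 else 0) \<in> fe_space \<Omega> R"
  by (rule nodal_interp_in_fe) auto

lemma hat_sum_in_fe: "(\<lambda>x. \<Sum>p\<in>vertices \<inter> \<Omega>. c p * nodal_interp (\<lambda>q. if q = p then 1 else 0) x) \<in> fe_space \<Omega> R"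
proof -
  define y where "y q = (if q \<in> \<Omega> then c q else 0)" for q
  have y: "nodal_interp y \<in> fe_space \<Omega> R" by (rule nodal_interp_in_fe) (simp add: y_def)
  have eq: "nodal_interp y p = c p" if p: "p \<in> vertices \<inter> \<Omega>" for p
  proof -
    obtain \<tau> where \<tau>: "\<tau> \<in> R" "p \<in> corners \<tau>" using p unfolding vertices_def by blast
    have "nodal_interp y p = (\<Sum>q\<in>corners \<tau>. if q = p then y q else 0)"
      unfolding nodal_interp_eq[OF \<tau>(1) corner_in[OF simplices[OF \<tau>(1)] \<tau>(2)]]
      using \<tau> bary_corner[OF simplices[OF \<tau>(1)]] by (intro sum.cong) auto
    then show ?thesis using \<tau>(2) p corners_simplex(1)[OF simplices[OF \<tau>(1)]] by (simp add: y_def)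
  qed
  from y have "(\<lambda>x. \<Sum>p\<in>vertices \<inter> \<Omega>. c p * nodal_interp (\<lambda>q. if q = p then 1 else 0) x) = nodal_interp y"
    by (intro ext, subst fe_expansion[OF y]) (simp add: eq)
  with y show ?thesis by simp
qed

theorem l2_projection_fe:
  assumes u: "cont_supp u"
  defines "w \<equiv> l2_projection \<Omega> (fe_space \<Omega> R) u"
  shows "w \<in> fe_space \<Omega> R" "\<And>v. v \<in> fe_space \<Omega> R \<Longrightarrow> ip (\<lambda>x. u x - w x) v = 0"
proof -
  define P where "P w \<longleftrightarrow> w \<in> fe_space \<Omega> R \<and> (\<forall>v\<in>fe_space \<Omega> R. l2_inner \<Omega> (\<lambda>x. u x - w x) v = 0)" for w
  have conv: "l2_inner \<Omega> (\<lambda>x. u x - w x) v = ip (\<lambda>x. u x - w x) v"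
    if "w \<in> fe_space \<Omega> R" "v \<in> fe_space \<Omega> R" for w v
    by (intro l2_inner_eq_ip dom(1) cont_supp_diff u fe_cont_supp that fe_zero[OF that(2)])
  let ?\<phi> = "\<lambda>p. nodal_interp (\<lambda>q. if q = p then 1 else 0)"
  have \<phi>: "cont_supp (?\<phi> p)" if "p \<in> vertices \<inter> \<Omega>" for p using fe_cont_supp[OF hat_in_fe[OF that]] .
  obtain c where c: "\<forall>p\<in>vertices \<inter> \<Omega>. ip (\<lambda>x. u x - (\<Sum>q\<in>vertices \<inter> \<Omega>. c q * ?\<phi> q x)) (?\<phi> p) = 0"
    using orthogonal_projection_exists[of "vertices \<inter> \<Omega>" ?\<phi> u] finite_vertices \<phi> u by blast
  define w0 where "w0 = (\<lambda>x. \<Sum>q\<in>vertices \<inter> \<Omega>. c q * ?\<phi> q x)"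
  have w0: "w0 \<in> fe_space \<Omega> R" unfolding w0_def by (rule hat_sum_in_fe)
  have cs: "cont_supp (\<lambda>x. u x - w0 x)" by (intro cont_supp_diff u fe_cont_supp w0)
  have orth: "ip (\<lambda>x. u x - w0 x) v = 0" if v: "v \<in> fe_space \<Omega> R" for v
  proof -
    have "ip (\<lambda>x. u x - w0 x) v = ip (\<lambda>x. u x - w0 x) (\<lambda>x. \<Sum>p\<in>vertices \<inter> \<Omega>. v p * ?\<phi> p x)"
      using fe_expansion[OF v] by (simp flip: fe_expansion[OF v])
    also have "\<dots> = (\<Sum>p\<in>vertices \<inter> \<Omega>. v p * ip (\<lambda>x. u x - w0 x) (?\<phi> p))"
      by (rule ip_sum_right[OF \<phi> cs])
    also have "\<dots> = 0" using c unfolding w0_def by simp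
    finally show ?thesis .
  qed
  then have "P w0" unfolding P_def using w0 conv[OF w0] by simp
  moreover have "w = w0" if "P w" for w
  proof -
    have w: "w \<in> fe_space \<Omega> R" using that P_def by blast
    define d where "d = (\<lambda>x. w0 x - w x)"
    have d: "d \<in> fe_space \<Omega> R" unfolding d_def by (rule fe_diff(1)[OF w0 w])
    have "ip (\<lambda>x. u x - w x) d = 0" using that conv[OF w d] d unfolding P_def by simp
    moreover have "ip (\<lambda>x. u x - w0 x) d = 0" by (rule orth[OF d])
    moreover have "ip (\<lambda>x. (u x - w x) - (u x - w0 x)) d = ip (\<lambda>x. u x - w x) d - ip (\<lambda>x. u x - w0 x) d"
      by (intro ip_diff_left cs cont_supp_diff u fe_cont_supp w d)
    ultimately have "ip d d = 0" by (simp add: d_def)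
    then have "d x = 0" for x using ip_self_eq_0[OF fe_cont_supp[OF d]] by blast
    then show ?thesis unfolding d_def by auto
  qed
  ultimately have "P (THE w. P w)" by (metis (mono_tags) theI)
  then have "P w" unfolding w_def l2_projection_def P_def[abs_def] by simp
  then show "w \<in> fe_space \<Omega> R" "\<And>v. v \<in> fe_space \<Omega> R \<Longrightarrow> ip (\<lambda>x. u x - w x) v = 0"
    using conv unfolding P_def by auto
qed

lemma l2_projection_best:
  assumes u: "cont_supp u" and w: "w \<in> fe_space \<Omega> R"
  defines "q \<equiv> l2_projection \<Omega> (fe_space \<Omega> R) u"
  shows "ip (\<lambda>x. q x - w x) (\<lambda>x. q x - w x) \<le> ip (\<lambda>x. u x - w x) (\<lambda>x. u x - w x)"
proof -
  have q: "q \<in> fe_space \<Omega> R" and orth: "\<And>v. v \<in> fe_space \<Omega> R \<Longrightarrow> ip (\<lambda>x. u x - q x) v = 0"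
    using l2_projection_fe[OF u] unfolding q_def by blast+
  define e where "e = (\<lambda>x. u x - w x)"
  define d where "d = (\<lambda>x. q x - w x)"
  have d: "d \<in> fe_space \<Omega> R" unfolding d_def by (rule fe_diff(1)[OF q w])
  have cs: "cont_supp e" "cont_supp d" "cont_supp (\<lambda>x. e x - d x)"
    unfolding e_def using fe_cont_supp d w u by (auto intro!: cont_supp_diff)
  have "(\<lambda>x. e x - d x) = (\<lambda>x. u x - q x)" by (auto simp: e_def d_def)
  then have "ip (\<lambda>x. e x - d x) d = 0" using orth[OF d] by simp
  then have "ip e d = ip d d" using cs by (simp add: ip_diff_left)
  moreover have "0 \<le> ip (\<lambda>x. e x - d x) (\<lambda>x. e x - d x)" by (rule ip_nonneg)
  ultimately have "ip d d \<le> ip e e"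
    using cs by (simp add: ip_diff_left ip_diff_right ip_commute[of d e])
  then show ?thesis unfolding e_def d_def .
qed

end

section \<open>Inverse estimate\<close>

definition ball_measure :: "'a::euclidean_space itself \<Rightarrow> real \<Rightarrow> real" where
  "ball_measure _ r = measure lborel (ball (0::'a) r)"

lemma measure_ball_scale:
  fixes s :: "'a::euclidean_space"
  assumes "0 \<le> r"
  shows "measure lborel (ball s r) = ball_measure TYPE('a) 1 * r ^ DIM('a)"
    "emeasure lborel (ball s r) = ennreal (ball_measure TYPE('a) 1 * r ^ DIM('a))"
    "measure lborel (cball s r) = ball_measure TYPE('a) 1 * r ^ DIM('a)"
  using assms by (simp_all add: ball_measure_def measure_def emeasure_ball emeasure_cball)

lemma ball_measure_pos: "0 < ball_measure TYPE('a::euclidean_space) 1"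
  by (simp add: ball_measure_def measure_def emeasure_ball)

context fe_mesh
begin

text \<open>Two small balls in \<open>\<tau>\<close>, displaced in the direction of \<open>a\<close>, see values that differ by
  a multiple of \<open>norm a\<close>.\<close>

lemma inverse_estimate_simplex:
  fixes a :: 'a
  assumes \<tau>: "\<tau> \<in> R" and fat: "ball s (\<rho> * diameter \<tau>) \<subseteq> \<tau>" and \<rho>: "0 < \<rho>"
    and h: "0 < h" "c * h \<le> diameter \<tau>" "0 < c"
    and v: "\<And>x. x \<in> \<tau> \<Longrightarrow> v x = a \<bullet> x + b"
    and meas: "v \<in> borel_measurable borel"
  shows "ennreal (measure lborel \<tau> * (norm a)\<^sup>2) \<le>
    ennreal (16 * (4 / \<rho>) ^ DIM('a) / (\<rho> * c)\<^sup>2 / h\<^sup>2) *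
      (\<integral>\<^sup>+x. indicator (interior \<tau>) x * ennreal ((v x - \<beta>)\<^sup>2) \<partial>lborel)"
proof (cases "a = 0")
  case False
  note [measurable] = meas
  have [measurable]: "interior \<tau> \<in> sets borel" by simp
  define d where "d = diameter \<tau>"
  define r where "r = \<rho> * d"
  have d: "0 < d" using h unfolding d_def by (meson less_le_trans mult_pos_pos)
  have r: "0 < r" "\<rho> * c * h \<le> r" using d \<rho> h unfolding r_def d_def by (auto simp: mult.assoc)
  have ball_int: "ball s r \<subseteq> interior \<tau>"
    using fat unfolding r_def d_def by (simp add: interior_maximal)
  define z where "z = (r / 2 / norm a) *\<^sub>R a"
  have nz: "norm z = r / 2" "a \<bullet> z = norm a * r / 2"
    using False r by (simp_all add: z_def dot_square_norm power2_eq_square)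
  have sub: "ball s (r / 4) \<subseteq> ball s r" using r by (intro subset_ball) auto
  have sub': "x + z \<in> ball s r" if "x \<in> ball s (r / 4)" for x
  proof -
    have "dist s (x + z) \<le> dist s x + norm z"
      by (metis add_diff_cancel_left' dist_norm dist_triangle norm_minus_commute)
    then show ?thesis using that nz r by simp
  qed
  let ?I = "\<integral>\<^sup>+x. indicator (interior \<tau>) x * ennreal ((v x - \<beta>)\<^sup>2) \<partial>lborel"
  have "ennreal ((norm a)\<^sup>2 * r\<^sup>2 / 8) * emeasure lborel (ball s (r / 4)) =
      (\<integral>\<^sup>+x. ennreal ((norm a)\<^sup>2 * r\<^sup>2 / 8) * indicator (ball s (r / 4)) x \<partial>lborel)"
    by (subst nn_integral_cmult_indicator) auto
  also have "\<dots> \<le> (\<integral>\<^sup>+x. indicator (interior \<tau>) x * ennreal ((v x - \<beta>)\<^sup>2) +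
      indicator (interior \<tau>) (z + x) * ennreal ((v (z + x) - \<beta>)\<^sup>2) \<partial>lborel)"
  proof (rule nn_integral_mono)
    fix x
    show "ennreal ((norm a)\<^sup>2 * r\<^sup>2 / 8) * indicator (ball s (r / 4)) x \<le>
      indicator (interior \<tau>) x * ennreal ((v x - \<beta>)\<^sup>2) + indicator (interior \<tau>) (z + x) * ennreal ((v (z + x) - \<beta>)\<^sup>2)"
    proof (cases "x \<in> ball s (r / 4)")
      case True
      then have x: "x \<in> interior \<tau>" "z + x \<in> interior \<tau>"
        using sub sub' ball_int by (auto simp: add.commute)
      then have x': "x \<in> \<tau>" "z + x \<in> \<tau>" using interior_subset by blast+
      have e: "(v (z + x) - \<beta>) - (v x - \<beta>) = norm a * r / 2"
        using x' v nz by (simp add: inner_add_right)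
      then have "(norm a * r / 2)\<^sup>2 = ((v (z + x) - \<beta>) - (v x - \<beta>))\<^sup>2" by (simp only: e)
      also have "\<dots> \<le> 2 * ((v x - \<beta>)\<^sup>2 + (v (z + x) - \<beta>)\<^sup>2)"
        using zero_le_power2[of "(v (z + x) - \<beta>) + (v x - \<beta>)"] by (simp add: power2_eq_square algebra_simps)
      finally have "(norm a)\<^sup>2 * r\<^sup>2 / 8 \<le> (v x - \<beta>)\<^sup>2 + (v (z + x) - \<beta>)\<^sup>2"
        by (simp add: power2_eq_square algebra_simps)
      then show ?thesis using True x by (simp add: ennreal_leI flip: ennreal_plus)
    qed simp
  qed
  also have "\<dots> = ?I + (\<integral>\<^sup>+x. indicator (interior \<tau>) (z + x) * ennreal ((v (z + x) - \<beta>)\<^sup>2) \<partial>lborel)"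
    by (intro nn_integral_add; measurable)
  also have "(\<integral>\<^sup>+x. indicator (interior \<tau>) (z + x) * ennreal ((v (z + x) - \<beta>)\<^sup>2) \<partial>lborel) =
      (\<integral>\<^sup>+x. indicator (interior \<tau>) x * ennreal ((v x - \<beta>)\<^sup>2) \<partial>(distr lborel borel ((+) z)))"
    by (subst nn_integral_distr) auto
  also have "\<dots> = ?I" by (simp add: lborel_distr_plus)
  finally have main: "ennreal ((norm a)\<^sup>2 * r\<^sup>2 / 8) * emeasure lborel (ball s (r / 4)) \<le> 2 * ?I"
    by (simp add: mult_2)
  have "\<tau> \<noteq> {}" using simplex_interior_nonempty[OF simplices[OF \<tau>]] interior_subset by blast
  then obtain x0 where x0: "x0 \<in> \<tau>" by blast
  have "\<tau> \<subseteq> cball x0 d"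
    using diameter_bounded_bound[OF compact_imp_bounded[OF simplex_compact[OF simplices[OF \<tau>]]] x0]
    unfolding d_def by auto
  then have "measure lborel \<tau> \<le> measure lborel (cball x0 d)"
    using simplex_closed[OF simplices[OF \<tau>]] emeasure_bounded_finite[OF bounded_cball, of x0 d]
    by (intro measure_mono_fmeasurable) (auto simp: fmeasurable_def)
  also have "\<dots> = ball_measure TYPE('a) 1 * (r / \<rho>) ^ DIM('a)"
    using d \<rho> by (subst measure_ball_scale) (auto simp: r_def)
  also have "\<dots> = (4 / \<rho>) ^ DIM('a) * measure lborel (ball s (r / 4))"
    using r by (subst measure_ball_scale) (auto simp: power_divide)
  finally have "measure lborel \<tau> * (norm a)\<^sup>2 \<le> (4 / \<rho>) ^ DIM('a) * measure lborel (ball s (r / 4)) * (norm a)\<^sup>2"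
    by (intro mult_right_mono) auto
  also have "\<dots> = (8 * (4 / \<rho>) ^ DIM('a) / r\<^sup>2) * ((norm a)\<^sup>2 * r\<^sup>2 / 8 * measure lborel (ball s (r / 4)))"
    using r by (simp add: field_simps)
  also have "\<dots> \<le> (8 * (4 / \<rho>) ^ DIM('a) / (\<rho> * c * h)\<^sup>2) * ((norm a)\<^sup>2 * r\<^sup>2 / 8 * measure lborel (ball s (r / 4)))"
    using r \<rho> h by (intro mult_right_mono divide_left_mono power_mono) auto
  finally have "ennreal (measure lborel \<tau> * (norm a)\<^sup>2) \<le>
     ennreal ((8 * (4 / \<rho>) ^ DIM('a) / (\<rho> * c * h)\<^sup>2) * ((norm a)\<^sup>2 * r\<^sup>2 / 8 * measure lborel (ball s (r / 4))))"
    by (rule ennreal_leI)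
  also have "\<dots> = ennreal (8 * (4 / \<rho>) ^ DIM('a) / (\<rho> * c * h)\<^sup>2) *
      (ennreal ((norm a)\<^sup>2 * r\<^sup>2 / 8) * emeasure lborel (ball s (r / 4)))"
  proof -
    have "emeasure lborel (ball s (r / 4)) = ennreal (measure lborel (ball s (r / 4)))"
      using r by (simp add: measure_ball_scale)
    moreover have "0 \<le> 8 * (4 / \<rho>) ^ DIM('a) / (\<rho> * c * h)\<^sup>2" using \<rho> by simp
    moreover have "0 \<le> (norm a)\<^sup>2 * r\<^sup>2 / 8" by simp
    ultimately show ?thesis by (simp only: ennreal_mult')
  qed
  also have "\<dots> \<le> ennreal (8 * (4 / \<rho>) ^ DIM('a) / (\<rho> * c * h)\<^sup>2) * (2 * ?I)"
    by (intro mult_left_mono main) auto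
  also have "\<dots> = ennreal (8 * (4 / \<rho>) ^ DIM('a) / (\<rho> * c * h)\<^sup>2 * 2) * ?I"
    using ennreal_mult''[of 2 "8 * (4 / \<rho>) ^ DIM('a) / (\<rho> * c * h)\<^sup>2"] by (simp only: ennreal_numeral mult.assoc)
  also have "8 * (4 / \<rho>) ^ DIM('a) / (\<rho> * c * h)\<^sup>2 * 2 = 16 * (4 / \<rho>) ^ DIM('a) / (\<rho> * c)\<^sup>2 / h\<^sup>2"
    by (simp add: power_mult_distrib)
  finally show ?thesis .
qed simp

lemma sum_interior_integral_le:
  assumes "S \<subseteq> R" "f \<in> borel_measurable borel"
  shows "(\<Sum>\<tau>\<in>S. \<integral>\<^sup>+x. indicator (interior \<tau>) x * f x \<partial>lborel) \<le> (\<integral>\<^sup>+x. f x \<partial>lborel)"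
proof -
  have S: "finite S" using assms(1) finite_R finite_subset by blast
  note [measurable] = assms(2)
  have "(\<Sum>\<tau>\<in>S. \<integral>\<^sup>+x. indicator (interior \<tau>) x * f x \<partial>lborel) =
      (\<integral>\<^sup>+x. (\<Sum>\<tau>\<in>S. indicator (interior \<tau>) x * f x) \<partial>lborel)"
    by (subst nn_integral_sum) auto
  also have "\<dots> \<le> (\<integral>\<^sup>+x. f x \<partial>lborel)"
  proof (rule nn_integral_mono)
    fix x
    show "(\<Sum>\<tau>\<in>S. indicator (interior \<tau>) x * f x) \<le> f x"
    proof (cases "\<exists>\<tau>\<in>S. x \<in> interior \<tau>")
      case True
      then obtain \<tau> where \<tau>: "\<tau> \<in> S" "x \<in> interior \<tau>" by blast
      have "(\<Sum>\<sigma>\<in>S. indicator (interior \<sigma>) x * f x) = (\<Sum>\<sigma>\<in>S. if \<sigma> = \<tau> then f x else 0)"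
        using \<tau> assms(1) disjoint_interiors by (intro sum.cong) (auto simp: indicator_def)
      then show ?thesis using S \<tau> by simp
    next
      case False
      then show ?thesis by (subst sum.neutral) (auto simp: indicator_def)
    qed
  qed
  finally show ?thesis .
qed

lemma inverse_estimate:
  assumes fat: "\<And>\<tau>. \<tau> \<in> R \<Longrightarrow> \<exists>s. ball s (\<rho> * diameter \<tau>) \<subseteq> \<tau>" and \<rho>: "0 < \<rho>"
    and h: "0 < h" "0 < c" "\<And>\<tau>. \<tau> \<in> R \<Longrightarrow> c * h \<le> diameter \<tau>"
    and v: "v \<in> fe_space \<Omega> R"
  shows "energy v \<le> 16 * (4 / \<rho>) ^ DIM('a) / (\<rho> * c)\<^sup>2 / h\<^sup>2 * ip v v"
proof -
  define A where "A = 16 * (4 / \<rho>) ^ DIM('a) / (\<rho> * c)\<^sup>2 / h\<^sup>2"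
  have A: "0 \<le> A" unfolding A_def using \<rho> by simp
  have vm: "v \<in> borel_measurable borel" using cont_supp_measurable[OF fe_cont_supp[OF v]] .
  have "ennreal (energy v) = (\<Sum>\<tau>\<in>R. ennreal (measure lborel \<tau> * (norm (slope v \<tau>))\<^sup>2))"
    unfolding energy_def by (subst sum_ennreal) auto
  also have "\<dots> \<le> (\<Sum>\<tau>\<in>R. ennreal A * (\<integral>\<^sup>+x. indicator (interior \<tau>) x * ennreal ((v x)\<^sup>2) \<partial>lborel))"
  proof (rule sum_mono)
    fix \<tau> assume \<tau>: "\<tau> \<in> R"
    obtain s where s: "ball s (\<rho> * diameter \<tau>) \<subseteq> \<tau>" using fat[OF \<tau>] by blast
    obtain b where b: "\<And>x. x \<in> \<tau> \<Longrightarrow> v x = slope v \<tau> \<bullet> x + b" using fe_affine[OF v \<tau>] by blast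
    show "ennreal (measure lborel \<tau> * (norm (slope v \<tau>))\<^sup>2) \<le>
        ennreal A * (\<integral>\<^sup>+x. indicator (interior \<tau>) x * ennreal ((v x)\<^sup>2) \<partial>lborel)"
      using inverse_estimate_simplex[OF \<tau> s \<rho> h(1) h(3)[OF \<tau>] h(2) b vm, of 0] by (simp add: A_def)
  qed
  also have "\<dots> = ennreal A * (\<Sum>\<tau>\<in>R. \<integral>\<^sup>+x. indicator (interior \<tau>) x * ennreal ((v x)\<^sup>2) \<partial>lborel)"
    by (rule sum_distrib_left[symmetric])
  also have "\<dots> \<le> ennreal A * (\<integral>\<^sup>+x. ennreal ((v x)\<^sup>2) \<partial>lborel)"
    using vm by (intro mult_left_mono sum_interior_integral_le) auto
  also have "(\<integral>\<^sup>+x. ennreal ((v x)\<^sup>2) \<partial>lborel) = ennreal (ip v v)"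
    unfolding ip_def power2_eq_square
    by (intro nn_integral_eq_integral cont_supp_integrable_mult fe_cont_supp[OF v]) auto
  also have "ennreal A * ennreal (ip v v) = ennreal (A * ip v v)"
    using A ip_nonneg[of v] by (simp add: ennreal_mult)
  finally have "energy v \<le> A * ip v v"
    using A ip_nonneg[of v] by (subst (asm) ennreal_le_iff) auto
  then show ?thesis unfolding A_def .
qed

end

section \<open>Local mean oscillation\<close>

definition osc :: "('a::euclidean_space \<Rightarrow> real) \<Rightarrow> real \<Rightarrow> 'a \<Rightarrow> real" where
  "osc u \<delta> x = (\<integral>y. indicat_real (ball x \<delta>) y * (u y - u x)\<^sup>2 \<partial>lborel)"

lemma integrable_ball:
  fixes f :: "'a::euclidean_space \<Rightarrow> real"
  assumes f: "continuous_on UNIV f"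
  shows "integrable lborel (\<lambda>y. indicat_real (ball s r) y * f y)"
proof -
  have "bounded (f ` cball s r)"
    by (intro compact_imp_bounded compact_continuous_image continuous_on_subset[OF f]) auto
  then obtain C where "\<forall>y\<in>f ` cball s r. norm y \<le> C" unfolding bounded_iff by blast
  then have C: "\<bar>f y\<bar> \<le> C" if "y \<in> cball s r" for y using that by auto
  have "norm (indicat_real (ball s r) y * f y) \<le> \<bar>C\<bar>" for y
    using C[of y] by (auto simp: indicator_def)
  moreover have "indicat_real (ball s r) y * f y = 0" if y: "norm s + r < norm y" for y
  proof -
    have "norm y \<le> norm s + dist s y" using norm_triangle_sub[of y s] by (simp add: dist_norm norm_minus_commute)
    then show ?thesis using y by auto
  qed
  moreover have "(\<lambda>y. indicat_real (ball s r) y * f y) \<in> borel_measurable borel"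
    using borel_measurable_continuous_onI[OF f] by (intro borel_measurable_times borel_measurable_indicator) auto
  ultimately show ?thesis by (intro integrable_bounded_support[where C="\<bar>C\<bar>" and B="norm s + r"]) auto
qed

lemma osc_subball:
  assumes u: "continuous_on UNIV u" and "ball s r \<subseteq> ball x \<delta>"
  shows "(\<integral>y. indicat_real (ball s r) y * (u y - u x)\<^sup>2 \<partial>lborel) \<le> osc u \<delta> x"
  unfolding osc_def using assms(2)
  by (intro integral_mono integrable_ball continuous_intros u) (auto simp: indicator_def)

lemma osc_nonneg: "0 \<le> osc u \<delta> x"
  unfolding osc_def by (intro Bochner_Integration.integral_nonneg) auto

lemma integral_indicator_ball: "(\<integral>y. indicat_real (ball s r) y * c \<partial>lborel) = measure lborel (ball s r) * c"
  by simp

lemma osc_zero: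
  assumes u: "continuous_on UNIV u" and sub: "ball s r \<subseteq> ball x \<delta>" and 0: "\<And>y. y \<in> ball s r \<Longrightarrow> u y = 0"
  shows "measure lborel (ball s r) * (u x - 0)\<^sup>2 \<le> osc u \<delta> x"
proof -
  have "measure lborel (ball s r) * (u x - 0)\<^sup>2 = (\<integral>y. indicat_real (ball s r) y * (u x)\<^sup>2 \<partial>lborel)"
    by (simp only: integral_indicator_ball) simp
  also have "\<dots> = (\<integral>y. indicat_real (ball s r) y * (u y - u x)\<^sup>2 \<partial>lborel)"
    using 0 by (intro Bochner_Integration.integral_cong) (auto simp: indicator_def)
  also have "\<dots> \<le> osc u \<delta> x" by (rule osc_subball[OF u sub])
  finally show ?thesis .
qed

definition ball_avg :: "('a::euclidean_space \<Rightarrow> real) \<Rightarrow> 'a \<Rightarrow> real \<Rightarrow> real" where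
  "ball_avg u s r = (\<integral>y. indicat_real (ball s r) y * u y \<partial>lborel) / measure lborel (ball s r)"

lemma osc_avg:
  fixes u :: "'a::euclidean_space \<Rightarrow> real"
  assumes u: "continuous_on UNIV u" and sub: "ball s r \<subseteq> ball x \<delta>" and r: "0 < r"
  shows "measure lborel (ball s r) * (u x - ball_avg u s r)\<^sup>2 \<le> osc u \<delta> x"
proof -
  define m where "m = measure lborel (ball s r)"
  define \<beta> where "\<beta> = ball_avg u s r"
  have m: "m > 0" unfolding m_def using r ball_measure_pos[where 'a='a] by (simp add: measure_ball_scale)
  have mean: "(\<integral>y. indicat_real (ball s r) y * u y \<partial>lborel) = m * \<beta>"
    using m by (simp add: \<beta>_def ball_avg_def m_def)
  have "(\<integral>y. indicat_real (ball s r) y * ((u x - \<beta>)\<^sup>2 + 2 * (u x - \<beta>) * \<beta>) - 2 * (u x - \<beta>) * (indicat_real (ball s r) y * u y) \<partial>lborel)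
     = m * ((u x - \<beta>)\<^sup>2 + 2 * (u x - \<beta>) * \<beta>) - 2 * (u x - \<beta>) * (m * \<beta>)"
    using mean integral_indicator_ball[of s r "(u x - \<beta>)\<^sup>2 + 2 * (u x - \<beta>) * \<beta>"]
    by (subst Bochner_Integration.integral_diff)
      (auto simp only: m_def integral_mult_right_zero intro!: integrable_ball integrable_mult_right continuous_intros u)
  also have "\<dots> = m * (u x - \<beta>)\<^sup>2" by (simp add: algebra_simps)
  finally have "m * (u x - \<beta>)\<^sup>2 = (\<integral>y. indicat_real (ball s r) y * ((u x - \<beta>)\<^sup>2 + 2 * (u x - \<beta>) * \<beta>) - 2 * (u x - \<beta>) * (indicat_real (ball s r) y * u y) \<partial>lborel)"
    by simp
  also have "\<dots> \<le> (\<integral>y. indicat_real (ball s r) y * (u y - u x)\<^sup>2 \<partial>lborel)"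
  proof (rule integral_mono)
    fix y
    have "(u x - \<beta>)\<^sup>2 + 2 * (u x - \<beta>) * \<beta> - 2 * (u x - \<beta>) * u y \<le> (u y - u x)\<^sup>2"
      using zero_le_power2[of "u y - \<beta>"] by (simp add: power2_eq_square algebra_simps)
    then show "indicat_real (ball s r) y * ((u x - \<beta>)\<^sup>2 + 2 * (u x - \<beta>) * \<beta>) - 2 * (u x - \<beta>) * (indicat_real (ball s r) y * u y)
        \<le> indicat_real (ball s r) y * (u y - u x)\<^sup>2"
      by (auto simp: indicator_def)
  qed (auto intro!: Bochner_Integration.integrable_diff integrable_mult_right integrable_ball continuous_intros u)
  also have "\<dots> \<le> osc u \<delta> x" by (rule osc_subball[OF u sub])
  finally show ?thesis unfolding m_def \<beta>_def .
qed

lemma integral_half_scaling: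
  fixes f :: "'a::euclidean_space \<Rightarrow> real"
  assumes [measurable]: "f \<in> borel_measurable borel"
  shows "(\<integral>y. indicat_real (ball s r) y * f ((1/2) *\<^sub>R (p + y)) \<partial>lborel) =
    2 ^ DIM('a) * (\<integral>y. indicat_real (ball ((1/2) *\<^sub>R (p + s)) (r / 2)) y * f y \<partial>lborel)"
proof -
  define F where "F y = indicat_real (ball ((1/2) *\<^sub>R (p + s)) (r / 2)) y * f y" for y
  have [measurable]: "F \<in> borel_measurable borel" unfolding F_def by (intro borel_measurable_times borel_measurable_indicator) auto
  have F: "F ((1/2) *\<^sub>R p + (1/2) *\<^sub>R y) = indicat_real (ball s r) y * f ((1/2) *\<^sub>R (p + y))" for y
  proof -
    have "(1/2) *\<^sub>R (p + s) - ((1/2) *\<^sub>R p + (1/2) *\<^sub>R y) = (1/2) *\<^sub>R (s - y)"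
      by (simp add: algebra_simps)
    then have "dist ((1/2) *\<^sub>R (p + s)) ((1/2) *\<^sub>R p + (1/2) *\<^sub>R y) = dist s y / 2"
      by (simp add: dist_norm)
    then show ?thesis by (simp add: F_def indicator_def scaleR_add_right)
  qed
  have "(\<integral>y. F y \<partial>lborel) = (\<integral>y. F y \<partial>density (distr lborel borel (\<lambda>x. (1/2) *\<^sub>R p + (1/2) *\<^sub>R x)) (\<lambda>_. ennreal (\<bar>1/2\<bar> ^ DIM('a))))"
    using lborel_affine[of "1/2" "(1/2) *\<^sub>R p"] by simp
  also have "\<dots> = (1/2) ^ DIM('a) * (\<integral>y. F ((1/2) *\<^sub>R p + (1/2) *\<^sub>R y) \<partial>lborel)"
    by (simp add: integral_density integral_distr)
  finally have "(\<integral>y. F y \<partial>lborel) = (1/2) ^ DIM('a) * (\<integral>y. indicat_real (ball s r) y * f ((1/2) *\<^sub>R (p + y)) \<partial>lborel)"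
    unfolding F .
  then show ?thesis unfolding F_def by (simp add: power_one_over)
qed

text \<open>For affine \<open>u\<close>, the value at \<open>p\<close> is recovered from \<open>u p = 2 * u ((p + y) / 2) - u y\<close>.\<close>

lemma osc_affine:
  fixes u :: "'a::euclidean_space \<Rightarrow> real"
  assumes u: "continuous_on UNIV u" and sub: "ball s r \<subseteq> ball x \<delta>"
    and sub2: "ball ((1/2) *\<^sub>R (p + s)) (r / 2) \<subseteq> ball x \<delta>"
    and aff: "\<And>y. y \<in> ball s r \<Longrightarrow> u p = 2 * u ((1/2) *\<^sub>R (p + y)) - u y"
  shows "measure lborel (ball s r) * (u x - u p)\<^sup>2 \<le> (8 * 2 ^ DIM('a) + 2) * osc u \<delta> x"
proof -
  have cont: "continuous_on UNIV (\<lambda>y. (u ((1/2) *\<^sub>R (p + y)) - u x)\<^sup>2)"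
    by (intro continuous_intros continuous_on_compose2[OF u]) auto
  have "measure lborel (ball s r) * (u x - u p)\<^sup>2 = (\<integral>y. indicat_real (ball s r) y * (u x - u p)\<^sup>2 \<partial>lborel)"
    by (simp only: integral_indicator_ball)
  also have "\<dots> \<le> (\<integral>y. 8 * (indicat_real (ball s r) y * (u ((1/2) *\<^sub>R (p + y)) - u x)\<^sup>2)
      + 2 * (indicat_real (ball s r) y * (u y - u x)\<^sup>2) \<partial>lborel)"
  proof (rule integral_mono)
    fix y
    have "(2 * a - b)\<^sup>2 \<le> 8 * a\<^sup>2 + 2 * b\<^sup>2" for a b :: real
      using zero_le_power2[of "2 * a + b"] by (simp add: power2_eq_square algebra_simps)
    then have "(2 * (u ((1/2) *\<^sub>R (p + y)) - u x) - (u y - u x))\<^sup>2 \<le> 8 * (u ((1/2) *\<^sub>R (p + y)) - u x)\<^sup>2 + 2 * (u y - u x)\<^sup>2"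
      by blast
    moreover have "2 * (u ((1/2) *\<^sub>R (p + y)) - u x) - (u y - u x) = u p - u x" if "y \<in> ball s r"
      using aff[OF that] by simp
    ultimately show "indicat_real (ball s r) y * (u x - u p)\<^sup>2 \<le> 8 * (indicat_real (ball s r) y * (u ((1/2) *\<^sub>R (p + y)) - u x)\<^sup>2)
      + 2 * (indicat_real (ball s r) y * (u y - u x)\<^sup>2)"
      by (cases "y \<in> ball s r") (auto simp: power2_commute[of "u x"])
  qed (intro Bochner_Integration.integrable_add integrable_mult_right integrable_ball cont continuous_intros u)+
  also have "\<dots> = 8 * (\<integral>y. indicat_real (ball s r) y * (u ((1/2) *\<^sub>R (p + y)) - u x)\<^sup>2 \<partial>lborel) +
      2 * (\<integral>y. indicat_real (ball s r) y * (u y - u x)\<^sup>2 \<partial>lborel)"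
  proof -
    have "integrable lborel (\<lambda>y. 8 * (indicat_real (ball s r) y * (u ((1/2) *\<^sub>R (p + y)) - u x)\<^sup>2))"
      "integrable lborel (\<lambda>y. 2 * (indicat_real (ball s r) y * (u y - u x)\<^sup>2))"
      by (intro integrable_mult_right integrable_ball cont continuous_intros u)+
    then show ?thesis by (simp only: Bochner_Integration.integral_add integral_mult_right_zero)
  qed
  also have "(\<integral>y. indicat_real (ball s r) y * (u ((1/2) *\<^sub>R (p + y)) - u x)\<^sup>2 \<partial>lborel) =
      2 ^ DIM('a) * (\<integral>y. indicat_real (ball ((1/2) *\<^sub>R (p + s)) (r / 2)) y * (u y - u x)\<^sup>2 \<partial>lborel)"
    using integral_half_scaling[of "\<lambda>y. (u y - u x)\<^sup>2" s r p] borel_measurable_continuous_onI[OF u] by simp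
  also have "8 * (2 ^ DIM('a) * (\<integral>y. indicat_real (ball ((1/2) *\<^sub>R (p + s)) (r / 2)) y * (u y - u x)\<^sup>2 \<partial>lborel)) +
      2 * (\<integral>y. indicat_real (ball s r) y * (u y - u x)\<^sup>2 \<partial>lborel) \<le> 8 * (2 ^ DIM('a) * osc u \<delta> x) + 2 * osc u \<delta> x"
    by (intro add_mono mult_left_mono osc_subball u sub sub2) auto
  finally show ?thesis by (simp add: algebra_simps)
qed

lemma osc_nn_integral:
  assumes "continuous_on UNIV u"
  shows "(\<integral>\<^sup>+y. indicator (ball x \<delta>) y * ennreal ((u y - u x)\<^sup>2) \<partial>lborel) = ennreal (osc u \<delta> x)"
proof -
  have "ennreal (osc u \<delta> x) = (\<integral>\<^sup>+y. ennreal (indicat_real (ball x \<delta>) y * (u y - u x)\<^sup>2) \<partial>lborel)"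
    unfolding osc_def by (intro nn_integral_eq_integral[symmetric] integrable_ball continuous_intros assms) auto
  also have "\<dots> = (\<integral>\<^sup>+y. indicator (ball x \<delta>) y * ennreal ((u y - u x)\<^sup>2) \<partial>lborel)"
    by (intro nn_integral_cong) (auto simp: indicator_def)
  finally show ?thesis by simp
qed

lemma osc_measurable:
  assumes u: "continuous_on UNIV (u::'a::euclidean_space \<Rightarrow> real)"
  shows "(\<lambda>x. ennreal (osc u \<delta> x)) \<in> borel_measurable borel"
proof -
  have [measurable]: "u \<in> borel_measurable borel" by (rule borel_measurable_continuous_onI[OF u])
  have [measurable]: "Measurable.pred (borel \<Otimes>\<^sub>M borel) (\<lambda>z::'a \<times> 'a. snd z \<in> ball (fst z) \<delta>)"
    unfolding mem_ball by measurable
  have "(\<lambda>x. \<integral>\<^sup>+y. indicator (ball x \<delta>) y * ennreal ((u y - u x)\<^sup>2) \<partial>lborel) \<in> borel_measurable lborel"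
    unfolding indicator_def by measurable
  then show ?thesis unfolding osc_nn_integral[OF u] by simp
qed

lemma (in fe_mesh) osc_integral:
  assumes u: "u \<in> fe_space \<Omega> R" and \<delta>: "0 \<le> \<delta>"
  shows "(\<integral>\<^sup>+x. ennreal (osc u \<delta> x) \<partial>lborel) \<le> ennreal (ball_measure TYPE('a) 1 * \<delta> ^ DIM('a) * \<delta>\<^sup>2 * energy u)"
proof -
  have cu: "continuous_on UNIV u" by (rule fe_continuous[OF u])
  have [measurable]: "u \<in> borel_measurable borel" by (rule borel_measurable_continuous_onI[OF cu])
  have [measurable]: "ball x \<delta> \<in> sets borel" for x :: 'a by simp
  have shift: "(\<integral>\<^sup>+y. indicator (ball x \<delta>) y * ennreal ((u y - u x)\<^sup>2) \<partial>lborel) =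
      (\<integral>\<^sup>+z. indicator (ball 0 \<delta>) z * ennreal ((u (x + z) - u x)\<^sup>2) \<partial>lborel)" for x
  proof -
    have "(\<integral>\<^sup>+y. indicator (ball x \<delta>) y * ennreal ((u y - u x)\<^sup>2) \<partial>lborel) =
        (\<integral>\<^sup>+y. indicator (ball x \<delta>) y * ennreal ((u y - u x)\<^sup>2) \<partial>distr lborel borel ((+) x))"
      by (simp add: lborel_distr_plus)
    also have "\<dots> = (\<integral>\<^sup>+z. indicator (ball x \<delta>) (x + z) * ennreal ((u (x + z) - u x)\<^sup>2) \<partial>lborel)"
      by (subst nn_integral_distr) measurable
    also have "\<dots> = (\<integral>\<^sup>+z. indicator (ball 0 \<delta>) z * ennreal ((u (x + z) - u x)\<^sup>2) \<partial>lborel)"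
      by (intro nn_integral_cong) (auto simp: indicator_def dist_norm)
    finally show ?thesis .
  qed
  have "(\<integral>\<^sup>+x. ennreal (osc u \<delta> x) \<partial>lborel) =
      (\<integral>\<^sup>+x. \<integral>\<^sup>+z. indicator (ball 0 \<delta>) z * ennreal ((u (x + z) - u x)\<^sup>2) \<partial>lborel \<partial>lborel)"
    by (simp add: shift flip: osc_nn_integral[OF cu])
  also have "\<dots> = (\<integral>\<^sup>+z. \<integral>\<^sup>+x. indicator (ball 0 \<delta>) z * ennreal ((u (x + z) - u x)\<^sup>2) \<partial>lborel \<partial>lborel)"
    by (rule lborel_pair.Fubini') measurable
  also have "\<dots> = (\<integral>\<^sup>+z. indicator (ball 0 \<delta>) z * (\<integral>\<^sup>+x. ennreal ((u (x + z) - u x)\<^sup>2) \<partial>lborel) \<partial>lborel)"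
    by (intro nn_integral_cong nn_integral_cmult) measurable
  also have "\<dots> \<le> (\<integral>\<^sup>+z. ennreal (\<delta>\<^sup>2 * energy u) * indicator (ball (0::'a) \<delta>) z \<partial>lborel)"
  proof (rule nn_integral_mono)
    fix z :: 'a
    show "indicator (ball 0 \<delta>) z * (\<integral>\<^sup>+x. ennreal ((u (x + z) - u x)\<^sup>2) \<partial>lborel) \<le>
      ennreal (\<delta>\<^sup>2 * energy u) * indicator (ball (0::'a) \<delta>) z"
    proof (cases "z \<in> ball 0 \<delta>")
      case True
      have "(\<integral>\<^sup>+x. ennreal ((u (x + z) - u x)\<^sup>2) \<partial>lborel) \<le> ennreal ((norm z)\<^sup>2 * energy u)"
        by (rule fe_translation[OF u])
      also have "\<dots> \<le> ennreal (\<delta>\<^sup>2 * energy u)"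
        using True energy_nonneg by (intro ennreal_leI mult_right_mono power_mono) auto
      finally show ?thesis using True by simp
    qed simp
  qed
  also have "\<dots> = ennreal (\<delta>\<^sup>2 * energy u) * emeasure lborel (ball (0::'a) \<delta>)"
    by (subst nn_integral_cmult_indicator) auto
  also have "\<dots> = ennreal (ball_measure TYPE('a) 1 * \<delta> ^ DIM('a) * \<delta>\<^sup>2 * energy u)"
    using \<delta> energy_nonneg ball_measure_pos[where 'a='a]
    by (simp add: measure_ball_scale ennreal_mult less_imp_le ac_simps)
  finally show ?thesis .
qed

section \<open>Quasi-interpolation\<close>

lemma convex_combination_square_le:
  fixes a :: "'b \<Rightarrow> real"
  assumes "\<And>p. p \<in> P \<Longrightarrow> 0 \<le> l p" "sum l P = 1" "\<And>p. p \<in> P \<Longrightarrow> (a p)\<^sup>2 \<le> M"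
  shows "(\<Sum>p\<in>P. l p * a p)\<^sup>2 \<le> M"
proof -
  have "P \<noteq> {}" using assms(2) by auto
  then have M: "0 \<le> M" using assms(3) zero_le_power2 order_trans by blast
  have "\<bar>\<Sum>p\<in>P. l p * a p\<bar> \<le> (\<Sum>p\<in>P. l p * sqrt M)"
  proof (rule order_trans[OF sum_abs sum_mono])
    fix p assume p: "p \<in> P"
    have "\<bar>a p\<bar> \<le> sqrt M" using assms(3)[OF p] real_le_rsqrt by simp
    then show "\<bar>l p * a p\<bar> \<le> l p * sqrt M" using assms(1)[OF p] by (simp add: abs_mult mult_left_mono)
  qed
  also have "\<dots> = sqrt M" using assms(2) by (simp flip: sum_distrib_right)
  finally show ?thesis using M by (simp add: sqrt_ge_absD)
qed

locale mesh_pair = coarse: fe_mesh \<Omega> R + fine: fe_mesh \<Omega> R'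
  for \<Omega> :: "'a::euclidean_space set" and R R' :: "'a set set" +
  fixes \<rho> c C D r0 h :: real
  assumes pos: "0 < \<rho>" "0 < c" "0 \<le> C" "1 \<le> D" "0 < r0" "0 < h"
    and r0: "r0 \<le> \<rho> * c" "r0 \<le> \<rho>"
    and fat: "\<And>\<tau>. \<tau> \<in> R \<Longrightarrow> \<exists>s. ball s (\<rho> * diameter \<tau>) \<subseteq> \<tau>"
    and diam_lower: "\<And>\<tau>. \<tau> \<in> R \<Longrightarrow> c * h \<le> diameter \<tau>"
    and diam_upper: "\<And>\<tau>. \<tau> \<in> R \<Longrightarrow> \<tau> \<notin> R' \<Longrightarrow> diameter \<tau> \<le> C * h"
    and corkscrew: "\<And>p. p \<in> frontier \<Omega> \<Longrightarrow> \<exists>s. dist s p \<le> D * h \<and> ball s (r0 * h) \<inter> \<Omega> = {}"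
begin

definition \<delta> :: real where "\<delta> = (C + D + r0) * h"

text \<open>Near a simplex that is not refined any further, nodal values are kept, so that the
  quasi-interpolant reproduces \<open>u\<close> there, whatever the size of that simplex.\<close>

definition quasi_nodes :: "('a \<Rightarrow> real) \<Rightarrow> 'a \<Rightarrow> real" where
  "quasi_nodes u p = (if p \<notin> \<Omega> then 0 else if \<exists>\<tau>\<in>R \<inter> R'. p \<in> corners \<tau> then u p else ball_avg u p (r0 * h))"

definition quasi_interp :: "('a \<Rightarrow> real) \<Rightarrow> 'a \<Rightarrow> real" where
  "quasi_interp u = coarse.nodal_interp (quasi_nodes u)"

definition K2 :: real where
  "K2 = (8 * 2 ^ DIM('a) + 2) / (ball_measure TYPE('a) 1 * r0 ^ DIM('a))"

definition K3 :: real where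
  "K3 = K2 * ball_measure TYPE('a) 1 * (C + D + r0) ^ DIM('a) * (C + D + r0)\<^sup>2"

definition A1 :: real where
  "A1 = 16 * (4 / \<rho>) ^ DIM('a) / (\<rho> * c)\<^sup>2"

lemma constants_nonneg: "0 < K2" "0 \<le> K3" "0 \<le> A1"
  using pos ball_measure_pos[where 'a='a] unfolding K2_def K3_def A1_def
  by (auto intro!: divide_pos_pos mult_nonneg_nonneg mult_pos_pos simp: add_pos_pos)

lemma quasi_interp_in_fe: "quasi_interp u \<in> fe_space \<Omega> R"
  unfolding quasi_interp_def by (rule coarse.nodal_interp_in_fe) (simp add: quasi_nodes_def)

lemma quasi_nodes_osc:
  assumes u: "u \<in> fe_space \<Omega> R'" and \<tau>: "\<tau> \<in> R" "\<tau> \<notin> R'" and p: "p \<in> corners \<tau>" and x: "x \<in> \<tau>"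
  shows "(u x - quasi_nodes u p)\<^sup>2 \<le> K2 / h ^ DIM('a) * osc u \<delta> x"
proof -
  note s\<tau> = coarse.simplices[OF \<tau>(1)]
  have cu: "continuous_on UNIV u" by (rule fine.fe_continuous[OF u])
  have "dist x p \<le> diameter \<tau>"
    using diameter_bounded_bound[OF compact_imp_bounded[OF simplex_compact[OF s\<tau>]] x corner_in[OF s\<tau> p]] .
  then have xp: "dist x p \<le> C * h" using diam_upper[OF \<tau>] by simp
  have sub: "ball s r \<subseteq> ball x \<delta>" if "dist s p \<le> D * h" "r \<le> r0 * h" for s r
  proof
    fix y assume "y \<in> ball s r"
    then have "dist s y < r0 * h" using that(2) by simp
    moreover have "dist x y \<le> dist x p + dist p s + dist s y"
      by (metis dist_triangle dist_triangle_le add.commute add_left_mono order_trans dist_triangle2 dist_commute)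
    ultimately have "dist x y < C * h + D * h + r0 * h" using xp that(1) by (simp add: dist_commute)
    then show "y \<in> ball x \<delta>" by (simp add: \<delta>_def algebra_simps)
  qed
  let ?k = "8 * 2 ^ DIM('a) + 2 :: real"
  have k1: "1 \<le> ?k" by simp
  have osc: "osc u \<delta> x \<le> ?k * osc u \<delta> x"
    using mult_right_mono[OF k1 osc_nonneg[of u \<delta> x]] by simp
  have "\<exists>s::'a. measure lborel (ball s (r0 * h)) * (u x - quasi_nodes u p)\<^sup>2 \<le> ?k * osc u \<delta> x"
  proof (cases "p \<in> \<Omega>")
    case False
    have "p \<in> closure \<Omega>" using corner_in[OF s\<tau> p] \<tau>(1) coarse.cover by blast
    then have "p \<in> frontier \<Omega>" using False coarse.frontier_domain by blast
    then obtain s where s: "dist s p \<le> D * h" "ball s (r0 * h) \<inter> \<Omega> = {}" using corkscrew by blast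
    have "measure lborel (ball s (r0 * h)) * (u x - 0)\<^sup>2 \<le> osc u \<delta> x"
      by (rule osc_zero[OF cu sub[OF s(1) order_refl]]) (use s(2) fine.fe_zero[OF u] in blast)
    from order_trans[OF this osc] show ?thesis
      unfolding quasi_nodes_def if_P[OF False] by (intro exI[of _ s])
  next
    case p\<Omega>: True
    show ?thesis
    proof (cases "\<exists>\<sigma>\<in>R \<inter> R'. p \<in> corners \<sigma>")
      case True
      then obtain \<sigma> where \<sigma>: "\<sigma> \<in> R" "\<sigma> \<in> R'" "p \<in> corners \<sigma>" by blast
      have node: "quasi_nodes u p = u p" using True p\<Omega> by (simp add: quasi_nodes_def)
      note s\<sigma> = coarse.simplices[OF \<sigma>(1)]
      have p\<sigma>: "p \<in> \<sigma>" by (rule corner_in[OF s\<sigma> \<sigma>(3)])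
      have conv: "convex \<sigma>" by (rule simplex_convex[OF s\<sigma>])
      define d where "d = diameter \<sigma>"
      have d: "0 < d" "c * h \<le> d"
        using diam_lower[OF \<sigma>(1)] pos unfolding d_def by (auto intro: less_le_trans[OF mult_pos_pos])
      obtain s0 where s0: "ball s0 (\<rho> * d) \<subseteq> \<sigma>" using fat[OF \<sigma>(1)] unfolding d_def by blast
      have "s0 \<in> \<sigma>" using s0 d pos by (auto simp: subset_iff)
      then have ps0: "dist p s0 \<le> d"
        using diameter_bounded_bound[OF compact_imp_bounded[OF simplex_compact[OF s\<sigma>]] p\<sigma>] unfolding d_def by blast
      define t where "t = min 1 (h / d)"
      have t: "0 < t" "t \<le> 1" "t * d \<le> h" using d pos by (auto simp: t_def field_simps min_def)
      have "r0 * h \<le> \<rho> * (t * d)"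
      proof (cases "h \<le> d")
        case True
        then have "t * d = h" using d by (simp add: t_def min_def field_simps)
        moreover have "r0 * h \<le> \<rho> * h" using r0(2) pos by (intro mult_right_mono) auto
        ultimately show ?thesis by (simp only:)
      next
        case False
        then have "t * d = d" using d by (simp add: t_def min_def field_simps)
        moreover have "r0 * h \<le> \<rho> * (c * h)" using mult_right_mono[OF r0(1), of h] pos by (simp add: mult.assoc)
        moreover have "\<rho> * (c * h) \<le> \<rho> * d" using d(2) pos by (intro mult_left_mono) auto
        ultimately show ?thesis by (simp only: order_trans)
      qed
      then have r: "r0 * h \<le> t * (\<rho> * d)" by (simp add: ac_simps)
      define s where "s = p + t *\<^sub>R (s0 - p)"
      have ball\<sigma>: "ball s (r0 * h) \<subseteq> \<sigma>"
      proof
        fix y assume y: "y \<in> ball s (r0 * h)"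
        define y' where "y' = p + (1 / t) *\<^sub>R (y - p)"
        have "s0 - y' = (1 / t) *\<^sub>R (s - y)" using t by (simp add: s_def y'_def algebra_simps)
        then have "dist s0 y' = dist s y / t" using t by (simp add: dist_norm)
        also have "\<dots> < \<rho> * d" using y r t by (simp add: field_simps)
        finally have "y' \<in> \<sigma>" using s0 by auto
        moreover have "y = (1 - t) *\<^sub>R p + t *\<^sub>R y'" using t by (simp add: y'_def algebra_simps)
        ultimately show "y \<in> \<sigma>" using conv p\<sigma> t by (simp add: convexD)
      qed
      have "dist s p = t * dist p s0" using t by (simp add: s_def dist_norm norm_minus_commute)
      also have "\<dots> \<le> t * d" using ps0 t by (intro mult_left_mono) auto
      finally have sp: "dist s p \<le> h" using t(3) by simp
      have "1 * h \<le> D * h" using pos by (intro mult_right_mono) auto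
      with sp have spD: "dist s p \<le> D * h" by simp
      have "dist ((1/2) *\<^sub>R (p + s)) p = dist s p / 2"
      proof -
        have "(1/2) *\<^sub>R (p + s) - p = (1/2) *\<^sub>R (s - p)" by (simp add: algebra_simps flip: scaleR_add_left)
        then show ?thesis by (simp add: dist_norm)
      qed
      also have "\<dots> \<le> D * h" using spD zero_le_dist[of s p] by linarith
      finally have half: "dist ((1/2) *\<^sub>R (p + s)) p \<le> D * h" .
      obtain b where b: "\<And>z. z \<in> \<sigma> \<Longrightarrow> u z = slope u \<sigma> \<bullet> z + b" using fine.fe_affine[OF u \<sigma>(2)] by blast
      have "measure lborel (ball s (r0 * h)) * (u x - u p)\<^sup>2 \<le> ?k * osc u \<delta> x"
      proof (rule osc_affine[OF cu sub[OF spD order_refl] sub[OF half]])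
        show "r0 * h / 2 \<le> r0 * h" using pos by simp
        fix y assume "y \<in> ball s (r0 * h)"
        then have y: "y \<in> \<sigma>" using ball\<sigma> by blast
        have "(1/2) *\<^sub>R (p + y) \<in> \<sigma>"
          using convexD[OF conv p\<sigma> y, of "1/2" "1/2"] by (simp add: scaleR_add_right)
        then show "u p = 2 * u ((1/2) *\<^sub>R (p + y)) - u y"
          using b p\<sigma> y by (simp add: inner_add_right add_divide_distrib)
      qed
      then show ?thesis unfolding node by (intro exI[of _ s])
    next
      case False
      then have node: "quasi_nodes u p = ball_avg u p (r0 * h)" using p\<Omega> by (simp add: quasi_nodes_def)
      have "measure lborel (ball p (r0 * h)) * (u x - ball_avg u p (r0 * h))\<^sup>2 \<le> osc u \<delta> x"
        by (rule osc_avg[OF cu sub]) (use pos in auto)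
      from order_trans[OF this osc] show ?thesis unfolding node by (intro exI[of _ p])
    qed
  qed
  then obtain s :: 'a where "measure lborel (ball s (r0 * h)) * (u x - quasi_nodes u p)\<^sup>2 \<le> ?k * osc u \<delta> x" by blast
  moreover have "measure lborel (ball s (r0 * h)) = ball_measure TYPE('a) 1 * r0 ^ DIM('a) * h ^ DIM('a)"
    using pos by (subst measure_ball_scale) (auto simp: power_mult_distrib)
  ultimately show ?thesis
    using pos ball_measure_pos[where 'a='a] unfolding K2_def by (simp add: field_simps)
qed

lemma quasi_interp_unrefined:
  assumes u: "u \<in> fe_space \<Omega> R'" and "\<tau> \<in> R" "\<tau> \<in> R'" "x \<in> \<tau>"
  shows "quasi_interp u x = u x"
proof -
  have "quasi_nodes u p = u p" if "p \<in> corners \<tau>" for p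
    using that assms fine.fe_zero[OF u] by (auto simp: quasi_nodes_def)
  then show ?thesis
    unfolding quasi_interp_def coarse.nodal_interp_eq[OF assms(2,4)] fine.fe_corner_sum[OF u assms(3,4)]
    by (intro sum.cong) auto
qed

lemma quasi_interp_refined:
  assumes u: "u \<in> fe_space \<Omega> R'" and \<tau>: "\<tau> \<in> R" "\<tau> \<notin> R'" and x: "x \<in> \<tau>"
  shows "(u x - quasi_interp u x)\<^sup>2 \<le> K2 / h ^ DIM('a) * osc u \<delta> x"
proof -
  note s\<tau> = coarse.simplices[OF \<tau>(1)]
  have "u x - quasi_interp u x = (\<Sum>p\<in>corners \<tau>. bary \<tau> p x * (u x - quasi_nodes u p))"
    unfolding quasi_interp_def coarse.nodal_interp_eq[OF \<tau>(1) x]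
    using bary_representation(1)[OF s\<tau>, of x]
    by (simp add: right_diff_distrib sum_subtractf mult.commute flip: sum_distrib_left sum_distrib_right)
  then show ?thesis
    using convex_combination_square_le[of "corners \<tau>" "\<lambda>p. bary \<tau> p x", OF _ bary_representation(1)[OF s\<tau>] quasi_nodes_osc[OF u \<tau> _ x]]
      mem_simplex_iff[OF s\<tau>] x by simp
qed

lemma osc_scaled_integral:
  assumes u: "u \<in> fe_space \<Omega> R'"
  shows "(\<integral>\<^sup>+x. ennreal (K2 / h ^ DIM('a) * osc u \<delta> x) \<partial>lborel) \<le> ennreal (K3 * h\<^sup>2 * fine.energy u)"
proof -
  have k: "0 \<le> K2 / h ^ DIM('a)" using constants_nonneg pos by simp
  have "(\<integral>\<^sup>+x. ennreal (K2 / h ^ DIM('a) * osc u \<delta> x) \<partial>lborel) = ennreal (K2 / h ^ DIM('a)) * (\<integral>\<^sup>+x. ennreal (osc u \<delta> x) \<partial>lborel)"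
    using osc_measurable[OF fine.fe_continuous[OF u], of \<delta>] unfolding ennreal_mult'[OF k]
    by (intro nn_integral_cmult) simp
  also have "\<dots> \<le> ennreal (K2 / h ^ DIM('a)) * ennreal (ball_measure TYPE('a) 1 * \<delta> ^ DIM('a) * \<delta>\<^sup>2 * fine.energy u)"
    using pos by (intro mult_left_mono fine.osc_integral u) (auto simp: \<delta>_def)
  also have "\<dots> = ennreal (K2 / h ^ DIM('a) * (ball_measure TYPE('a) 1 * \<delta> ^ DIM('a) * \<delta>\<^sup>2 * fine.energy u))"
    using k by (simp only: ennreal_mult')
  also have "K2 / h ^ DIM('a) * (ball_measure TYPE('a) 1 * \<delta> ^ DIM('a) * \<delta>\<^sup>2 * fine.energy u) = K3 * h\<^sup>2 * fine.energy u"
    using pos by (simp add: K3_def \<delta>_def power_mult_distrib)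
  finally show ?thesis .
qed

lemma quasi_interp_l2:
  assumes u: "u \<in> fe_space \<Omega> R'"
  shows "ip (\<lambda>x. u x - quasi_interp u x) (\<lambda>x. u x - quasi_interp u x) \<le> K3 * h\<^sup>2 * fine.energy u"
proof -
  define e where "e = (\<lambda>x. u x - quasi_interp u x)"
  have e: "cont_supp e"
    unfolding e_def by (intro cont_supp_diff fine.fe_cont_supp u coarse.fe_cont_supp quasi_interp_in_fe)
  have K: "0 \<le> K2 / h ^ DIM('a)" using constants_nonneg pos by simp
  have "e x * e x \<le> K2 / h ^ DIM('a) * osc u \<delta> x" for x
  proof (cases "\<exists>\<tau>\<in>R. \<tau> \<notin> R' \<and> x \<in> \<tau>")
    case True
    then show ?thesis using quasi_interp_refined[OF u] by (auto simp: e_def power2_eq_square)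
  next
    case False
    have "e x = 0"
    proof (cases "x \<in> closure \<Omega>")
      case True
      then obtain \<tau> where "\<tau> \<in> R" "x \<in> \<tau>" using coarse.cover by blast
      then show ?thesis using False quasi_interp_unrefined[OF u] by (auto simp: e_def)
    next
      case False
      then have "x \<notin> \<Omega>" using closure_subset by blast
      then show ?thesis using fine.fe_zero[OF u] coarse.fe_zero[OF quasi_interp_in_fe] by (simp add: e_def)
    qed
    then show ?thesis using mult_nonneg_nonneg[OF K osc_nonneg[of u \<delta> x]] by simp
  qed
  then have "(\<integral>\<^sup>+x. ennreal (e x * e x) \<partial>lborel) \<le> (\<integral>\<^sup>+x. ennreal (K2 / h ^ DIM('a) * osc u \<delta> x) \<partial>lborel)"
    by (intro nn_integral_mono ennreal_leI)
  also have "\<dots> \<le> ennreal (K3 * h\<^sup>2 * fine.energy u)" by (rule osc_scaled_integral[OF u])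
  also have "(\<integral>\<^sup>+x. ennreal (e x * e x) \<partial>lborel) = ennreal (ip e e)"
    unfolding ip_def by (intro nn_integral_eq_integral cont_supp_integrable_mult e) auto
  finally have "ip e e \<le> K3 * h\<^sup>2 * fine.energy u"
    using constants_nonneg fine.energy_nonneg by (subst (asm) ennreal_le_iff) auto
  then show ?thesis unfolding e_def .
qed

lemma quasi_interp_energy:
  assumes u: "u \<in> fe_space \<Omega> R'"
  shows "coarse.energy (quasi_interp u) \<le> (1 + 4 * A1 * K3) * fine.energy u"
proof -
  define w where "w = quasi_interp u"
  have w: "w \<in> fe_space \<Omega> R" unfolding w_def by (rule quasi_interp_in_fe)
  have wm: "w \<in> borel_measurable borel" by (rule cont_supp_measurable[OF coarse.fe_cont_supp[OF w]])
  define k where "k = K2 / h ^ DIM('a)"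
  have k: "0 \<le> k" using constants_nonneg pos by (simp add: k_def)
  define a where "a \<tau> = measure lborel \<tau> * (norm (slope w \<tau>))\<^sup>2" for \<tau> :: "'a set"
  have om: "(\<lambda>x. ennreal (k * osc u \<delta> x)) \<in> borel_measurable borel"
    using osc_measurable[OF fine.fe_continuous[OF u]] k by (simp add: ennreal_mult')
  have "sum a (R \<inter> R') = (\<Sum>\<tau>\<in>R \<inter> R'. measure lborel \<tau> * (norm (slope u \<tau>))\<^sup>2)"
  proof (rule sum.cong)
    fix \<tau> assume \<tau>: "\<tau> \<in> R \<inter> R'"
    obtain b where b: "\<And>x. x \<in> \<tau> \<Longrightarrow> u x = slope u \<tau> \<bullet> x + b" using fine.fe_affine[OF u] \<tau> by blast
    have "slope w \<tau> = slope u \<tau>"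
      by (rule slope_eqI[where b=b]) (use \<tau> coarse.simplices b quasi_interp_unrefined[OF u] w_def in auto)
    then show "a \<tau> = measure lborel \<tau> * (norm (slope u \<tau>))\<^sup>2" by (simp add: a_def)
  qed simp
  also have "\<dots> \<le> fine.energy u"
    unfolding fine.energy_def using fine.finite_R by (intro sum_mono2) auto
  finally have part1: "sum a (R \<inter> R') \<le> fine.energy u" .
  have "ennreal (sum a (R - R')) = (\<Sum>\<tau>\<in>R - R'. ennreal (a \<tau>))"
    unfolding a_def by (subst sum_ennreal) auto
  also have "\<dots> \<le> (\<Sum>\<tau>\<in>R - R'. ennreal (A1 / h\<^sup>2) * (4 * (\<integral>\<^sup>+x. indicator (interior \<tau>) x * ennreal (k * osc u \<delta> x) \<partial>lborel)))"
  proof (rule sum_mono)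
    fix \<tau> assume "\<tau> \<in> R - R'"
    then have \<tau>: "\<tau> \<in> R" "\<tau> \<notin> R'" by auto
    note s\<tau> = coarse.simplices[OF \<tau>(1)]
    obtain s where s: "ball s (\<rho> * diameter \<tau>) \<subseteq> \<tau>" using fat[OF \<tau>(1)] by blast
    obtain b where b: "\<And>x. x \<in> \<tau> \<Longrightarrow> w x = slope w \<tau> \<bullet> x + b" using coarse.fe_affine[OF w \<tau>(1)] by blast
    have "corners \<tau> \<noteq> {}" using corners_simplex(3)[OF s\<tau>] by auto
    then obtain p where p: "p \<in> corners \<tau>" by blast
    define \<beta> where "\<beta> = quasi_nodes u p"
    have "ennreal (a \<tau>) \<le> ennreal (A1 / h\<^sup>2) * (\<integral>\<^sup>+x. indicator (interior \<tau>) x * ennreal ((w x - \<beta>)\<^sup>2) \<partial>lborel)"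
      unfolding a_def A1_def
      using coarse.inverse_estimate_simplex[OF \<tau>(1) s pos(1,6) diam_lower[OF \<tau>(1)] pos(2) b wm] by simp
    also have "\<dots> \<le> ennreal (A1 / h\<^sup>2) * (\<integral>\<^sup>+x. 4 * (indicator (interior \<tau>) x * ennreal (k * osc u \<delta> x)) \<partial>lborel)"
    proof (intro mult_left_mono nn_integral_mono)
      fix x
      show "indicator (interior \<tau>) x * ennreal ((w x - \<beta>)\<^sup>2) \<le> 4 * (indicator (interior \<tau>) x * ennreal (k * osc u \<delta> x))"
      proof (cases "x \<in> interior \<tau>")
        case True
        then have x: "x \<in> \<tau>" using interior_subset by blast
        have "(w x - \<beta>)\<^sup>2 \<le> 2 * (u x - w x)\<^sup>2 + 2 * (u x - \<beta>)\<^sup>2"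
          using zero_le_power2[of "(u x - w x) + (u x - \<beta>)"] by (simp add: power2_eq_square algebra_simps)
        also have "\<dots> \<le> 4 * (k * osc u \<delta> x)"
          using quasi_interp_refined[OF u \<tau> x] quasi_nodes_osc[OF u \<tau> p x] unfolding w_def \<beta>_def k_def by linarith
        finally have "ennreal ((w x - \<beta>)\<^sup>2) \<le> ennreal (4 * (k * osc u \<delta> x))" by (rule ennreal_leI)
        then show ?thesis using True k osc_nonneg[of u \<delta> x] by (simp add: ennreal_mult)
      qed simp
    qed simp
    also have "\<dots> = ennreal (A1 / h\<^sup>2) * (4 * (\<integral>\<^sup>+x. indicator (interior \<tau>) x * ennreal (k * osc u \<delta> x) \<partial>lborel))"
      using om by (subst nn_integral_cmult) auto
    finally show "ennreal (a \<tau>) \<le> ennreal (A1 / h\<^sup>2) * (4 * (\<integral>\<^sup>+x. indicator (interior \<tau>) x * ennreal (k * osc u \<delta> x) \<partial>lborel))" .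
  qed
  also have "\<dots> = ennreal (A1 / h\<^sup>2) * (4 * (\<Sum>\<tau>\<in>R - R'. \<integral>\<^sup>+x. indicator (interior \<tau>) x * ennreal (k * osc u \<delta> x) \<partial>lborel))"
    by (simp only: sum_distrib_left)
  also have "\<dots> \<le> ennreal (A1 / h\<^sup>2) * (4 * ennreal (K3 * h\<^sup>2 * fine.energy u))"
    using order_trans[OF coarse.sum_interior_integral_le[OF Diff_subset om] osc_scaled_integral[OF u, folded k_def]]
    by (intro mult_left_mono) auto
  also have "\<dots> = ennreal (A1 / h\<^sup>2 * (4 * (K3 * h\<^sup>2 * fine.energy u)))"
  proof -
    have "0 \<le> A1 / h\<^sup>2" using constants_nonneg by simp
    then show ?thesis
      using ennreal_mult'[of 4 "K3 * h\<^sup>2 * fine.energy u"] by (simp only: ennreal_mult' ennreal_numeral)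
  qed
  also have "A1 / h\<^sup>2 * (4 * (K3 * h\<^sup>2 * fine.energy u)) = 4 * A1 * K3 * fine.energy u"
    using pos by (simp add: field_simps)
  finally have part2: "sum a (R - R') \<le> 4 * A1 * K3 * fine.energy u"
    using constants_nonneg fine.energy_nonneg[of u] by (subst (asm) ennreal_le_iff) auto
  have "coarse.energy w = sum a (R \<inter> R') + sum a (R - R')"
    unfolding coarse.energy_def a_def by (rule sum.Int_Diff[OF coarse.finite_R])
  then show ?thesis using part1 part2 unfolding w_def by (simp add: algebra_simps)
qed

theorem projection_energy:
  assumes u: "u \<in> fe_space \<Omega> R'"
  shows "coarse.energy (l2_projection \<Omega> (fe_space \<Omega> R) u) \<le> (2 + 10 * A1 * K3) * fine.energy u"
proof -
  define q where "q = l2_projection \<Omega> (fe_space \<Omega> R) u"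
  define w where "w = quasi_interp u"
  have cs: "cont_supp u" by (rule fine.fe_cont_supp[OF u])
  have q: "q \<in> fe_space \<Omega> R" unfolding q_def by (rule coarse.l2_projection_fe(1)[OF cs])
  have w: "w \<in> fe_space \<Omega> R" unfolding w_def by (rule quasi_interp_in_fe)
  have A: "0 \<le> A1 / h\<^sup>2" using constants_nonneg by simp
  have "coarse.energy (\<lambda>x. q x - w x) \<le> A1 / h\<^sup>2 * ip (\<lambda>x. q x - w x) (\<lambda>x. q x - w x)"
    unfolding A1_def
    by (rule coarse.inverse_estimate[OF fat pos(1,6,2) diam_lower coarse.fe_diff(1)[OF q w]])
  also have "\<dots> \<le> A1 / h\<^sup>2 * (K3 * h\<^sup>2 * fine.energy u)"
    using coarse.l2_projection_best[OF cs w] quasi_interp_l2[OF u] A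
    by (intro mult_left_mono) (auto simp: q_def w_def)
  also have "\<dots> = A1 * K3 * fine.energy u" using pos by simp
  finally have "coarse.energy (\<lambda>x. q x - w x) \<le> A1 * K3 * fine.energy u" .
  moreover have "coarse.energy q \<le> 2 * coarse.energy w + 2 * coarse.energy (\<lambda>x. q x - w x)"
    by (rule coarse.energy_diff[OF q w])
  ultimately show ?thesis
    using quasi_interp_energy[OF u] unfolding q_def[symmetric] w_def by (simp add: algebra_simps)
qed

theorem projection_h1_norm:
  assumes u: "u \<in> fe_space \<Omega> R'"
  shows "h1_norm \<Omega> (l2_projection \<Omega> (fe_space \<Omega> R) u) \<le> sqrt (2 + 10 * A1 * K3) * h1_norm \<Omega> u"
proof -
  define q where "q = l2_projection \<Omega> (fe_space \<Omega> R) u"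
  have cs: "cont_supp u" by (rule fine.fe_cont_supp[OF u])
  have q: "q \<in> fe_space \<Omega> R" unfolding q_def by (rule coarse.l2_projection_fe(1)[OF cs])
  have K: "1 \<le> 2 + 10 * A1 * K3" using constants_nonneg by simp
  have zero: "(\<lambda>x. 0) \<in> fe_space \<Omega> R"
    using coarse.fe_diff(1)[OF q q] by simp
  have "ip q q \<le> ip u u"
    using coarse.l2_projection_best[OF cs zero] by (simp add: q_def)
  also have "\<dots> \<le> (2 + 10 * A1 * K3) * ip u u"
    using mult_right_mono[OF K ip_nonneg[of u]] by simp
  finally have "(h1_norm \<Omega> q)\<^sup>2 \<le> (2 + 10 * A1 * K3) * (h1_norm \<Omega> u)\<^sup>2"
    using projection_energy[OF u]
    unfolding coarse.fe_h1_norm_square[OF q] fine.fe_h1_norm_square[OF u] q_def[symmetric]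
    by (simp add: ip_def power2_eq_square distrib_left)
  moreover have "0 \<le> h1_norm \<Omega> u"
    unfolding h1_norm_def l2_inner_def
    by (intro real_sqrt_ge_zero add_nonneg_nonneg Bochner_Integration.integral_nonneg) auto
  ultimately show ?thesis
    unfolding q_def[symmetric] using K
    by - (rule power2_le_imp_le; simp add: power_mult_distrib)
qed

end

section \<open>Exterior balls\<close>

text \<open>The complement of the closure is, up to a null set, a finite union of convex cells of
  the arrangement of the facet hyperplanes; each boundary point is in the closure of one of them,
  and a ball in that cell can be shrunk towards the boundary point.\<close>

lemma (in fe_mesh) exterior_balls:
  "\<exists>r0>0. \<exists>D. \<forall>p\<in>frontier \<Omega>. \<forall>t. 0 < t \<and> t \<le> 1 \<longrightarrow> (\<exists>s. dist s p \<le> D * t \<and> ball s (r0 * t) \<inter> \<Omega> = {})"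
proof -
  have "\<exists>F. finite F \<and> \<tau> = \<Inter>F \<and> (\<forall>h\<in>F. \<exists>a b. a \<noteq> 0 \<and> h = {x. a \<bullet> x \<le> b})" if "\<tau> \<in> R" for \<tau>
    using simplex_imp_polyhedron[OF simplices[OF that]] unfolding polyhedron_def .
  then obtain F where F: "\<And>\<tau>. \<tau> \<in> R \<Longrightarrow> finite (F \<tau>)" "\<And>\<tau>. \<tau> \<in> R \<Longrightarrow> \<tau> = \<Inter>(F \<tau>)"
    "\<And>\<tau> h. \<tau> \<in> R \<Longrightarrow> h \<in> F \<tau> \<Longrightarrow> \<exists>a b. a \<noteq> 0 \<and> h = {x. a \<bullet> x \<le> b}"
    by metis
  define H where "H = (\<Union>\<tau>\<in>R. F \<tau>)"
  have H: "finite H" using F(1) finite_R unfolding H_def by blast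
  have half: "\<exists>a b. h = {x. a \<bullet> x \<le> b}" if "h \<in> H" for h
    using that F(3) unfolding H_def by blast
  define cell where "cell S = (\<Inter>h\<in>H. if h \<in> S then interior h else - h)" for S
  have convex_h: "convex h" "closed h" "convex (- h)" if h: "h \<in> H" for h
  proof -
    obtain a b where ab: "h = {x. a \<bullet> x \<le> b}" using half[OF h] by blast
    have "- h = {x. a \<bullet> x > b}" unfolding ab by auto
    then show "convex h" "closed h" "convex (- h)"
      by (simp_all add: convex_halfspace_gt) (simp_all add: ab convex_halfspace_le closed_halfspace_le)
  qed
  have conv: "convex (cell S)" for S
    unfolding cell_def using convex_h by (intro convex_INT) auto
  have opn: "open (cell S)" for S
    unfolding cell_def using H convex_h by (intro open_INT) auto
  define N where "N = (\<Union>h\<in>H. frontier h)"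
  have N: "negligible N"
    unfolding N_def using H convex_h by (intro negligible_Union) (auto intro: negligible_convex_frontier)
  define good where "good = {S \<in> Pow H. cell S \<noteq> {} \<and> cell S \<inter> closure \<Omega> = {}}"
  have fin: "finite good" unfolding good_def using H by simp
  have cover_cells: "- closure \<Omega> - N \<subseteq> (\<Union>S\<in>good. cell S)"
  proof
    fix x assume x: "x \<in> - closure \<Omega> - N"
    define S where "S = {h \<in> H. x \<in> h}"
    have xS: "x \<in> cell S"
      unfolding cell_def S_def using x convex_h by (auto simp: N_def frontier_def)
    have "cell S \<inter> closure \<Omega> = {}"
    proof (rule ccontr)
      assume "cell S \<inter> closure \<Omega> \<noteq> {}"
      then obtain y \<tau> where y: "y \<in> cell S" "\<tau> \<in> R" "y \<in> \<tau>" using cover by blast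
      have "x \<in> h" if h: "h \<in> F \<tau>" for h
      proof (rule ccontr)
        assume "x \<notin> h"
        have hH: "h \<in> H" using h y(2) unfolding H_def by blast
        have "y \<in> (if h \<in> S then interior h else - h)" using y(1) hH unfolding cell_def by blast
        moreover have "h \<notin> S" using \<open>x \<notin> h\<close> unfolding S_def by blast
        moreover have "y \<in> h" using y(3) h F(2)[OF y(2)] by blast
        ultimately show False by simp
      qed
      then have "x \<in> \<tau>" using F(2)[OF y(2)] by blast
      then show False using x y(2) cover by blast
    qed
    then have "S \<in> good" unfolding good_def using xS S_def by blast
    then show "x \<in> (\<Union>S\<in>good. cell S)" using xS by blast
  qed
  have near: "\<exists>S\<in>good. p \<in> closure (cell S)" if p: "p \<in> frontier \<Omega>" for p
  proof -
    have "p \<notin> interior (closure \<Omega>)" using p frontier_domain dom(2) by blast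
    then have pU: "p \<in> closure (- closure \<Omega>)" by (simp add: closure_complement)
    have "p \<in> closure (- closure \<Omega> - N)"
      unfolding closure_approachable
    proof (intro allI impI)
      fix e :: real assume "0 < e"
      then obtain y where "y \<in> - closure \<Omega>" "dist y p < e" using pU unfolding closure_approachable by blast
      then have "ball p e \<inter> - closure \<Omega> \<noteq> {}" by (auto simp: dist_commute)
      moreover have "open (ball p e \<inter> - closure \<Omega>)" by auto
      ultimately have "\<not> negligible (ball p e \<inter> - closure \<Omega>)" using open_not_negligible by blast
      then have "\<not> ball p e \<inter> - closure \<Omega> \<subseteq> N" using N negligible_subset by blast
      then show "\<exists>y\<in>- closure \<Omega> - N. dist y p < e" by (auto simp: dist_commute)
    qed
    then have "p \<in> closure (\<Union>S\<in>good. cell S)" using closure_mono[OF cover_cells] by blast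
    moreover have "closure (\<Union>S\<in>good. cell S) \<subseteq> (\<Union>S\<in>good. closure (cell S))"
    proof (rule closure_minimal)
      show "(\<Union>S\<in>good. cell S) \<subseteq> (\<Union>S\<in>good. closure (cell S))" using closure_subset by blast
      show "closed (\<Union>S\<in>good. closure (cell S))" using fin by (intro closed_UN) auto
    qed
    ultimately show ?thesis by blast
  qed
  have "\<exists>q r. 0 < r \<and> ball q r \<subseteq> cell S" if "S \<in> good" for S
    using that opn[of S] unfolding good_def open_contains_ball by blast
  then obtain q r where qr: "\<And>S. S \<in> good \<Longrightarrow> 0 < r S" "\<And>S. S \<in> good \<Longrightarrow> ball (q S) (r S) \<subseteq> cell S"
    by metis
  define r0 where "r0 = Min (insert 1 (r ` good))"
  have r0: "0 < r0" "\<And>S. S \<in> good \<Longrightarrow> r0 \<le> r S"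
    unfolding r0_def using fin qr(1) by (auto simp: Min_gr_iff)
  obtain B where B: "\<And>p. p \<in> closure \<Omega> \<Longrightarrow> norm p \<le> B"
    using compact_imp_bounded[OF compact_domain] bounded_iff by blast
  define D where "D = (\<Sum>S\<in>good. norm (q S)) + B"
  show ?thesis
  proof (rule exI[of _ r0], rule conjI, rule r0(1), rule exI[of _ D], intro ballI allI impI)
    fix p t assume p: "p \<in> frontier \<Omega>" and t: "0 < t \<and> t \<le> (1::real)"
    obtain S where S: "S \<in> good" "p \<in> closure (cell S)" using near[OF p] by blast
    define s where "s = p + t *\<^sub>R (q S - p)"
    have "norm (q S) \<le> (\<Sum>S\<in>good. norm (q S))" using fin S(1) by (intro member_le_sum) auto
    moreover have "norm p \<le> B" using B p frontier_domain by blast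
    ultimately have "norm (q S - p) \<le> D" unfolding D_def using norm_triangle_ineq4[of "q S" p] by linarith
    then have "dist s p \<le> D * t" using t by (simp add: s_def dist_norm mult.commute mult_left_mono)
    moreover have "ball s (r0 * t) \<subseteq> cell S"
    proof
      fix y assume y: "y \<in> ball s (r0 * t)"
      define y' where "y' = p + (1 / t) *\<^sub>R (y - p)"
      have "q S - y' = (1 / t) *\<^sub>R (s - y)" using t by (simp add: s_def y'_def algebra_simps)
      then have "dist (q S) y' = dist s y / t" using t by (simp add: dist_norm)
      also have "\<dots> < r0" using y t by (simp add: field_simps)
      finally have "y' \<in> ball (q S) (r S)" using r0(2)[OF S(1)] by simp
      then have "y' \<in> interior (cell S)" using qr(2)[OF S(1)] opn[of S] by (simp add: interior_open subset_iff)
      from mem_interior_closure_convex_shrink[OF conv this S(2), of t]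
      have "p - t *\<^sub>R (p - y') \<in> interior (cell S)" using t by simp
      moreover have "p - t *\<^sub>R (p - y') = y" using t by (simp add: y'_def algebra_simps)
      ultimately show "y \<in> cell S" using interior_subset by fastforce
    qed
    moreover have "cell S \<inter> \<Omega> = {}" using S(1) closure_subset unfolding good_def by blast
    ultimately show "\<exists>s. dist s p \<le> D * t \<and> ball s (r0 * t) \<inter> \<Omega> = {}" by blast
  qed
qed

section \<open>Shape regular simplices\<close>

lemma vec_angle_inner_bound:
  assumes "\<alpha> \<le> vec_angle v w" "0 < \<alpha>"
  shows "v \<bullet> w \<le> cos (min \<alpha> (pi / 2)) * (norm v * norm w)"
proof (cases "norm v * norm w = 0")
  case False
  define r where "r = v \<bullet> w / (norm v * norm w)"
  have pos: "0 < norm v * norm w" using False by simp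
  have "\<bar>r\<bar> \<le> 1" using Cauchy_Schwarz_ineq2[of v w] pos by (simp add: r_def abs_mult)
  then have r: "-1 \<le> r" "r \<le> 1" by auto
  have "min \<alpha> (pi / 2) \<le> arccos r" using assms(1) unfolding vec_angle_def r_def by simp
  then have "cos (arccos r) \<le> cos (min \<alpha> (pi / 2))"
    using assms(2) r by (intro cos_monotone_0_pi_le) (auto simp: arccos_ubound)
  then have "r \<le> cos (min \<alpha> (pi / 2))" using r by simp
  then show ?thesis using pos by (simp add: r_def field_simps)
qed auto

definition gram2 :: "'a::real_inner \<Rightarrow> 'a \<Rightarrow> real" where
  "gram2 v w = (norm v)\<^sup>2 * (norm w)\<^sup>2 - (v \<bullet> w)\<^sup>2"

lemma gram2_le: "gram2 v w \<le> (norm v)\<^sup>2 * (norm w)\<^sup>2"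
  by (simp add: gram2_def)

lemma norm_orth_part:
  assumes "t \<noteq> 0"
  shows "(norm (orth_part t w))\<^sup>2 = gram2 t w / (norm t)\<^sup>2"
  using assms unfolding orth_part_def gram2_def power2_norm_eq_inner
  by (simp add: inner_diff_left inner_diff_right field_simps power2_eq_square inner_commute)

lemma orth_part_orthogonal: "t \<noteq> 0 \<Longrightarrow> orth_part t w \<bullet> t = 0"
  unfolding orth_part_def by (simp add: inner_diff_left)

text \<open>Lower bounds for the angles are encoded by an upper bound \<open>\<kappa>\<close> for their cosines.\<close>

locale regular_corners =
  fixes C :: "'a::euclidean_space set" and \<kappa> :: real
  assumes \<kappa>: "0 \<le> \<kappa>" "\<kappa> < 1"
    and face_angle: "\<And>a b c. {a, b, c} \<subseteq> C \<Longrightarrow> distinct [a, b, c] \<Longrightarrow>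
      (b - a) \<bullet> (c - a) \<le> \<kappa> * (norm (b - a) * norm (c - a))"
    and dihedral: "\<And>a b c e. {a, b, c, e} \<subseteq> C \<Longrightarrow> distinct [a, b, c, e] \<Longrightarrow>
      orth_part (b - a) (c - a) \<bullet> orth_part (b - a) (e - a) \<le>
        \<kappa> * (norm (orth_part (b - a) (c - a)) * norm (orth_part (b - a) (e - a)))"
begin

definition \<mu> :: real where "\<mu> = 1 - \<kappa>\<^sup>2"

lemma \<mu>: "0 < \<mu>" "\<mu> \<le> 1"
  using power_strict_mono[of \<kappa> 1 2] \<kappa> by (simp_all add: \<mu>_def)

lemma acute_gram:
  assumes "0 \<le> v \<bullet> w" "v \<bullet> w \<le> \<kappa> * (norm v * norm w)"
  shows "\<mu> * ((norm v)\<^sup>2 * (norm w)\<^sup>2) \<le> gram2 v w"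
proof -
  have "(v \<bullet> w)\<^sup>2 \<le> (\<kappa> * (norm v * norm w))\<^sup>2" using assms by (intro power_mono)
  then show ?thesis by (simp add: gram2_def \<mu>_def power_mult_distrib algebra_simps)
qed

text \<open>If the angle at \<open>a\<close> is obtuse, the one at \<open>b\<close> is acute and can be used instead.\<close>

lemma triangle_gram:
  assumes "{a, b, c} \<subseteq> C" "distinct [a, b, c]"
  shows "\<mu> * ((norm (b - a))\<^sup>2 * (norm (c - a))\<^sup>2) \<le> gram2 (b - a) (c - a)"
proof (cases "0 \<le> (b - a) \<bullet> (c - a)")
  case True
  then show ?thesis using face_angle[OF assms] acute_gram by blast
next
  case False
  have ab: "{b, a, c} \<subseteq> C" "distinct [b, a, c]" using assms by auto
  define v w where "v = b - a" and "w = c - a"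
  have eq: "a - b = - v" "c - b = w - v" by (simp_all add: v_def w_def)
  have vw: "v \<bullet> w < 0" using False by (simp add: v_def w_def)
  have nx: "(norm (w - v))\<^sup>2 = (norm w)\<^sup>2 + (norm v)\<^sup>2 - 2 * (v \<bullet> w)"
    unfolding power2_norm_eq_inner by (simp add: inner_diff_left inner_diff_right inner_commute)
  have "v \<bullet> w \<le> v \<bullet> v" using vw inner_ge_zero[of v] by linarith
  then have "0 \<le> (- v) \<bullet> (w - v)" by (simp add: inner_diff_right)
  then have "\<mu> * ((norm (- v))\<^sup>2 * (norm (w - v))\<^sup>2) \<le> gram2 (- v) (w - v)"
    using face_angle[OF ab] unfolding eq by (rule acute_gram)
  moreover have "gram2 (- v) (w - v) = gram2 v w"
    unfolding gram2_def power2_norm_eq_inner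
    by (simp add: inner_diff_left inner_diff_right inner_commute power2_eq_square algebra_simps)
  moreover have "(norm w)\<^sup>2 \<le> (norm (w - v))\<^sup>2" using vw nx zero_le_power2[of "norm v"] by linarith
  then have "\<mu> * ((norm v)\<^sup>2 * (norm w)\<^sup>2) \<le> \<mu> * ((norm (- v))\<^sup>2 * (norm (w - v))\<^sup>2)"
    using \<mu> unfolding norm_minus_cancel by (intro mult_left_mono) auto
  ultimately show ?thesis unfolding v_def[symmetric] w_def[symmetric] by linarith
qed

lemma gram2_swap: "gram2 (b - a :: 'a) (c - a) = gram2 (a - b) (c - b)"
proof -
  have "gram2 v w = gram2 (- v) (w - v)" for v w :: 'a
    unfolding gram2_def power2_norm_eq_inner
    by (simp add: inner_diff_left inner_diff_right inner_commute power2_eq_square algebra_simps)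
  from this[of "b - a" "c - a"] show ?thesis by simp
qed

lemma gram2_commute: "gram2 v w = gram2 w (v::'a)"
  by (simp add: gram2_def inner_commute mult.commute)

lemma adjacent_edges:
  assumes "{a, b, c} \<subseteq> C" "distinct [a, b, c]"
  shows "\<mu> * (norm (c - a))\<^sup>2 \<le> (norm (b - a))\<^sup>2"
proof -
  have c: "{c, a, b} \<subseteq> C" "distinct [c, a, b]" using assms by auto
  have "\<mu> * ((norm (a - c))\<^sup>2 * (norm (b - c))\<^sup>2) \<le> gram2 (a - c) (b - c)" by (rule triangle_gram[OF c])
  also have "\<dots> = gram2 (a - b) (c - b)"
    using gram2_swap[of b c a] gram2_commute[of "a - c" "b - c"] gram2_commute[of "c - b" "a - b"] by simp
  also have "\<dots> \<le> (norm (a - b))\<^sup>2 * (norm (c - b))\<^sup>2" by (rule gram2_le)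
  finally have "\<mu> * (norm (c - a))\<^sup>2 * (norm (c - b))\<^sup>2 \<le> (norm (b - a))\<^sup>2 * (norm (c - b))\<^sup>2"
    by (simp add: norm_minus_commute mult.assoc)
  moreover have "0 < (norm (c - b))\<^sup>2" using assms(2) by auto
  ultimately show ?thesis by (rule mult_right_le_imp_le)
qed

lemma edges_comparable:
  assumes "{a, b} \<subseteq> C" "a \<noteq> b" "{p, q} \<subseteq> C"
  shows "\<mu>\<^sup>2 * (norm (q - p))\<^sup>2 \<le> (norm (b - a))\<^sup>2"
proof -
  have adj: "\<mu> * (norm (z - x))\<^sup>2 \<le> (norm (y - x))\<^sup>2" if "{x, y, z} \<subseteq> C" "x \<noteq> y" for x y z
  proof (cases "z = x \<or> z = y")
    case True
    then show ?thesis using \<mu> by (auto intro: mult_left_le_one_le)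
  next
    case False
    then show ?thesis using that by (intro adjacent_edges) auto
  qed
  have up: "\<mu>\<^sup>2 * t \<le> \<mu> * t" if "0 \<le> t" for t
    using \<mu> that by (intro mult_right_mono) (auto simp: power2_eq_square mult_left_le_one_le)
  show ?thesis
  proof (cases "p = a")
    case True
    then have "\<mu> * (norm (q - p))\<^sup>2 \<le> (norm (b - a))\<^sup>2" using adj[of a b q] assms by simp
    then show ?thesis using up[of "(norm (q - p))\<^sup>2"] by simp
  next
    case False
    have "\<mu>\<^sup>2 * (norm (q - p))\<^sup>2 = \<mu> * (\<mu> * (norm (q - p))\<^sup>2)" by (simp add: power2_eq_square)
    also have "\<dots> \<le> \<mu> * (norm (a - p))\<^sup>2"
      using \<mu> adj[of p a q] assms False by (intro mult_left_mono) auto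
    also have "\<dots> = \<mu> * (norm (p - a))\<^sup>2" by (simp add: norm_minus_commute)
    also have "\<dots> \<le> (norm (b - a))\<^sup>2" using adj[of a b p] assms by simp
    finally show ?thesis .
  qed
qed

lemma orth_part_lower:
  assumes "{a, b, c} \<subseteq> C" "distinct [a, b, c]"
  shows "\<mu> * (norm (c - a))\<^sup>2 \<le> (norm (orth_part (b - a) (c - a)))\<^sup>2"
  using triangle_gram[OF assms] assms(2) by (subst norm_orth_part) (auto simp: field_simps)

text \<open>The orthogonal projection of \<open>p\<close> to the plane of \<open>b\<close>, \<open>c\<close>, \<open>e\<close> has barycentric
  coordinates with sum one, hence a positive one; the sign of a coordinate is that of the cosine
  of the dihedral angle at the opposite edge.\<close>

lemma acute_dihedral_exists:
  fixes b c e p :: 'a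
  assumes "distinct [b, c, e]" "0 < gram2 (c - b) (e - b)"
  shows "\<exists>b' c' e'. {b', c', e'} = {b, c, e} \<and> distinct [b', c', e'] \<and>
    0 \<le> orth_part (c' - b') (e' - b') \<bullet> orth_part (c' - b') (p - b')"
proof (rule ccontr)
  assume neg: "\<not> ?thesis"
  define x y z where "x = c - b" and "y = e - b" and "z = p - b"
  have orth: "(norm t)\<^sup>2 * (orth_part t v \<bullet> orth_part t w) = (norm t)\<^sup>2 * (v \<bullet> w) - (t \<bullet> v) * (t \<bullet> w)"
    if "t \<noteq> 0" for t v w :: 'a
    using that unfolding orth_part_def power2_norm_eq_inner
    by (simp add: inner_diff_left inner_diff_right inner_commute field_simps)
  have lt: "(norm (c' - b'))\<^sup>2 * (orth_part (c' - b') (e' - b') \<bullet> orth_part (c' - b') (p - b')) < 0"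
    if "{b', c', e'} = {b, c, e}" "distinct [b', c', e']" for b' c' e'
  proof -
    have "orth_part (c' - b') (e' - b') \<bullet> orth_part (c' - b') (p - b') < 0" using neg that not_le by blast
    moreover have "0 < (norm (c' - b'))\<^sup>2" using that(2) by auto
    ultimately show ?thesis by (simp add: mult_pos_neg)
  qed
  have nz: "x \<noteq> 0" "y \<noteq> 0" "y - x \<noteq> 0" using assms(1) by (auto simp: x_def y_def)
  have 1: "(norm x)\<^sup>2 * (y \<bullet> z) - (x \<bullet> y) * (x \<bullet> z) < 0"
    using lt[of b c e] assms(1) orth[OF nz(1), of y z] by (simp add: x_def y_def z_def)
  have 2: "(norm y)\<^sup>2 * (x \<bullet> z) - (y \<bullet> x) * (y \<bullet> z) < 0"
    using lt[of b e c] assms(1) orth[OF nz(2), of x z] by (auto simp: x_def y_def z_def)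
  have e: "e - c = y - x" "b - c = - x" "p - c = z - x" by (simp_all add: x_def y_def z_def)
  have 3: "(norm (y - x))\<^sup>2 * ((- x) \<bullet> (z - x)) - ((y - x) \<bullet> (- x)) * ((y - x) \<bullet> (z - x)) < 0"
    using lt[of c e b] assms(1) orth[OF nz(3), of "- x" "z - x"] unfolding e by auto
  have "((norm x)\<^sup>2 * (y \<bullet> z) - (x \<bullet> y) * (x \<bullet> z)) + ((norm y)\<^sup>2 * (x \<bullet> z) - (y \<bullet> x) * (y \<bullet> z)) +
    ((norm (y - x))\<^sup>2 * ((- x) \<bullet> (z - x)) - ((y - x) \<bullet> (- x)) * ((y - x) \<bullet> (z - x))) = gram2 x y"
    unfolding gram2_def power2_norm_eq_inner
    by (simp add: inner_diff_left inner_diff_right inner_commute power2_eq_square algebra_simps)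
  then show False using 1 2 3 assms(2) unfolding x_def[symmetric] y_def[symmetric] by linarith
qed

lemma coordinate_from_normal:
  assumes "b \<in> C" "p \<noteq> b" "0 < L" "L \<le> norm n"
    and "\<And>q. q \<in> C \<Longrightarrow> q \<noteq> p \<Longrightarrow> n \<bullet> (q - b) = 0" "n \<bullet> (p - b) = (norm n)\<^sup>2"
  shows "\<exists>a k. (\<forall>q\<in>C. a \<bullet> q + k = (if q = p then 1 else 0)) \<and> norm a * L \<le> 1"
proof -
  have n: "0 < norm n" using assms(3,4) by linarith
  define a where "a = (1 / (norm n)\<^sup>2) *\<^sub>R n"
  have "a \<bullet> q + - (a \<bullet> b) = (if q = p then 1 else 0)" if q: "q \<in> C" for q
  proof -
    have "a \<bullet> q + - (a \<bullet> b) = (n \<bullet> (q - b)) / (norm n)\<^sup>2" by (simp add: a_def inner_diff_right diff_divide_distrib)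
    then show ?thesis using assms(5)[OF q] assms(6) n by auto
  qed
  moreover have "norm a * L \<le> 1"
  proof -
    have "norm a = 1 / norm n" using n by (simp add: a_def power2_eq_square)
    then show ?thesis using n assms(4) by simp
  qed
  ultimately show ?thesis by blast
qed

lemma \<mu>_power_le: "m \<le> n \<Longrightarrow> \<mu> ^ n \<le> \<mu> ^ m"
  using \<mu> by (intro power_decreasing) auto

lemma norm_ge_if_square_ge:
  assumes "\<mu> ^ 4 * d\<^sup>2 \<le> (norm n)\<^sup>2" "0 \<le> d"
  shows "\<mu>\<^sup>2 * d \<le> norm (n :: 'a)"
proof (rule power2_le_imp_le)
  show "(\<mu>\<^sup>2 * d)\<^sup>2 \<le> (norm n)\<^sup>2" using assms(1) by (simp add: power_mult_distrib flip: power_mult)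
qed simp

lemma coordinate_triangle:
  assumes C: "C = {p, b, c}" "distinct [p, b, c]" and uv: "u \<in> C" "v \<in> C" "u \<noteq> v"
  shows "\<exists>a k. (\<forall>q\<in>C. a \<bullet> q + k = (if q = p then 1 else 0)) \<and> norm a * (\<mu>\<^sup>2 * norm (u - v)) \<le> 1"
proof -
  define d where "d = norm (u - v)"
  have d: "0 < d" using uv by (simp add: d_def)
  define n where "n = orth_part (c - b) (p - b)"
  have t: "c - b \<noteq> 0" using C(2) by auto
  have n0: "n \<bullet> (c - b) = 0" unfolding n_def using orth_part_orthogonal[OF t] .
  have np: "n \<bullet> (p - b) = (norm n)\<^sup>2"
  proof -
    have "p - b = n + (((p - b) \<bullet> (c - b)) / ((c - b) \<bullet> (c - b))) *\<^sub>R (c - b)" by (simp add: n_def orth_part_def)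
    then have "n \<bullet> (p - b) = n \<bullet> n + n \<bullet> ((((p - b) \<bullet> (c - b)) / ((c - b) \<bullet> (c - b))) *\<^sub>R (c - b))"
      by (metis inner_add_right)
    then show ?thesis using n0 by (simp add: power2_norm_eq_inner)
  qed
  have "\<mu> ^ 4 * d\<^sup>2 \<le> \<mu> ^ 3 * d\<^sup>2" by (intro mult_right_mono \<mu>_power_le) auto
  also have "\<dots> = \<mu> * (\<mu>\<^sup>2 * d\<^sup>2)" by (simp add: power2_eq_square power3_eq_cube)
  also have "\<dots> \<le> \<mu> * (norm (p - b))\<^sup>2"
    using edges_comparable[of b p v u] C uv \<mu> by (intro mult_left_mono) (auto simp: d_def)
  also have "\<dots> \<le> (norm n)\<^sup>2" unfolding n_def using C by (intro orth_part_lower) auto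
  finally have "\<mu>\<^sup>2 * d \<le> norm n" using d by (intro norm_ge_if_square_ge) auto
  then show ?thesis unfolding d_def[symmetric]
    using C n0 np d \<mu> by (intro coordinate_from_normal[of b]) auto
qed

lemma acute_base:
  assumes C: "C = {p, b, c, e}" "distinct [p, b, c, e]"
  obtains b' c' e' where "C = {p, b', c', e'}" "distinct [p, b', c', e']" "{b', c', e'} = {b, c, e}"
    "0 \<le> orth_part (c' - b') (e' - b') \<bullet> orth_part (c' - b') (p - b')"
proof -
  have "0 < \<mu> * ((norm (c - b))\<^sup>2 * (norm (e - b))\<^sup>2)" using C(2) \<mu> by auto
  also have "\<dots> \<le> gram2 (c - b) (e - b)" using C by (intro triangle_gram) auto
  finally obtain b' c' e' where *: "{b', c', e'} = {b, c, e}" "distinct [b', c', e']"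
    "0 \<le> orth_part (c' - b') (e' - b') \<bullet> orth_part (c' - b') (p - b')"
    using acute_dihedral_exists[of b c e p] C(2) by auto
  have "C = {p, b', c', e'}" using C(1) *(1) by auto
  moreover have "p \<notin> {b', c', e'}" unfolding *(1) using C(2) by auto
  ultimately show ?thesis using * by (intro that) auto
qed

lemma acute_dihedral_gram:
  assumes "C = {p, b, c, e}" "distinct [p, b, c, e]"
    "0 \<le> orth_part (c - b) (e - b) \<bullet> orth_part (c - b) (p - b)"
  shows "\<mu> * ((norm (orth_part (c - b) (e - b)))\<^sup>2 * (norm (orth_part (c - b) (p - b)))\<^sup>2) \<le>
    gram2 (orth_part (c - b) (e - b)) (orth_part (c - b) (p - b))"
  using assms by (intro acute_gram dihedral) auto

lemma coordinate_tetrahedron: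
  assumes C0: "C = {p, b0, c0, e0}" "distinct [p, b0, c0, e0]" and uv: "u \<in> C" "v \<in> C" "u \<noteq> v"
  shows "\<exists>a k. (\<forall>q\<in>C. a \<bullet> q + k = (if q = p then 1 else 0)) \<and> norm a * (\<mu>\<^sup>2 * norm (u - v)) \<le> 1"
proof -
  obtain b c e where C: "C = {p, b, c, e}" "distinct [p, b, c, e]"
    and acute: "0 \<le> orth_part (c - b) (e - b) \<bullet> orth_part (c - b) (p - b)"
    by (rule acute_base[OF C0]) blast
  define d where "d = norm (u - v)"
  have d: "0 < d" using uv by (simp add: d_def)
  have t: "c - b \<noteq> 0" using C(2) by auto
  define w2 w3 where "w2 = orth_part (c - b) (e - b)" and "w3 = orth_part (c - b) (p - b)"
  define n where "n = orth_part w2 w3"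
  have w0: "w2 \<bullet> (c - b) = 0" "w3 \<bullet> (c - b) = 0"
    unfolding w2_def w3_def using orth_part_orthogonal[OF t] by auto
  have lower: "\<mu> * (\<mu>\<^sup>2 * d\<^sup>2) \<le> (norm (orth_part (c - b) (q - b)))\<^sup>2" if "q = e \<or> q = p" for q
  proof -
    have "\<mu> * (\<mu>\<^sup>2 * d\<^sup>2) \<le> \<mu> * (norm (q - b))\<^sup>2"
      using edges_comparable[of b q v u] C uv \<mu> that by (intro mult_left_mono) (auto simp: d_def)
    also have "\<dots> \<le> (norm (orth_part (c - b) (q - b)))\<^sup>2" using C that by (intro orth_part_lower) auto
    finally show ?thesis .
  qed
  have "0 < \<mu> * (\<mu>\<^sup>2 * d\<^sup>2)" using \<mu> d by simp
  then have w2: "w2 \<noteq> 0" using lower[of e] unfolding w2_def by auto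
  have n2: "n \<bullet> w2 = 0" unfolding n_def by (rule orth_part_orthogonal[OF w2])
  have nt: "n \<bullet> (c - b) = 0"
    unfolding n_def orth_part_def using w0 by (simp add: inner_diff_left)
  have ne: "n \<bullet> (e - b) = 0"
  proof -
    have "e - b = w2 + (((e - b) \<bullet> (c - b)) / ((c - b) \<bullet> (c - b))) *\<^sub>R (c - b)" by (simp add: w2_def orth_part_def)
    then have "n \<bullet> (e - b) = n \<bullet> w2 + n \<bullet> ((((e - b) \<bullet> (c - b)) / ((c - b) \<bullet> (c - b))) *\<^sub>R (c - b))"
      by (metis inner_add_right)
    then show ?thesis using n2 nt by simp
  qed
  have np: "n \<bullet> (p - b) = (norm n)\<^sup>2"
  proof -
    have "p - b = w3 + (((p - b) \<bullet> (c - b)) / ((c - b) \<bullet> (c - b))) *\<^sub>R (c - b)" by (simp add: w3_def orth_part_def)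
    then have "n \<bullet> (p - b) = n \<bullet> w3 + n \<bullet> ((((p - b) \<bullet> (c - b)) / ((c - b) \<bullet> (c - b))) *\<^sub>R (c - b))"
      by (metis inner_add_right)
    then have 1: "n \<bullet> (p - b) = n \<bullet> w3" using nt by simp
    have "w3 = n + ((w3 \<bullet> w2) / (w2 \<bullet> w2)) *\<^sub>R w2" by (simp add: n_def orth_part_def)
    then have "n \<bullet> w3 = n \<bullet> n + n \<bullet> (((w3 \<bullet> w2) / (w2 \<bullet> w2)) *\<^sub>R w2)" by (metis inner_add_right)
    then show ?thesis using 1 n2 by (simp add: power2_norm_eq_inner)
  qed
  have "\<mu> ^ 4 * d\<^sup>2 = \<mu> * (\<mu> * (\<mu>\<^sup>2 * d\<^sup>2))" by (simp add: power2_eq_square power4_eq_xxxx)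
  also have "\<dots> \<le> \<mu> * (norm w3)\<^sup>2" using lower[of p] \<mu> unfolding w3_def by (intro mult_left_mono) auto
  also have "\<dots> \<le> (norm n)\<^sup>2"
    using acute_dihedral_gram[OF C acute] w2 unfolding n_def norm_orth_part[OF w2] w2_def[symmetric] w3_def[symmetric]
    by (simp add: field_simps)
  finally have "\<mu>\<^sup>2 * d \<le> norm n" using d by (intro norm_ge_if_square_ge) auto
  then show ?thesis unfolding d_def[symmetric]
    using C nt ne np d \<mu> by (intro coordinate_from_normal[of b]) auto
qed

end

lemma simplex_diameter:
  fixes \<tau> :: "'a::euclidean_space set"
  assumes \<tau>: "int DIM('a) simplex \<tau>"
  obtains u v where "u \<in> corners \<tau>" "v \<in> corners \<tau>" "u \<noteq> v" "diameter \<tau> = norm (u - v)"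
proof -
  note c = corners_simplex[OF \<tau>]
  have card: "2 \<le> card (corners \<tau>)" using c(3) DIM_positive[where 'a='a] by linarith
  then have "corners \<tau> \<noteq> {}" by auto
  then obtain u v where uv: "u \<in> corners \<tau>" "v \<in> corners \<tau>"
    "\<And>x y. x \<in> \<tau> \<Longrightarrow> y \<in> \<tau> \<Longrightarrow> norm (x - y) \<le> norm (u - v)"
    using simplex_extremal_le[OF c(1)] c(4) by metis
  obtain x y where "x \<in> corners \<tau>" "y \<in> corners \<tau>" "x \<noteq> y"
    using card card_le_Suc0_iff_eq[OF c(1)] by fastforce
  then have "0 < norm (u - v)"
    using uv(3)[of x y] corner_in[OF \<tau>] by (metis eq_iff_diff_eq_0 less_le_trans zero_less_norm_iff)
  moreover have "diameter \<tau> \<le> norm (u - v)"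
    by (rule diameter_le) (use uv(3) in auto)
  moreover have "norm (u - v) \<le> diameter \<tau>"
    using diameter_bounded_bound[OF compact_imp_bounded[OF simplex_compact[OF \<tau>]] corner_in[OF \<tau> uv(1)] corner_in[OF \<tau> uv(2)]]
    by (simp add: dist_norm)
  ultimately show ?thesis using uv by (intro that[of u v]) auto
qed

lemma regular_simplex_fat:
  fixes \<tau> :: "'a::euclidean_space set"
  assumes \<tau>: "int DIM('a) simplex \<tau>" and dim: "DIM('a) = 2 \<or> DIM('a) = 3"
    and reg: "regular_corners (corners \<tau>) \<kappa>"
  shows "\<exists>s. ball s ((1 - \<kappa>\<^sup>2)\<^sup>2 / (real DIM('a) + 1) * diameter \<tau>) \<subseteq> \<tau>"
proof -
  interpret regular_corners "corners \<tau>" \<kappa> by (rule reg)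
  note c = corners_simplex[OF \<tau>]
  obtain u v where uv: "u \<in> corners \<tau>" "v \<in> corners \<tau>" "u \<noteq> v" "diameter \<tau> = norm (u - v)"
    by (rule simplex_diameter[OF \<tau>])
  have coord: "\<exists>a k. (\<forall>q\<in>corners \<tau>. a \<bullet> q + k = (if q = p then 1 else 0)) \<and> norm a * (\<mu>\<^sup>2 * norm (u - v)) \<le> 1"
    if p: "p \<in> corners \<tau>" for p
  proof -
    have split: "corners \<tau> = insert p (corners \<tau> - {p})" "card (corners \<tau> - {p}) = DIM('a)"
      using p c(1,3) by auto
    from dim show ?thesis
    proof
      assume "DIM('a) = 2"
      then obtain x y where "corners \<tau> - {p} = {x, y}" "x \<noteq> y" using split(2) card_2_iff by metis
      then have "corners \<tau> = {p, x, y}" "distinct [p, x, y]" using split(1) by auto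
      then show ?thesis using coordinate_triangle uv by blast
    next
      assume "DIM('a) = 3"
      then obtain x y z where "corners \<tau> - {p} = {x, y, z}" "x \<noteq> y" "y \<noteq> z" "x \<noteq> z" using split(2) card_3_iff by metis
      then have "corners \<tau> = {p, x, y, z}" "distinct [p, x, y, z]" using split(1) by auto
      then show ?thesis using coordinate_tetrahedron uv by blast
    qed
  qed
  define N where "N = real DIM('a) + 1"
  have N: "0 < N" "N = real (card (corners \<tau>))" using c(3) by (auto simp: N_def)
  define s where "s = (\<Sum>q\<in>corners \<tau>. (1 / N) *\<^sub>R q)"
  have sum1: "(\<Sum>q\<in>corners \<tau>. 1 / N) = 1" using N by simp
  show ?thesis
  proof (intro exI[of _ s] subsetI)
    fix x assume x: "x \<in> ball s ((1 - \<kappa>\<^sup>2)\<^sup>2 / (real DIM('a) + 1) * diameter \<tau>)"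
    have "0 \<le> bary \<tau> p x" if p: "p \<in> corners \<tau>" for p
    proof -
      obtain a k where ak: "\<And>q. q \<in> corners \<tau> \<Longrightarrow> a \<bullet> q + k = (if q = p then 1 else 0)"
        "norm a * (\<mu>\<^sup>2 * norm (u - v)) \<le> 1" using coord[OF p] by blast
      have bary: "bary \<tau> p y = a \<bullet> y + k" for y
      proof -
        have "a \<bullet> y + k = (\<Sum>q\<in>corners \<tau>. if q = p then bary \<tau> q y else 0)"
          unfolding bary_affine_function[OF \<tau>, of a y k] by (intro sum.cong) (auto simp: ak)
        then show ?thesis using p c(1) by simp
      qed
      have "bary \<tau> p s = 1 / N" unfolding s_def by (rule bary_unique[OF \<tau> sum1 p])
      then have "bary \<tau> p x = 1 / N + a \<bullet> (x - s)" by (simp add: bary inner_diff_right)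
      moreover have "\<bar>a \<bullet> (x - s)\<bar> \<le> 1 / N"
      proof -
        have "norm (x - s) \<le> \<mu>\<^sup>2 * norm (u - v) / N"
          using x uv(4) by (simp add: \<mu>_def N_def dist_norm norm_minus_commute)
        then have "norm a * norm (x - s) \<le> norm a * (\<mu>\<^sup>2 * norm (u - v) / N)" by (intro mult_left_mono) auto
        also have "\<dots> \<le> 1 / N" using ak(2) N by (simp add: divide_simps)
        finally show ?thesis using Cauchy_Schwarz_ineq2 order_trans by blast
      qed
      ultimately show ?thesis by linarith
    qed
    then show "x \<in> \<tau>" using mem_simplex_iff[OF \<tau>] by blast
  qed
qed

section \<open>Volumes of tetrahedra\<close>

definition gram3 :: "'a::real_inner \<Rightarrow> 'a \<Rightarrow> 'a \<Rightarrow> real" where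
  "gram3 x y z = (x \<bullet> x) * ((y \<bullet> y) * (z \<bullet> z) - (y \<bullet> z)\<^sup>2) - (x \<bullet> y) * ((x \<bullet> y) * (z \<bullet> z) - (y \<bullet> z) * (x \<bullet> z))
     + (x \<bullet> z) * ((x \<bullet> y) * (y \<bullet> z) - (y \<bullet> y) * (x \<bullet> z))"

text \<open>36 times the square of the volume of the tetrahedron.\<close>

definition tet_gram :: "'a::real_inner \<Rightarrow> 'a \<Rightarrow> 'a \<Rightarrow> 'a \<Rightarrow> real" where
  "tet_gram a b c e = gram3 (b - a) (c - a) (e - a)"

lemma gram3_orth:
  assumes "t \<noteq> 0"
  shows "gram3 t v w = (norm t)\<^sup>2 * gram2 (orth_part t v) (orth_part t w)"
  using assms unfolding gram3_def gram2_def orth_part_def power2_norm_eq_inner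
  by (simp add: inner_diff_left inner_diff_right inner_commute field_simps power2_eq_square)

lemma tet_gram_swap12: "tet_gram b a c e = tet_gram a b c e"
proof -
  have "gram3 (- x) (y - x) (z - x) = gram3 x y z" for x y z :: 'a
    unfolding gram3_def by (simp add: inner_diff_left inner_diff_right inner_commute power2_eq_square algebra_simps)
  from this[of "b - a" "c - a" "e - a"] show ?thesis by (simp add: tet_gram_def)
qed

lemma tet_gram_swap23: "tet_gram a c b e = tet_gram a b c e"
  unfolding tet_gram_def gram3_def by (simp add: inner_commute power2_eq_square algebra_simps)

lemma tet_gram_swap34: "tet_gram a b e c = tet_gram a b c e"
  unfolding tet_gram_def gram3_def by (simp add: inner_commute power2_eq_square algebra_simps)

lemma tet_gram_cong:
  assumes eq: "{a, b, c, e} = {a', b', c', e'}" and dist: "distinct [a, b, c, e]" "distinct [a', b', c', e']"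
  shows "tet_gram a b c e = tet_gram a' b' c' e'"
proof -
  have "a' \<in> {a, b, c, e}" "b' \<in> {a, b, c, e}" "c' \<in> {a, b, c, e}" "e' \<in> {a, b, c, e}" unfolding eq by auto
  moreover have "a' \<noteq> b'" "a' \<noteq> c'" "a' \<noteq> e'" "b' \<noteq> c'" "b' \<noteq> e'" "c' \<noteq> e'" using dist(2) by auto
  ultimately show ?thesis
    by (elim insertE emptyE; simp; metis tet_gram_swap12 tet_gram_swap23 tet_gram_swap34)
qed

lemma (in regular_corners) tet_gram_lower:
  assumes C0: "C = {p, b0, c0, e0}" "distinct [p, b0, c0, e0]" and uv: "u \<in> C" "v \<in> C"
  shows "\<mu> ^ 9 * norm (u - v) ^ 6 \<le> tet_gram p b0 c0 e0"
proof -
  obtain b c e where C: "C = {p, b, c, e}" "distinct [p, b, c, e]" "{b, c, e} = {b0, c0, e0}"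
    and acute: "0 \<le> orth_part (c - b) (e - b) \<bullet> orth_part (c - b) (p - b)"
    by (rule acute_base[OF C0]) blast
  define d where "d = norm (u - v)"
  have edge: "\<mu>\<^sup>2 * d\<^sup>2 \<le> (norm (q - b))\<^sup>2" if "q \<in> {c, e, p}" for q
    using edges_comparable[of b q v u] C uv that by (auto simp: d_def)
  have lower: "\<mu> * (\<mu>\<^sup>2 * d\<^sup>2) \<le> (norm (orth_part (c - b) (q - b)))\<^sup>2" if "q \<in> {e, p}" for q
  proof -
    have "\<mu> * (\<mu>\<^sup>2 * d\<^sup>2) \<le> \<mu> * (norm (q - b))\<^sup>2" using edge[of q] \<mu> that by (intro mult_left_mono) auto
    also have "\<dots> \<le> (norm (orth_part (c - b) (q - b)))\<^sup>2" using C that by (intro orth_part_lower) auto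
    finally show ?thesis .
  qed
  have "\<mu> ^ 9 * d ^ 6 = (\<mu>\<^sup>2 * d\<^sup>2) * (\<mu> * ((\<mu> * (\<mu>\<^sup>2 * d\<^sup>2)) * (\<mu> * (\<mu>\<^sup>2 * d\<^sup>2))))"
    by (simp add: power_numeral_reduce)
  also have "\<dots> \<le> (norm (c - b))\<^sup>2 * (\<mu> * ((norm (orth_part (c - b) (e - b)))\<^sup>2 * (norm (orth_part (c - b) (p - b)))\<^sup>2))"
    using \<mu> by (intro mult_mono edge lower mult_left_mono mult_nonneg_nonneg) auto
  also have "\<dots> \<le> (norm (c - b))\<^sup>2 * gram2 (orth_part (c - b) (e - b)) (orth_part (c - b) (p - b))"
    by (intro mult_left_mono acute_dihedral_gram C acute) auto
  also have "\<dots> = tet_gram b c e p"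
  proof -
    have "c - b \<noteq> 0" using C(2) by auto
    then show ?thesis by (simp add: tet_gram_def gram3_orth)
  qed
  also have "\<dots> = tet_gram p b0 c0 e0"
    using C C0 by (intro tet_gram_cong) auto
  finally show ?thesis unfolding d_def .
qed

lemma gram3_ops:
  "gram3 (u - v) v w = gram3 u v w" "gram3 (u + v) v w = gram3 u v w" "gram3 (- u) v w = gram3 u v w"
  unfolding gram3_def
  by (simp_all add: inner_diff_left inner_diff_right inner_add_left inner_add_right inner_commute power2_eq_square algebra_simps)

lemma gram3_swap: "gram3 u v w = gram3 v u w" "gram3 u v w = gram3 u w v"
  unfolding gram3_def by (simp_all add: inner_commute power2_eq_square algebra_simps)

lemma red_tetrahedron_gram:
  fixes a b c e :: "'a::euclidean_space"
  assumes "\<sigma> \<in> red_tetrahedron a b c e"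
  obtains a' b' c' e' where "\<sigma> = convex hull {a', b', c', e'}" "tet_gram a' b' c' e' = tet_gram a b c e / 64"
proof -
  define x y z where "x = b - a" and "y = c - a" and "z = e - a"
  have bce: "b = a + x" "c = a + y" "e = a + z" by (simp_all add: x_def y_def z_def)
  have red: "tet_gram p q r s = tet_gram a b c e / 64"
    if "gram3 (2 *\<^sub>R (q - p)) (2 *\<^sub>R (r - p)) (2 *\<^sub>R (s - p)) = gram3 x y z" for p q r s :: 'a
  proof -
    have "gram3 (2 *\<^sub>R u) (2 *\<^sub>R v) (2 *\<^sub>R w) = 64 * gram3 u v w" for u v w :: 'a
      unfolding gram3_def by (simp add: power2_eq_square algebra_simps)
    then have "64 * gram3 (q - p) (r - p) (s - p) = gram3 x y z" using that by metis
    then show ?thesis by (simp add: tet_gram_def x_def y_def z_def)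
  qed
  have "gram3 x y z = gram3 (- x) (y - x) (z - x)"
    using gram3_ops(3)[of x "y - x" "z - x"] gram3_ops(1)[of y x "z - x"] gram3_ops(1)[of z x y] gram3_swap by metis
  moreover have "gram3 x y z = gram3 (- y) (x - y) (z - y)"
    using gram3_ops(3)[of y "x - y" "z - y"] gram3_ops(1)[of x y "z - y"] gram3_ops(1)[of z y x] gram3_swap by metis
  moreover have "gram3 x y z = gram3 (- z) (x - z) (y - z)"
    using gram3_ops(3)[of z "x - z" "y - z"] gram3_ops(1)[of x z "y - z"] gram3_ops(1)[of y z x] gram3_swap by metis
  moreover have neg: "gram3 x y w = gram3 (y - x) y w" "gram3 x z w = gram3 (z - x) z w" for w
    using gram3_ops(3)[of "x - y" y w] gram3_ops(1)[of x y w] gram3_ops(3)[of "x - z" z w] gram3_ops(1)[of x z w] by simp_all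
  moreover have "gram3 x y z = gram3 (z + (y - x)) (y - x) y"
    using gram3_ops(2)[of z "y - x" y] neg(1)[of z] gram3_swap by metis
  moreover have "gram3 x y z = gram3 (- ((x - y) - z)) y z"
    using gram3_ops(3)[of "(x - y) - z" y z] gram3_ops(1)[of "x - y" z y] gram3_ops(1)[of x y z] gram3_swap by metis
  moreover have "gram3 x y z = gram3 (y + (z - x)) z (z - x)"
    using gram3_ops(2)[of y "z - x" z] neg(2)[of y] gram3_swap by metis
  moreover have "gram3 x y z = gram3 (y + (z - x)) (z - x) (y - x)"
    using gram3_ops(2)[of y "z - x" "y - x"] neg(1)[of "z - x"] gram3_ops(1)[of z x y] gram3_swap by metis
  ultimately have eqs: "gram3 (- x) (y - x) (z - x) = gram3 x y z" "gram3 (- y) (x - y) (z - y) = gram3 x y z"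
    "gram3 (- z) (x - z) (y - z) = gram3 x y z" "gram3 (z + (y - x)) (y - x) y = gram3 x y z"
    "gram3 (- ((x - y) - z)) y z = gram3 x y z" "gram3 (y + (z - x)) z (z - x) = gram3 x y z"
    "gram3 (y + (z - x)) (z - x) (y - x) = gram3 x y z" by simp_all
  have red': "tet_gram p q r s = tet_gram a b c e / 64"
    if "gram3 u v w = gram3 x y z" "2 *\<^sub>R (q - p) = u" "2 *\<^sub>R (r - p) = v" "2 *\<^sub>R (s - p) = w" for p q r s u v w :: 'a
    using red that by simp
  have mids: "2 *\<^sub>R (midpoint a b - a) = x" "2 *\<^sub>R (midpoint a c - a) = y" "2 *\<^sub>R (midpoint a e - a) = z"
    "2 *\<^sub>R (midpoint a b - b) = - x" "2 *\<^sub>R (midpoint b c - b) = y - x" "2 *\<^sub>R (midpoint b e - b) = z - x"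
    "2 *\<^sub>R (midpoint a c - c) = - y" "2 *\<^sub>R (midpoint b c - c) = x - y" "2 *\<^sub>R (midpoint c e - c) = z - y"
    "2 *\<^sub>R (midpoint a e - e) = - z" "2 *\<^sub>R (midpoint b e - e) = x - z" "2 *\<^sub>R (midpoint c e - e) = y - z"
    "2 *\<^sub>R (midpoint a c - midpoint a b) = y - x" "2 *\<^sub>R (midpoint b c - midpoint a b) = y"
    "2 *\<^sub>R (midpoint b e - midpoint a b) = z" "2 *\<^sub>R (midpoint a e - midpoint a b) = z - x"
    "2 *\<^sub>R (midpoint c e - midpoint a b) = z + (y - x)" "2 *\<^sub>R (midpoint c e - midpoint a b) = - ((x - y) - z)"
    "2 *\<^sub>R (midpoint c e - midpoint a b) = y + (z - x)"
    unfolding midpoint_def bce by (simp_all add: scaleR_right_diff_distrib scaleR_2)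
  from assms consider "\<sigma> = convex hull {a, midpoint a b, midpoint a c, midpoint a e}"
    | "\<sigma> = convex hull {b, midpoint a b, midpoint b c, midpoint b e}"
    | "\<sigma> = convex hull {c, midpoint a c, midpoint b c, midpoint c e}"
    | "\<sigma> = convex hull {e, midpoint a e, midpoint b e, midpoint c e}"
    | "\<sigma> = convex hull {midpoint a b, midpoint c e, midpoint a c, midpoint b c}"
    | "\<sigma> = convex hull {midpoint a b, midpoint c e, midpoint b c, midpoint b e}"
    | "\<sigma> = convex hull {midpoint a b, midpoint c e, midpoint b e, midpoint a e}"
    | "\<sigma> = convex hull {midpoint a b, midpoint c e, midpoint a e, midpoint a c}"
    unfolding red_tetrahedron_def by blast
  then show ?thesis
  proof cases
    case 1 then show ?thesis by (rule that) (rule red'[OF refl mids(1,2,3)])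
  next
    case 2 then show ?thesis by (rule that) (rule red'[OF eqs(1) mids(4,5,6)])
  next
    case 3 then show ?thesis by (rule that) (rule red'[OF eqs(2) mids(7,8,9)])
  next
    case 4 then show ?thesis by (rule that) (rule red'[OF eqs(3) mids(10,11,12)])
  next
    case 5 then show ?thesis by (rule that) (rule red'[OF eqs(4) mids(17,13,14)])
  next
    case 6 then show ?thesis by (rule that) (rule red'[OF eqs(5) mids(18,14,15)])
  next
    case 7 then show ?thesis by (rule that) (rule red'[OF eqs(6) mids(19,15,16)])
  next
    case 8 then show ?thesis by (rule that) (rule red'[OF eqs(7) mids(19,16,13)])
  qed
qed

section \<open>Sizes of the simplices\<close>

lemma dist_midpoints:
  "dist (midpoint x y) (midpoint x z) = dist y z / 2" "dist (midpoint y x) (midpoint x z) = dist y z / 2"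
  "dist (midpoint y x) (midpoint z x) = dist y z / 2" "dist (midpoint x y) (midpoint z x) = dist y z / 2"
  for x y z :: "'a::real_normed_vector"
proof -
  have "dist (midpoint x y) (midpoint x z) = dist y z / 2" for x y z :: 'a
  proof -
    have "midpoint x y - midpoint x z = (1/2) *\<^sub>R (y - z)" by (simp add: midpoint_def algebra_simps)
    then show ?thesis by (simp add: dist_norm)
  qed
  then show "dist (midpoint x y) (midpoint x z) = dist y z / 2" "dist (midpoint y x) (midpoint x z) = dist y z / 2"
    "dist (midpoint y x) (midpoint z x) = dist y z / 2" "dist (midpoint x y) (midpoint z x) = dist y z / 2"
    by (simp_all add: midpoint_sym[of y x] midpoint_sym[of z x])
qed

lemma corners_hull_subset: "corners (convex hull S) \<subseteq> S"
  unfolding corners_def using extreme_point_of_convex_hull by blast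

lemma red_triangle_diameter:
  fixes \<tau> \<sigma> :: "'a::euclidean_space set"
  assumes "int DIM('a) simplex \<tau>" "int DIM('a) simplex \<sigma>" "corners \<tau> = {a, b, c}" "\<sigma> \<in> red_triangle a b c"
  shows "diameter \<sigma> \<le> diameter \<tau> / 2"
proof -
  have d: "dist x y \<le> diameter \<tau>" if "x \<in> corners \<tau>" "y \<in> corners \<tau>" for x y
    using diameter_bounded_bound[OF compact_imp_bounded[OF simplex_compact[OF assms(1)]]] corner_in[OF assms(1)] that by blast
  have abc: "dist a b \<le> diameter \<tau>" "dist a c \<le> diameter \<tau>" "dist b c \<le> diameter \<tau>" "0 \<le> diameter \<tau>"
    "dist b a \<le> diameter \<tau>" "dist c a \<le> diameter \<tau>" "dist c b \<le> diameter \<tau>"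
    using d[of a b] d[of a c] d[of b c] d[of a a] unfolding assms(3) by (simp_all add: dist_commute)
  obtain u v where uv: "u \<in> corners \<sigma>" "v \<in> corners \<sigma>" "diameter \<sigma> = dist u v"
    using simplex_diameter[OF assms(2)] unfolding dist_norm by metis
  have tri: "dist u v \<le> r"
    if "\<sigma> = convex hull {x, y, z}" "dist x y \<le> r" "dist x z \<le> r" "dist y z \<le> r" "0 \<le> r" for x y z r
  proof -
    have "u \<in> {x, y, z}" "v \<in> {x, y, z}" using uv corners_hull_subset that(1) by blast+
    then show ?thesis using that(2-5) by (auto simp: dist_commute)
  qed
  from assms(4) consider "\<sigma> = convex hull {a, midpoint a b, midpoint a c}"
    | "\<sigma> = convex hull {b, midpoint a b, midpoint b c}"
    | "\<sigma> = convex hull {c, midpoint a c, midpoint b c}"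
    | "\<sigma> = convex hull {midpoint a b, midpoint a c, midpoint b c}"
    unfolding red_triangle_def by blast
  then show ?thesis
    unfolding uv(3) by cases (erule tri; use abc in \<open>simp add: dist_midpoint dist_midpoints\<close>)+
qed

lemma tetrahedron_corners:
  fixes \<tau> :: "'a::euclidean_space set"
  assumes "int DIM('a) simplex \<tau>" "DIM('a) = 3"
  obtains a b c e where "corners \<tau> = {a, b, c, e}" "distinct [a, b, c, e]"
proof -
  note c = corners_simplex[OF assms(1)]
  have card: "card (corners \<tau>) = 4" using c(3) assms(2) by simp
  then obtain a where a: "a \<in> corners \<tau>" by fastforce
  then have "card (corners \<tau> - {a}) = 3" using card c(1) by simp
  then obtain x y z where "corners \<tau> - {a} = {x, y, z}" "x \<noteq> y" "y \<noteq> z" "x \<noteq> z" using card_3_iff by metis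
  then show ?thesis using a by (intro that[of a x y z]) auto
qed

definition small_tetrahedron :: "'a::euclidean_space set \<Rightarrow> real \<Rightarrow> bool" where
  "small_tetrahedron \<tau> m \<longleftrightarrow> 0 \<le> m \<and>
     (\<exists>a b c e. corners \<tau> = {a, b, c, e} \<and> distinct [a, b, c, e] \<and> tet_gram a b c e \<le> m ^ 6)"

lemma red_tetrahedron_small:
  fixes \<tau> \<sigma> :: "'a::euclidean_space set"
  assumes small: "small_tetrahedron \<tau> m" and dim: "DIM('a) = 3" and \<sigma>: "int DIM('a) simplex \<sigma>"
    and abce: "corners \<tau> = {a, b, c, e}" "distinct [a, b, c, e]" "\<sigma> \<in> red_tetrahedron a b c e"
  shows "small_tetrahedron \<sigma> (m / 2)"
proof -
  have m: "0 \<le> m" and "\<exists>a b c e. corners \<tau> = {a, b, c, e} \<and> distinct [a, b, c, e] \<and> tet_gram a b c e \<le> m ^ 6"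
    using small unfolding small_tetrahedron_def by auto
  then obtain p q r s where p: "corners \<tau> = {p, q, r, s}" "distinct [p, q, r, s]" "tet_gram p q r s \<le> m ^ 6"
    by blast
  have "tet_gram a b c e = tet_gram p q r s" using abce p by (intro tet_gram_cong) auto
  then have le: "tet_gram a b c e \<le> m ^ 6" using p(3) by simp
  obtain a' b' c' e' where \<sigma>': "\<sigma> = convex hull {a', b', c', e'}" "tet_gram a' b' c' e' = tet_gram a b c e / 64"
    by (rule red_tetrahedron_gram[OF abce(3)])
  have sub: "corners \<sigma> \<subseteq> {a', b', c', e'}" unfolding \<sigma>'(1) by (rule corners_hull_subset)
  have card: "card (corners \<sigma>) = 4" using corners_simplex(3)[OF \<sigma>] dim by simp
  have "card (set [a', b', c', e']) \<le> 4" using card_length[of "[a', b', c', e']"] by simp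
  then have eq: "corners \<sigma> = {a', b', c', e'}" using sub card by (intro card_seteq) auto
  then have "card (set [a', b', c', e']) = length [a', b', c', e']" using card by simp
  then have "distinct [a', b', c', e']" by (rule card_distinct)
  moreover have "tet_gram a' b' c' e' \<le> (m / 2) ^ 6" "0 \<le> m / 2"
    using \<sigma>'(2) le m by (simp_all add: power_divide)
  ultimately show ?thesis unfolding small_tetrahedron_def using eq by blast
qed

context red_green_refinement
begin

lemma simplex_T: "\<tau> \<in> T j \<Longrightarrow> int DIM('a) simplex \<tau>"
  using partition[of j] unfolding simplicial_partition_def by blast

lemma finite_T: "finite (T j)"
  using partition[of j] unfolding simplicial_partition_def by blast

lemma fe_mesh_T: "polyhedral_domain \<Omega> \<Longrightarrow> fe_mesh \<Omega> (T j)"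
  using partition conformity unfolding fe_mesh_def polyhedral_domain_def by blast

lemma level_le: "\<tau> \<in> T j \<Longrightarrow> level T \<tau> \<le> j"
  unfolding level_def by (rule Least_le)

lemma unrefined_if_level_less:
  assumes "\<tau> \<in> T k" "level T \<tau> < k" "k \<le> J"
  shows "\<tau> \<in> T J"
  using assms(3)
proof (induction J rule: dec_induct)
  case (step j)
  have "\<not> is_refined T j \<tau>" using refined_level[of j \<tau>] step assms(2) by linarith
  then have "sons T j \<tau> = {\<tau>}" using step.IH by (simp add: is_refined_def)
  then show ?case unfolding sons_def by blast
qed (rule assms(1))

lemma level_eq_if_refined:
  assumes "\<tau> \<in> T k" "\<tau> \<notin> T J" "k \<le> J"
  shows "level T \<tau> = k"
  using unrefined_if_level_less[OF assms(1) _ assms(3)] level_le[OF assms(1)] assms(2) le_neq_implies_less by blast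

lemma father:
  assumes "\<sigma> \<in> T (Suc j)" "level T \<sigma> = Suc j"
  obtains \<tau> where "\<tau> \<in> T j" "\<sigma> \<in> sons T j \<tau>" "is_refined T j \<tau>" "level T \<tau> = j" "\<not> irregular_simplex T \<tau>"
proof -
  obtain \<tau> where \<tau>: "\<tau> \<in> T j" "\<sigma> \<subseteq> \<tau>" using nested[OF assms(1)] by blast
  have son: "\<sigma> \<in> sons T j \<tau>" unfolding sons_def using assms(1) \<tau>(2) by blast
  have "sons T j \<tau> \<noteq> {\<tau>}"
  proof
    assume "sons T j \<tau> = {\<tau>}"
    with son have "\<sigma> = \<tau>" by simp
    with \<tau>(1) have "\<sigma> \<in> T j" by simp
    from level_le[OF this] show False using assms(2) by simp
  qed
  then have ref: "is_refined T j \<tau>" unfolding is_refined_def using \<tau>(1) by blast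
  have "\<not> irregular_simplex T \<tau>" using irregular_not_refined[of \<tau> j] ref by blast
  then show ?thesis by (rule that[OF \<tau>(1) son ref refined_level[OF ref]])
qed

text \<open>Fathers of simplices of full level are regular, so that a quantity halved by regular
  refinement decays geometrically along the whole ancestry.\<close>

lemma regular_decay:
  fixes Q :: "'a set \<Rightarrow> real \<Rightarrow> bool"
  assumes "\<And>\<tau>. \<tau> \<in> T 0 \<Longrightarrow> Q \<tau> M"
    and step: "\<And>j \<tau> \<sigma> m. \<tau> \<in> T j \<Longrightarrow> Q \<tau> m \<Longrightarrow> regular_refinement \<tau> (sons T j \<tau>) \<Longrightarrow> \<sigma> \<in> sons T j \<tau> \<Longrightarrow> Q \<sigma> (m / 2)"
    and "\<tau> \<in> T j" "level T \<tau> = j" "\<not> irregular_simplex T \<tau>"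
  shows "Q \<tau> (M / 2 ^ j)"
  using assms(3-5)
proof (induction j arbitrary: \<tau>)
  case 0
  then show ?case using assms(1) by simp
next
  case (Suc j)
  obtain \<tau>' where \<tau>': "\<tau>' \<in> T j" "\<tau> \<in> sons T j \<tau>'" "is_refined T j \<tau>'" "level T \<tau>' = j" "\<not> irregular_simplex T \<tau>'"
    by (rule father[OF Suc.prems(1,2)])
  have "\<not> irregular_refinement \<tau>' (sons T j \<tau>')"
    using Suc.prems(3) \<tau>'(1,2) unfolding irregular_simplex_def by blast
  then have "regular_refinement \<tau>' (sons T j \<tau>')" using refinement[OF \<tau>'(3)] by blast
  then have "Q \<tau> (M / 2 ^ j / 2)" by (rule step[OF \<tau>'(1) Suc.IH[OF \<tau>'(1,4,5)] _ \<tau>'(2)])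
  then show ?case by (simp add: mult.commute)
qed

lemma diameter_upper_from_decay:
  fixes Q :: "'a set \<Rightarrow> real \<Rightarrow> bool"
  assumes Q0: "\<And>\<tau>. \<tau> \<in> T 0 \<Longrightarrow> Q \<tau> M"
    and step: "\<And>j \<tau> \<sigma> m. \<tau> \<in> T j \<Longrightarrow> Q \<tau> m \<Longrightarrow> regular_refinement \<tau> (sons T j \<tau>) \<Longrightarrow> \<sigma> \<in> sons T j \<tau> \<Longrightarrow> Q \<sigma> (m / 2)"
    and diam: "\<And>j \<tau> m. \<tau> \<in> T j \<Longrightarrow> Q \<tau> m \<Longrightarrow> diameter \<tau> \<le> K * m" and "0 \<le> K" "0 \<le> M"
    and \<tau>: "\<tau> \<in> T j" "level T \<tau> = j"
  shows "diameter \<tau> \<le> 2 * K * M / 2 ^ j"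
proof -
  have KM: "0 \<le> K * M / 2 ^ i" for i :: nat using assms(4,5) by simp
  show ?thesis
  proof (cases "irregular_simplex T \<tau>")
    case False
    have "diameter \<tau> \<le> K * (M / 2 ^ j)" by (rule diam[OF \<tau>(1) regular_decay[of Q, OF Q0 step \<tau> False]])
    then show ?thesis using KM[of j] by simp
  next
    case True
    show ?thesis
    proof (cases j)
      case 0
      then have "diameter \<tau> \<le> K * M" using diam[OF \<tau>(1) Q0] \<tau>(1) by blast
      then show ?thesis using KM[of 0] 0 by simp
    next
      case (Suc i)
      obtain \<tau>' where \<tau>': "\<tau>' \<in> T i" "\<tau> \<in> sons T i \<tau>'" "is_refined T i \<tau>'" "level T \<tau>' = i" "\<not> irregular_simplex T \<tau>'"
        using father \<tau> unfolding Suc by blast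
      have "\<tau> \<subseteq> \<tau>'" using \<tau>'(2) unfolding sons_def by blast
      then have "diameter \<tau> \<le> diameter \<tau>'"
        using compact_imp_bounded[OF simplex_compact[OF simplex_T[OF \<tau>'(1)]]] by (rule diameter_subset)
      also have "\<dots> \<le> K * (M / 2 ^ i)" by (rule diam[OF \<tau>'(1) regular_decay[of Q, OF Q0 step \<tau>'(1,4,5)]])
      finally show ?thesis unfolding Suc by simp
    qed
  qed
qed

lemma uniformly_regular:
  "\<exists>\<kappa>. \<forall>j. \<forall>\<tau>\<in>T j. regular_corners (corners \<tau>) \<kappa>"
proof -
  obtain \<alpha> where \<alpha>: "0 < \<alpha>" "\<And>j \<tau>. \<tau> \<in> T j \<Longrightarrow> interior_angles_ge \<alpha> \<tau>"
    using nondegenerate unfolding shape_regular_def by blast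
  define \<kappa> where "\<kappa> = cos (min \<alpha> (pi / 2))"
  have "0 \<le> \<kappa>" unfolding \<kappa>_def using \<alpha>(1) by (intro cos_ge_zero) (auto simp: min_def)
  moreover have "\<kappa> < 1"
    using cos_monotone_0_pi[of 0 "min \<alpha> (pi / 2)"] \<alpha>(1) by (auto simp: \<kappa>_def min_def)
  ultimately have "regular_corners (corners \<tau>) \<kappa>" if "\<tau> \<in> T j" for j \<tau>
    using \<alpha>(2)[OF that] vec_angle_inner_bound[OF _ \<alpha>(1)]
    unfolding interior_angles_ge_def dihedral_angle_def \<kappa>_def by unfold_locales blast+
  then show ?thesis by blast
qed

lemma diameter_upper:
  assumes dim: "DIM('a) = 2 \<or> DIM('a) = 3"
  shows "\<exists>C\<ge>0. \<forall>j. \<forall>\<tau>\<in>T j. level T \<tau> = j \<longrightarrow> diameter \<tau> \<le> C / 2 ^ j"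
  using dim
proof
  assume d2: "DIM('a) = 2"
  define M where "M = (\<Sum>\<tau>\<in>T 0. diameter \<tau>)"
  have nonneg: "0 \<le> diameter \<tau>" if "\<tau> \<in> T j" for \<tau> j
    by (rule diameter_ge_0[OF compact_imp_bounded[OF simplex_compact[OF simplex_T[OF that]]]])
  have Q0: "diameter \<tau> \<le> M" if "\<tau> \<in> T 0" for \<tau>
    unfolding M_def using that nonneg finite_T by (intro member_le_sum) auto
  have M: "0 \<le> M" unfolding M_def by (intro sum_nonneg nonneg)
  have step: "diameter \<sigma> \<le> m / 2"
    if \<tau>: "\<tau> \<in> T j" "diameter \<tau> \<le> m" "regular_refinement \<tau> (sons T j \<tau>)" "\<sigma> \<in> sons T j \<tau>" for j \<tau> \<sigma> m
  proof -
    obtain a b c where abc: "corners \<tau> = {a, b, c}" "sons T j \<tau> = red_triangle a b c"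
      using \<tau>(3) d2 unfolding regular_refinement_def by auto
    have "\<sigma> \<in> T (Suc j)" using \<tau>(4) unfolding sons_def by blast
    then have "diameter \<sigma> \<le> diameter \<tau> / 2"
      using red_triangle_diameter[OF simplex_T[OF \<tau>(1)] simplex_T abc(1)] \<tau>(4) abc(2) by blast
    then show ?thesis using \<tau>(2) by simp
  qed
  have "diameter \<tau> \<le> 2 * 1 * M / 2 ^ j" if "\<tau> \<in> T j" "level T \<tau> = j" for \<tau> j
    by (rule diameter_upper_from_decay[of "\<lambda>\<tau> m. diameter \<tau> \<le> m", OF Q0 step _ _ M that]) auto
  then show ?thesis using M by (intro exI[of _ "2 * 1 * M"]) auto
next
  assume d3: "DIM('a) = 3"
  obtain \<kappa> where \<kappa>: "\<And>j \<tau>. \<tau> \<in> T j \<Longrightarrow> regular_corners (corners \<tau>) \<kappa>" using uniformly_regular by blast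
  have "\<exists>g. small_tetrahedron \<tau> g \<and> 0 \<le> g" if \<tau>: "\<tau> \<in> T 0" for \<tau>
  proof -
    obtain a b c e where abce: "corners \<tau> = {a, b, c, e}" "distinct [a, b, c, e]"
      by (rule tetrahedron_corners[OF simplex_T[OF \<tau>] d3])
    define g where "g = 1 + \<bar>tet_gram a b c e\<bar>"
    have "tet_gram a b c e \<le> g ^ 1" by (simp add: g_def)
    also have "\<dots> \<le> g ^ 6" by (rule power_increasing) (auto simp: g_def)
    finally have "small_tetrahedron \<tau> g"
      unfolding small_tetrahedron_def using abce by (auto simp: g_def)
    then show ?thesis unfolding small_tetrahedron_def by blast
  qed
  then obtain g where g: "\<And>\<tau>. \<tau> \<in> T 0 \<Longrightarrow> small_tetrahedron \<tau> (g \<tau>)" "\<And>\<tau>. \<tau> \<in> T 0 \<Longrightarrow> 0 \<le> g \<tau>" by metis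
  define M where "M = (\<Sum>\<tau>\<in>T 0. g \<tau>)"
  have M: "0 \<le> M" unfolding M_def by (intro sum_nonneg g(2))
  have Q0: "small_tetrahedron \<tau> M" if "\<tau> \<in> T 0" for \<tau>
  proof -
    have "g \<tau> \<le> M" unfolding M_def using that g finite_T by (intro member_le_sum) auto
    then have "g \<tau> ^ 6 \<le> M ^ 6" using g(2)[OF that] by (intro power_mono)
    then show ?thesis using g(1)[OF that] M unfolding small_tetrahedron_def by (meson order_trans)
  qed
  have step: "small_tetrahedron \<sigma> (m / 2)"
    if \<tau>: "\<tau> \<in> T j" "small_tetrahedron \<tau> m" "regular_refinement \<tau> (sons T j \<tau>)" "\<sigma> \<in> sons T j \<tau>" for j \<tau> \<sigma> m
  proof -
    obtain a b c e where abc: "corners \<tau> = {a, b, c, e}" "distinct [a, b, c, e]" "sons T j \<tau> = red_tetrahedron a b c e"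
      using \<tau>(3) d3 unfolding regular_refinement_def by auto
    have "\<sigma> \<in> T (Suc j)" using \<tau>(4) unfolding sons_def by blast
    then show ?thesis using red_tetrahedron_small[OF \<tau>(2) d3 simplex_T abc(1,2)] \<tau>(4) abc(3) by blast
  qed
  define \<mu> where "\<mu> = 1 - \<kappa>\<^sup>2"
  have diam: "diameter \<tau> \<le> (1 / \<mu>\<^sup>2) * m" if \<tau>: "\<tau> \<in> T j" "small_tetrahedron \<tau> m" for j \<tau> m
  proof -
    interpret r: regular_corners "corners \<tau>" \<kappa> by (rule \<kappa>[OF \<tau>(1)])
    have \<mu>: "r.\<mu> = \<mu>" by (simp add: \<mu>_def r.\<mu>_def)
    have m: "0 \<le> m" and "\<exists>a b c e. corners \<tau> = {a, b, c, e} \<and> distinct [a, b, c, e] \<and> tet_gram a b c e \<le> m ^ 6"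
      using \<tau>(2) unfolding small_tetrahedron_def by auto
    then obtain a b c e where abce: "corners \<tau> = {a, b, c, e}" "distinct [a, b, c, e]" "tet_gram a b c e \<le> m ^ 6"
      by blast
    obtain u v where uv: "u \<in> corners \<tau>" "v \<in> corners \<tau>" "diameter \<tau> = norm (u - v)"
      using simplex_diameter[OF simplex_T[OF \<tau>(1)]] by metis
    have "(\<mu>\<^sup>2 * diameter \<tau>) ^ 6 = \<mu> ^ 12 * norm (u - v) ^ 6"
      by (simp add: power_mult_distrib uv(3) flip: power_mult)
    also have "\<dots> \<le> \<mu> ^ 9 * norm (u - v) ^ 6"
      unfolding \<mu>[symmetric] by (intro mult_right_mono r.\<mu>_power_le) auto
    also have "\<dots> \<le> m ^ 6"
      using r.tet_gram_lower[OF abce(1,2) uv(1,2)] abce(3) unfolding \<mu> by simp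
    finally have "\<mu>\<^sup>2 * diameter \<tau> \<le> m" using power_le_imp_le_base[of _ 5 m] m by simp
    then show ?thesis using r.\<mu>(1) unfolding \<mu> by (simp add: field_simps)
  qed
  have K: "0 \<le> 1 / \<mu>\<^sup>2" by simp
  have "diameter \<tau> \<le> 2 * (1 / \<mu>\<^sup>2) * M / 2 ^ j" if "\<tau> \<in> T j" "level T \<tau> = j" for \<tau> j
    by (rule diameter_upper_from_decay[of small_tetrahedron, OF Q0 step diam K M that])
  then show ?thesis using M K by (intro exI[of _ "2 * (1 / \<mu>\<^sup>2) * M"]) auto
qed

lemma dyadic_coordinates:
  assumes "\<tau> \<in> T k"
  shows "\<exists>\<tau>0\<in>T 0. \<tau> \<subseteq> \<tau>0 \<and> (\<forall>p\<in>corners \<tau>0. \<forall>q\<in>corners \<tau>. \<exists>m::int. bary \<tau>0 p q = of_int m / 2 ^ k)"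
  using assms
proof (induction k arbitrary: \<tau>)
  case 0
  have "\<exists>m::int. bary \<tau> p q = of_int m / 2 ^ 0" if "p \<in> corners \<tau>" "q \<in> corners \<tau>" for p q
    using bary_corner[OF simplex_T[OF 0] that]
    by (intro exI[of _ "if q = p then 1 else 0"]) auto
  then show ?case using 0 by blast
next
  case (Suc k)
  obtain \<tau>' where \<tau>': "\<tau>' \<in> T k" "\<tau> \<subseteq> \<tau>'" using nested[OF Suc.prems] by blast
  obtain \<tau>0 where \<tau>0: "\<tau>0 \<in> T 0" "\<tau>' \<subseteq> \<tau>0"
    and IH: "\<And>p q. p \<in> corners \<tau>0 \<Longrightarrow> q \<in> corners \<tau>' \<Longrightarrow> \<exists>m::int. bary \<tau>0 p q = of_int m / 2 ^ k"
    using Suc.IH[OF \<tau>'(1)] by blast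
  have "\<exists>m::int. bary \<tau>0 p q = of_int m / 2 ^ Suc k" if p: "p \<in> corners \<tau>0" and q: "q \<in> corners \<tau>" for p q
  proof -
    have "q \<in> corners \<tau>' \<union> edge_midpoints \<tau>'" using nested_corners[OF Suc.prems \<tau>'] q by blast
    then show ?thesis
    proof
      assume "q \<in> corners \<tau>'"
      then obtain m :: int where "bary \<tau>0 p q = of_int m / 2 ^ k" using IH[OF p] by blast
      then show ?thesis by (intro exI[of _ "2 * m"]) simp
    next
      assume "q \<in> edge_midpoints \<tau>'"
      then obtain x y where xy: "q = midpoint x y" "closed_segment x y edge_of \<tau>'"
        unfolding edge_midpoints_def by blast
      have face: "closed_segment x y face_of \<tau>'" using xy(2) unfolding edge_of_def by blast
      have "x \<in> corners \<tau>'" "y \<in> corners \<tau>'"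
        using extreme_point_of_face[OF face] extreme_point_of_segment unfolding corners_def by blast+
      then obtain m n :: int where mn: "bary \<tau>0 p x = of_int m / 2 ^ k" "bary \<tau>0 p y = of_int n / 2 ^ k"
        using IH[OF p] by blast
      have "q = (1 - 1 / 2) *\<^sub>R x + (1 / 2) *\<^sub>R y" by (simp add: xy(1) midpoint_def scaleR_add_right)
      then have "bary \<tau>0 p q = (1 - 1 / 2) * bary \<tau>0 p x + 1 / 2 * bary \<tau>0 p y"
        using bary_segment[OF simplex_T[OF \<tau>0(1)] p] by blast
      then show ?thesis using mn by (intro exI[of _ "m + n"]) (simp add: add_divide_distrib)
    qed
  qed
  then show ?case using \<tau>0 \<tau>'(2) by blast
qed

lemma diameter_lower: "\<exists>c>0. \<forall>k. \<forall>\<tau>\<in>T k. c / 2 ^ k \<le> diameter \<tau>"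
proof -
  have "\<exists>a b. \<forall>x. bary \<tau> p x = a \<bullet> x + b" if "\<tau> \<in> T 0" "p \<in> corners \<tau>" for \<tau> p
    using bary_affine_delta[OF simplex_T[OF that(1)] that(2)] by (rule conjunct1)
  then obtain a b where ab: "\<And>\<tau> p x. \<tau> \<in> T 0 \<Longrightarrow> p \<in> corners \<tau> \<Longrightarrow> bary \<tau> p x = a \<tau> p \<bullet> x + b \<tau> p"
    by metis
  define L where "L = 1 + (\<Sum>\<tau>\<in>T 0. \<Sum>p\<in>corners \<tau>. norm (a \<tau> p))"
  have L: "norm (a \<tau> p) \<le> L" if "\<tau> \<in> T 0" "p \<in> corners \<tau>" for \<tau> p
  proof -
    have "norm (a \<tau> p) \<le> (\<Sum>p\<in>corners \<tau>. norm (a \<tau> p))"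
      using that corners_simplex(1)[OF simplex_T[OF that(1)]] by (intro member_le_sum) auto
    also have "\<dots> \<le> (\<Sum>\<tau>\<in>T 0. \<Sum>p\<in>corners \<tau>. norm (a \<tau> p))"
      using that finite_T by (intro member_le_sum) (auto intro: sum_nonneg)
    finally show ?thesis by (simp add: L_def)
  qed
  have L1: "0 < L" unfolding L_def by (intro add_pos_nonneg sum_nonneg) auto
  have "(1 / L) / 2 ^ k \<le> diameter \<tau>" if \<tau>: "\<tau> \<in> T k" for k \<tau>
  proof -
    obtain \<tau>0 where \<tau>0: "\<tau>0 \<in> T 0" "\<tau> \<subseteq> \<tau>0"
      and dy: "\<And>p q. p \<in> corners \<tau>0 \<Longrightarrow> q \<in> corners \<tau> \<Longrightarrow> \<exists>m::int. bary \<tau>0 p q = of_int m / 2 ^ k"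
      using dyadic_coordinates[OF \<tau>] by blast
    obtain u v where uv: "u \<in> corners \<tau>" "v \<in> corners \<tau>" "u \<noteq> v" "diameter \<tau> = norm (u - v)"
      by (rule simplex_diameter[OF simplex_T[OF \<tau>]])
    have "\<exists>p\<in>corners \<tau>0. bary \<tau>0 p u \<noteq> bary \<tau>0 p v"
    proof (rule ccontr)
      assume "\<not> ?thesis"
      then have "(\<Sum>p\<in>corners \<tau>0. bary \<tau>0 p u *\<^sub>R p) = (\<Sum>p\<in>corners \<tau>0. bary \<tau>0 p v *\<^sub>R p)"
        by (intro sum.cong) auto
      then show False using uv(3) bary_representation(2)[OF simplex_T[OF \<tau>0(1)]] by simp
    qed
    then obtain p where p: "p \<in> corners \<tau>0" "bary \<tau>0 p u \<noteq> bary \<tau>0 p v" by blast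
    obtain m n :: int where mn: "bary \<tau>0 p u = of_int m / 2 ^ k" "bary \<tau>0 p v = of_int n / 2 ^ k"
      using dy[OF p(1)] uv by blast
    then have "m \<noteq> n" using p(2) by auto
    then have "1 \<le> \<bar>m - n\<bar>" by linarith
    then have "(1::real) \<le> \<bar>of_int m - of_int n\<bar>" by (metis of_int_1_le_iff of_int_abs of_int_diff)
    then have "1 / 2 ^ k \<le> \<bar>bary \<tau>0 p u - bary \<tau>0 p v\<bar>"
      unfolding mn by (simp add: divide_right_mono flip: diff_divide_distrib)
    also have "\<dots> = \<bar>a \<tau>0 p \<bullet> (u - v)\<bar>" by (simp add: ab[OF \<tau>0(1) p(1)] inner_diff_right)
    also have "\<dots> \<le> norm (a \<tau>0 p) * norm (u - v)" by (rule Cauchy_Schwarz_ineq2)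
    also have "\<dots> \<le> L * norm (u - v)" by (intro mult_right_mono L \<tau>0 p) auto
    finally show ?thesis using L1 uv(4) by (simp add: field_simps)
  qed
  then show ?thesis using L1 by (intro exI[of _ "1 / L"]) auto
qed

end

theorem corollary9p2:
  fixes \<Omega> :: "(real ^ 'd) set" and T :: "nat \<Rightarrow> (real ^ 'd) set set"
  assumes "CARD('d) = 2 \<or> CARD('d) = 3"
    and "polyhedral_domain \<Omega>"
    and "red_green_refinement \<Omega> T"
  shows "\<exists>c::real. \<forall>J. \<forall>u \<in> fe_space \<Omega> (T J). \<forall>k\<le>J.
           h1_norm \<Omega> (l2_projection \<Omega> (fe_space \<Omega> (T k)) u) \<le> c * h1_norm \<Omega> u"
proof -
  interpret red_green_refinement \<Omega> T by (rule assms(3))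
  have dim: "DIM(real ^ 'd) = 2 \<or> DIM(real ^ 'd) = 3" using assms(1) by simp
  note mesh = fe_mesh_T[OF assms(2)]
  obtain \<kappa> where \<kappa>: "\<And>j \<tau>. \<tau> \<in> T j \<Longrightarrow> regular_corners (corners \<tau>) \<kappa>" using uniformly_regular by blast
  obtain C where C: "0 \<le> C" "\<And>j \<tau>. \<tau> \<in> T j \<Longrightarrow> level T \<tau> = j \<Longrightarrow> diameter \<tau> \<le> C / 2 ^ j"
    using diameter_upper[OF dim] by blast
  obtain c where c: "0 < c" "\<And>k \<tau>. \<tau> \<in> T k \<Longrightarrow> c / 2 ^ k \<le> diameter \<tau>" using diameter_lower by blast
  obtain r1 D1 where r1: "0 < r1"
    "\<And>p t. p \<in> frontier \<Omega> \<Longrightarrow> 0 < t \<Longrightarrow> t \<le> 1 \<Longrightarrow> \<exists>s. dist s p \<le> D1 * t \<and> ball s (r1 * t) \<inter> \<Omega> = {}"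
    using fe_mesh.exterior_balls[OF mesh[of 0]] by blast
  define \<rho> where "\<rho> = (1 - \<kappa>\<^sup>2)\<^sup>2 / (real DIM(real ^ 'd) + 1)"
  have fat: "\<exists>s. ball s (\<rho> * diameter \<tau>) \<subseteq> \<tau>" if "\<tau> \<in> T k" for \<tau> k
    unfolding \<rho>_def by (rule regular_simplex_fat[OF simplex_T[OF that] dim \<kappa>[OF that]])
  have "T 0 \<noteq> {}"
    using partition[of 0] assms(2) closure_subset[of \<Omega>] unfolding simplicial_partition_def polyhedral_domain_def by auto
  then obtain \<tau>0 where "\<tau>0 \<in> T 0" by blast
  then have "0 < 1 - \<kappa>\<^sup>2" using regular_corners.\<mu>(1)[OF \<kappa>] regular_corners.\<mu>_def[OF \<kappa>] by metis
  then have \<rho>: "0 < \<rho>" unfolding \<rho>_def by (intro divide_pos_pos zero_less_power) auto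
  define r0 where "r0 = min r1 (min (\<rho> * c) \<rho>)"
  define D where "D = max D1 1"
  have r0: "0 < r0" "r0 \<le> r1" "r0 \<le> \<rho> * c" "r0 \<le> \<rho>" using r1(1) \<rho> c(1) unfolding r0_def by auto
  define n where "n = DIM(real ^ 'd)"
  define B where "B = ball_measure TYPE(real ^ 'd) 1"
  define K where "K = 2 + 10 * (16 * (4 / \<rho>) ^ n / (\<rho> * c)\<^sup>2) *
    ((8 * 2 ^ n + 2) / (B * r0 ^ n) * B * (C + D + r0) ^ n * (C + D + r0)\<^sup>2)"
  have "h1_norm \<Omega> (l2_projection \<Omega> (fe_space \<Omega> (T k)) u) \<le> sqrt K * h1_norm \<Omega> u"
    if u: "u \<in> fe_space \<Omega> (T J)" and kJ: "k \<le> J" for J u k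
  proof -
    define h :: real where "h = 1 / 2 ^ k"
    have h: "0 < h" "h \<le> 1" by (auto simp: h_def)
    interpret coarse: fe_mesh \<Omega> "T k" by (rule mesh)
    interpret fine: fe_mesh \<Omega> "T J" by (rule mesh)
    interpret mesh_pair \<Omega> "T k" "T J" \<rho> c C D r0 h
    proof unfold_locales
      show "c * h \<le> diameter \<tau>" if "\<tau> \<in> T k" for \<tau> using c(2)[OF that] by (simp add: h_def)
      show "diameter \<tau> \<le> C * h" if "\<tau> \<in> T k" "\<tau> \<notin> T J" for \<tau>
        using C(2)[OF that(1) level_eq_if_refined[OF that kJ]] by (simp add: h_def)
      show "\<exists>s. dist s p \<le> D * h \<and> ball s (r0 * h) \<inter> \<Omega> = {}" if p: "p \<in> frontier \<Omega>" for p
      proof -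
        obtain s where s: "dist s p \<le> D1 * h" "ball s (r1 * h) \<inter> \<Omega> = {}" using r1(2)[OF p h] by blast
        have "D1 * h \<le> D * h" "r0 * h \<le> r1 * h" using h r0 unfolding D_def by (auto intro: mult_right_mono)
        then show ?thesis using s subset_ball[of "r0 * h" "r1 * h" s] by (intro exI[of _ s]) auto
      qed
    qed (use \<rho> c(1) C(1) h r0 fat in \<open>auto simp: D_def\<close>)
    show ?thesis
      using projection_h1_norm[OF u] unfolding A1_def K3_def K2_def K_def n_def B_def .
  qed
  then show ?thesis by blast
qed

end
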